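(* Suppose $n\ge 2$ is even. The Cohen–Westreich matrices $S_{CW}$ and $T_{CW}$ on the Higman ideal of $D\mathcal{K}_n$ are $$S_{CW}=(-1)^{n/2}\begin{pmatrix}0&2^{-n}&-2^{-n}\\2^{n-1}&1/2&1/2\\-2^{n-1}&1/2&1/2\end{pmatrix},\qquad T_{CW}=\begin{pmatrix}1&0&0\\0&1&0\\0&0&-1\end{pmatrix}.$$
   Context: $H=D\mathcal{K}_n$ (Drinfeld double of the Nichols Hopf algebra $\mathcal{K}_n$) is the $2^{2n+2}$-dimensional complex Hopf algebra with generators $K,\bar K,\xi_i,\bar\xi_i$ ($1\le i\le n$) and relations $K^2=\bar K^2=(K\bar K)^2=1$, $\xi_i^2=\bar\xi_i^2=0$; $K$ and $\bar K$ each anticommute with every $\xi_i$ and $\bar\xi_i$; $\xi_i\xi_j=-\xi_j\xi_i$, $\bar\xi_i\bar\xi_j=-\bar\xi_j\bar\xi_i$; $\xi_i\bar\xi_j=-\bar\xi_j\xi_i$ for $i\ne j$; $\xi_i\bar\xi_i=1-K\bar K-\bar\xi_i\xi_i$; $\Delta(K)=K\otimes K$, $\Delta(\bar K)=\bar K\otimes\bar K$, $\Delta(\xi_i)=K\otimes\xi_i+\xi_i\otimes1$, $\Delta(\bar\xi_i)=\bar K\otimes\bar\xi_i+\bar\xi_i\otimes1$, $S(K)=K$, $S(\bar K)=\bar K$, $S(\xi_i)=-K\xi_i$, $S(\bar\xi_i)=-\bar K\bar\xi_i$. Let $W$ be the set of words $w=\xi_{i_1}\cdots\xi_{i_k}$,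 $i_1<\dots<i_k$, $k\ge0$; $|w|=k$, $\bar w=\bar\xi_{i_1}\cdots\bar\xi_{i_k}$. $R$-matrix: $R=\sum_{w\in W}(-1)^{\lfloor|w|/2\rfloor}(w\otimes\bar w\bar K^{|w|})\cdot\frac12(1\otimes1+K\otimes1+1\otimes\bar K-K\otimes\bar K)$. Ribbon element: $\nu=(1+K-\bar K+K\bar K)\sum_{w\in W}\frac{(-1)^{\lfloor(|w|+1)/2\rfloor}}{2}w\bar w$. Balancing element $G=K$. Integral: $\Lambda=\frac12(1+K+\bar K+K\bar K)\xi_1\cdots\xi_n\bar\xi_1\cdots\bar\xi_n$. Primitive idempotents: $e_1=\frac14(1+K+\bar K+K\bar K)$, $e_K=\frac{(-1)^{n/2}}{2^{n+2}}(1+K-\bar K-K\bar K)\xi_1\cdots\xi_n\bar\xi_1\cdots\bar\xi_n$, $e_{\bar K}=\frac{(-1)^{n/2}}{2^{n+2}}(1-K+\bar K-K\bar K)\xi_1\cdots\xi_n\bar\xi_1\cdots\bar\xi_n$; let $p_1,p_K,p_{\bar K}$ be the characters of the left modules $He_1,He_K,He_{\bar K}$. The shifted Drinfeld map is $\hat f_Q(\beta)=(\hat\beta\otimes\mathrm{id})(R_{21}R)$, where $\hat\beta(x)=\beta(Kx)$, and the trace map is $\tau(x)=\sum S(\Lambda_{(2)})x\Lambda_{(1)}G^{-1}$. The Higman ideal $\mathrm{Hig}(H)$ is the image of $\tau$, with bases $B_\chi=\{\hat f_Q(p_1),\hat f_Q(p_K),\hat f_Q(p_{\bar K})\}$ and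 $B_\tau=\{\tau(e_1),\tau(e_K),\tau(e_{\bar K})\}$. The matrix $S_{CW}$ is the change of basis matrix: $\tau(e_j)=\sum_k (S_{CW})_{kj}\hat f_Q(p_k)$, with indices ordered $1,K,\bar K$. The matrix $T_{CW}$ is the matrix of $T_{LM}(x)=\nu x$ on $\mathrm{Hig}(H)$ with respect to the basis $B_\tau$. *)

theory Defs
  imports "HOL-Analysis.Analysis" "HOL-Library.Poly_Mapping"
begin

section \<open>Complex algebras\<close>

class complex_algebra_1 = ring_1 +
  fixes scaleC :: "complex \<Rightarrow> 'a \<Rightarrow> 'a"  (infixr "*\<^sub>C" 75)
  assumes scaleC_add_right: "c *\<^sub>C (x + y) = c *\<^sub>C x + c *\<^sub>C y"
    and scaleC_add_left: "(c + d) *\<^sub>C x = c *\<^sub>C x + d *\<^sub>C x"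
    and scaleC_scaleC: "c *\<^sub>C (d *\<^sub>C x) = (c * d) *\<^sub>C x"
    and scaleC_one: "1 *\<^sub>C x = x"
    and mult_scaleC_left: "(c *\<^sub>C x) * y = c *\<^sub>C (x * y)"
    and mult_scaleC_right: "x * (c *\<^sub>C y) = c *\<^sub>C (x * y)"

global_interpretation cvs: vector_space "scaleC :: complex \<Rightarrow> 'a \<Rightarrow> 'a::complex_algebra_1"
  by unfold_locales (simp_all add: scaleC_add_right scaleC_add_left scaleC_scaleC scaleC_one)

abbreviation clinear :: "('a::complex_algebra_1 \<Rightarrow> 'b::complex_algebra_1) \<Rightarrow> bool"
  where "clinear \<equiv> Vector_Spaces.linear scaleC scaleC"

definition cbilinear ::
    "('a::complex_algebra_1 \<Rightarrow> 'b::complex_algebra_1 \<Rightarrow> 'c::complex_algebra_1) \<Rightarrow> bool"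
  where "cbilinear f \<longleftrightarrow> (\<forall>a. clinear (f a)) \<and> (\<forall>b. clinear (\<lambda>a. f a b))"

lemma clinearI:
  assumes "\<And>x y. f (x + y) = f x + f y" "\<And>c x. f (c *\<^sub>C x) = c *\<^sub>C f x"
  shows "clinear f"
  by unfold_locales (simp_all add: assms)

lemma clinear_add: "clinear f \<Longrightarrow> f (x + y) = f x + f y"
  and clinear_scale: "clinear f \<Longrightarrow> f (c *\<^sub>C x) = c *\<^sub>C f x"
  by (simp_all add: Vector_Spaces.linear_iff)

instantiation complex :: complex_algebra_1
begin
definition scaleC_complex :: "complex \<Rightarrow> complex \<Rightarrow> complex"
  where "scaleC_complex c x = c * x"
instance
  by intro_classes (simp_all add: scaleC_complex_def algebra_simps)
end

lemma exists_functional_one: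
  "\<exists>\<phi> :: 'a::complex_algebra_1 \<Rightarrow> complex. clinear \<phi> \<and> \<phi> 1 = 1"
proof -
  define B where "B = cvs.extend_basis {1 :: 'a}"
  have ind: "cvs.independent {1 :: 'a}" by (simp add: cvs.independent_insert)
  have B: "cvs.independent B" "cvs.span B = UNIV" "1 \<in> B"
    using cvs.independent_extend_basis[OF ind] cvs.span_extend_basis[OF ind]
      cvs.extend_basis_superset[OF ind] by (auto simp: B_def)
  have "clinear (\<lambda>x. cvs.representation B x 1)"
    using B by (intro clinearI)
      (simp_all add: cvs.representation_add cvs.representation_scale scaleC_complex_def)
  moreover have "cvs.representation B 1 1 = 1"
    using B by (simp add: cvs.representation_basis)
  ultimately show ?thesis by blast
qed

definition unit_inv :: "'a::monoid_mult \<Rightarrow> 'a"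
  where "unit_inv g = (THE h. g * h = 1 \<and> h * g = 1)"

text \<open>Trace of an endomorphism of a finite-dimensional subspace \<open>V\<close>.\<close>

definition trace_on :: "'a::complex_algebra_1 set \<Rightarrow> ('a \<Rightarrow> 'a) \<Rightarrow> complex"
  where "trace_on V f =
    (let B = (SOME B. cvs.independent B \<and> cvs.span B = V)
     in \<Sum>b\<in>B. cvs.representation B (f b) b)"

definition left_ideal :: "'a::complex_algebra_1 \<Rightarrow> 'a set"
  where "left_ideal e = range (\<lambda>h. h * e)"

definition module_character :: "'a::complex_algebra_1 set \<Rightarrow> 'a \<Rightarrow> complex"
  where "module_character V x = trace_on V (\<lambda>v. x * v)"

text \<open>Families indexed by a finite type serve as ordered bases.\<close>

definition ordered_basis :: "('a::complex_algebra_1)^'m \<Rightarrow> 'a set \<Rightarrow> bool"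
  where "ordered_basis b V \<longleftrightarrow>
    inj (\<lambda>k. b $ k) \<and> cvs.independent (range (\<lambda>k. b $ k)) \<and> cvs.span (range (\<lambda>k. b $ k)) = V"

text \<open>Column \<open>j\<close> of this matrix consists of the coordinates of \<open>v $ j\<close>
  with respect to the ordered basis \<open>b\<close>.\<close>

definition coord_matrix ::
    "('a::complex_algebra_1)^'m \<Rightarrow> 'a^'m \<Rightarrow> complex^'m^'m"
  where "coord_matrix b v = (THE M. \<forall>j. v $ j = (\<Sum>k\<in>UNIV. M $ k $ j *\<^sub>C b $ k))"


section \<open>Quotients of monoid algebras\<close>

text \<open>
  The type \<open>'k \<Rightarrow>\<^sub>0 complex\<close> is the monoid algebra of the additively written,
  not necessarily commutative, monoid \<open>'k\<close>.
\<close>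

inductive_set ideal_gen :: "'r::ring_1 set \<Rightarrow> 'r set" for X
  where ideal_gen_zero: "0 \<in> ideal_gen X"
  | ideal_gen_base: "x \<in> X \<Longrightarrow> a * x * b \<in> ideal_gen X"
  | ideal_gen_add: "x \<in> ideal_gen X \<Longrightarrow> y \<in> ideal_gen X \<Longrightarrow> x + y \<in> ideal_gen X"

lemma ideal_gen_mult_left: "x \<in> ideal_gen X \<Longrightarrow> a * x \<in> ideal_gen X"
proof (induction rule: ideal_gen.induct)
  case (ideal_gen_base x c b)
  then have "(a * c) * x * b \<in> ideal_gen X" by (rule ideal_gen.ideal_gen_base)
  then show ?case by (simp add: mult.assoc)
qed (auto simp: distrib_left intro: ideal_gen.intros)

lemma ideal_gen_mult_right: "x \<in> ideal_gen X \<Longrightarrow> x * a \<in> ideal_gen X"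
proof (induction rule: ideal_gen.induct)
  case (ideal_gen_base x c b)
  then have "c * x * (b * a) \<in> ideal_gen X" by (rule ideal_gen.ideal_gen_base)
  then show ?case by (simp add: mult.assoc)
qed (auto simp: distrib_right intro: ideal_gen.intros)

lemma ideal_gen_uminus: "x \<in> ideal_gen X \<Longrightarrow> - x \<in> ideal_gen X"
  using ideal_gen_mult_left[of x X "- 1"] by simp

lemma ideal_gen_incl: "x \<in> X \<Longrightarrow> x \<in> ideal_gen X"
  using ideal_gen_base[of x X 1 1] by simp

definition ideal_cong :: "'r::ring_1 set \<Rightarrow> 'r \<Rightarrow> 'r \<Rightarrow> bool"
  where "ideal_cong X x y \<longleftrightarrow> x - y \<in> ideal_gen X"

lemma equivp_ideal_cong: "equivp (ideal_cong X)"
proof (rule equivpI)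
  show "reflp (ideal_cong X)"
    by (simp add: reflp_def ideal_cong_def ideal_gen_zero)
  show "symp (ideal_cong X)"
    using ideal_gen_uminus by (fastforce simp: symp_def ideal_cong_def)
  show "transp (ideal_cong X)"
    using ideal_gen_add by (fastforce simp: transp_def ideal_cong_def)
qed

lemma ideal_cong_refl: "a = b \<Longrightarrow> ideal_cong X a b"
  by (simp add: ideal_cong_def ideal_gen_zero)

lemma ideal_cong_add: "ideal_cong X a b \<Longrightarrow> ideal_cong X c d \<Longrightarrow> ideal_cong X (a + c) (b + d)"
  using ideal_gen_add[of "a - b" X "c - d"] by (simp add: ideal_cong_def algebra_simps)

lemma ideal_cong_uminus: "ideal_cong X a b \<Longrightarrow> ideal_cong X (- a) (- b)"
  using ideal_gen_uminus[of "a - b" X] by (simp add: ideal_cong_def)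

lemma ideal_cong_diff: "ideal_cong X a b \<Longrightarrow> ideal_cong X c d \<Longrightarrow> ideal_cong X (a - c) (b - d)"
  using ideal_cong_add[of X a b "- c" "- d"] ideal_cong_uminus[of X c d] by simp

lemma ideal_cong_mult:
  assumes "ideal_cong X a b" "ideal_cong X c d"
  shows "ideal_cong X (a * c) (b * d)"
proof -
  have "(a - b) * c + b * (c - d) \<in> ideal_gen X"
    using assms by (intro ideal_gen_add ideal_gen_mult_left ideal_gen_mult_right)
      (simp_all add: ideal_cong_def)
  then show ?thesis by (simp add: ideal_cong_def algebra_simps)
qed

definition scal :: "complex \<Rightarrow> ('k::monoid_add \<Rightarrow>\<^sub>0 complex) \<Rightarrow> 'k \<Rightarrow>\<^sub>0 complex"
  where "scal c p = Poly_Mapping.single 0 c * p"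

lemma scal_single: "scal c (Poly_Mapping.single k d) = Poly_Mapping.single k (c * d)"
  by (simp add: scal_def mult_single)

lemma scal_add_right: "scal c (p + q) = scal c p + scal c q"
  by (simp add: scal_def distrib_left)

lemma scal_add_left: "scal (c + d) p = scal c p + scal d p"
  by (simp add: scal_def distrib_right single_add)

lemma scal_scal: "scal c (scal d p) = scal (c * d) p"
  by (simp add: scal_def mult_single flip: mult.assoc)

lemma scal_one: "scal 1 p = p"
  by (simp add: scal_def)

lemma scal_mult_left: "scal c p * q = scal c (p * q)"
  by (simp add: scal_def mult.assoc)

lemma monoid_algebra_induct [case_names zero single add]:
  fixes p :: "'k \<Rightarrow>\<^sub>0 complex"
  assumes "P 0" "\<And>k c. P (Poly_Mapping.single k c)" "\<And>p q. P p \<Longrightarrow> P q \<Longrightarrow> P (p + q)"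
  shows "P p"
proof (induction p rule: Poly_Mapping.update_induct)
  case const
  show ?case by (rule assms)
next
  case (update p k c)
  have "Poly_Mapping.update k c p = p + Poly_Mapping.single k c"
    using update(1)
    by (intro poly_mapping_eqI)
      (auto simp: lookup_update lookup_add lookup_single in_keys_iff when_def)
  then show ?case using assms update by simp
qed

lemma scal_mult_right: "p * scal c q = scal c (p * q)"
proof (induction p rule: monoid_algebra_induct)
  case (single k d)
  show ?case
    by (induction q rule: monoid_algebra_induct)
      (simp_all add: scal_add_right distrib_left scal_single mult_single mult.left_commute, simp add: scal_def)
qed (simp_all add: scal_def distrib_left distrib_right)

lemma ideal_cong_scal: "ideal_cong X p q \<Longrightarrow> ideal_cong X (scal c p) (scal c q)"
  unfolding scal_def by (intro ideal_cong_mult) (simp_all add: ideal_cong_def ideal_gen_zero)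

definition lin_ext :: "('k \<Rightarrow> 'a::complex_algebra_1) \<Rightarrow> ('k \<Rightarrow>\<^sub>0 complex) \<Rightarrow> 'a"
  where "lin_ext g p = (\<Sum>k\<in>Poly_Mapping.keys p. Poly_Mapping.lookup p k *\<^sub>C g k)"

lemma lin_ext_superset:
  assumes "finite A" "Poly_Mapping.keys p \<subseteq> A"
  shows "lin_ext g p = (\<Sum>k\<in>A. Poly_Mapping.lookup p k *\<^sub>C g k)"
  unfolding lin_ext_def
  by (rule sum.mono_neutral_left) (use assms in \<open>auto simp: in_keys_iff\<close>)

lemma lin_ext_zero [simp]: "lin_ext g 0 = 0"
  by (simp add: lin_ext_def)

lemma lin_ext_add: "lin_ext g (p + q) = lin_ext g p + lin_ext g q"
proof -
  let ?A = "Poly_Mapping.keys p \<union> Poly_Mapping.keys q"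
  have "Poly_Mapping.keys (p + q) \<subseteq> ?A" by (rule Poly_Mapping.keys_add)
  then show ?thesis
    by (simp add: lin_ext_superset[of ?A] lookup_add scaleC_add_left sum.distrib)
qed

lemma lin_ext_single [simp]: "lin_ext g (Poly_Mapping.single k c) = c *\<^sub>C g k"
  by (simp add: lin_ext_def)

lemma lin_ext_uminus: "lin_ext g (- p) = - lin_ext g p"
  using lin_ext_add[of g p "- p"] by (simp add: eq_neg_iff_add_eq_0 add.commute)

lemma lin_ext_diff: "lin_ext g (p - q) = lin_ext g p - lin_ext g q"
  using lin_ext_add[of g p "- q"] by (simp add: lin_ext_uminus)

lemma lin_ext_scal: "lin_ext g (scal c p) = c *\<^sub>C lin_ext g p"
  by (induction p rule: monoid_algebra_induct)
    (simp_all add: scal_add_right lin_ext_add scaleC_add_right scal_single scaleC_scaleC, simp add: scal_def)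

lemma lin_ext_mult:
  assumes "\<And>k l. g (k + l) = g k * g l"
  shows "lin_ext g (p * q) = lin_ext g p * lin_ext g q"
proof (induction p rule: monoid_algebra_induct)
  case (single k c)
  show ?case
    by (induction q rule: monoid_algebra_induct)
      (simp_all add: mult_single assms mult_scaleC_left mult_scaleC_right scaleC_scaleC
        lin_ext_add distrib_left)
qed (simp_all add: lin_ext_add distrib_right)

lemma lin_ext_mult_anti:
  assumes "\<And>k l. g (k + l) = g l * g k"
  shows "lin_ext g (p * q) = lin_ext g q * lin_ext g p"
proof (induction p rule: monoid_algebra_induct)
  case (single k c)
  show ?case
    by (induction q rule: monoid_algebra_induct)
      (simp_all add: mult_single assms mult_scaleC_left mult_scaleC_right scaleC_scaleC
        lin_ext_add distrib_left distrib_right scaleC_add_right mult.commute)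
qed (simp_all add: lin_ext_add distrib_right distrib_left)

lemma lin_ext_ideal_cong:
  assumes "\<And>a x b. x \<in> X \<Longrightarrow> lin_ext g (a * x * b) = 0" "ideal_cong X p q"
  shows "lin_ext g p = lin_ext g q"
proof -
  have "lin_ext g y = 0" if "y \<in> ideal_gen X" for y
    using that by induction (simp_all add: assms(1) lin_ext_add)
  then show ?thesis
    using assms(2) by (metis ideal_cong_def lin_ext_diff right_minus_eq)
qed


section \<open>Tensor products of algebras\<close>

text \<open>Products of basis vectors in the monoid algebra of \<open>('a, 'b) pure\<close>
  follow the rule \<open>(a \<otimes> b) (c \<otimes> d) = a c \<otimes> b d\<close>.\<close>

datatype ('a, 'b) pure = Pure 'a 'b

instantiation pure :: (monoid_mult, monoid_mult) monoid_add
begin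

definition zero_pure :: "('a, 'b) pure"
  where "0 = Pure 1 1"

fun plus_pure :: "('a, 'b) pure \<Rightarrow> ('a, 'b) pure \<Rightarrow> ('a, 'b) pure"
  where "Pure a b + Pure c d = Pure (a * c) (b * d)"

instance
proof
  fix x y z :: "('a, 'b) pure"
  show "x + y + z = x + (y + z)" by (cases x; cases y; cases z) (simp add: mult.assoc)
  show "0 + x = x" by (cases x) (simp add: zero_pure_def)
  show "x + 0 = x" by (cases x) (simp add: zero_pure_def)
qed

end

abbreviation psingle :: "'a \<Rightarrow> 'b \<Rightarrow> ('a, 'b) pure \<Rightarrow>\<^sub>0 complex"
  where "psingle a b \<equiv> Poly_Mapping.single (Pure a b) 1"

text \<open>The subspace spanned by these elements is already a two-sided ideal.\<close>

inductive_set bilinear_rels ::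
    "(('a::complex_algebra_1, 'b::complex_algebra_1) pure \<Rightarrow>\<^sub>0 complex) set"
  where
    bilinear_add_left: "psingle (a + a') b - (psingle a b + psingle a' b) \<in> bilinear_rels"
  | bilinear_add_right: "psingle a (b + b') - (psingle a b + psingle a b') \<in> bilinear_rels"
  | bilinear_scale_left: "psingle (c *\<^sub>C a) b - scal c (psingle a b) \<in> bilinear_rels"
  | bilinear_scale_right: "psingle a (c *\<^sub>C b) - scal c (psingle a b) \<in> bilinear_rels"

lemma psingle_mult:
  "Poly_Mapping.single (Pure a b) c * Poly_Mapping.single (Pure a' b') c' =
    Poly_Mapping.single (Pure (a * a') (b * b')) (c * c')"
  by (simp add: mult_single)

lemma lin_ext_bilinear_rels:
  fixes f :: "'a::complex_algebra_1 \<Rightarrow> 'b::complex_algebra_1 \<Rightarrow> 'c::complex_algebra_1"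
  assumes f: "cbilinear f" and x: "x \<in> bilinear_rels"
  shows "lin_ext (case_pure f) (p * x * q) = 0"
proof -
  have l: "clinear (f a)" "clinear (\<lambda>a. f a b)" for a b
    using f by (auto simp: cbilinear_def)
  note f_simps = l[THEN clinear_add] l[THEN clinear_scale]
  have *: "lin_ext (case_pure f) (Poly_Mapping.single k c * x * Poly_Mapping.single l d) = 0"
    for k c l d
    using x by (cases k; cases l; cases rule: bilinear_rels.cases)
      (auto simp: psingle_mult scal_single left_diff_distrib right_diff_distrib
        distrib_left distrib_right lin_ext_add lin_ext_diff f_simps mult_scaleC_left mult_scaleC_right
        scaleC_scaleC scaleC_add_right mult_ac)
  have **: "lin_ext (case_pure f) (Poly_Mapping.single k c * x * q) = 0" for k c
    by (induction q rule: monoid_algebra_induct) (simp_all add: * distrib_left lin_ext_add)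
  show ?thesis
    by (induction p rule: monoid_algebra_induct) (simp_all add: ** distrib_right lin_ext_add)
qed

lemma lin_ext_tensor_cong:
  assumes "cbilinear f" "ideal_cong bilinear_rels p q"
  shows "lin_ext (case_pure f) p = lin_ext (case_pure f) q"
  using assms by (intro lin_ext_ideal_cong[OF lin_ext_bilinear_rels])

quotient_type (overloaded) ('a, 'b) tensor =
    "('a::complex_algebra_1, 'b::complex_algebra_1) pure \<Rightarrow>\<^sub>0 complex" / "ideal_cong bilinear_rels"
  by (rule equivp_ideal_cong)


instantiation tensor :: (complex_algebra_1, complex_algebra_1) complex_algebra_1
begin

lift_definition zero_tensor :: "('a, 'b) tensor" is 0 .
lift_definition one_tensor :: "('a, 'b) tensor" is 1 .
lift_definition plus_tensor :: "('a, 'b) tensor \<Rightarrow> ('a, 'b) tensor \<Rightarrow> ('a, 'b) tensor"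
  is "(+)" by (rule ideal_cong_add)
lift_definition uminus_tensor :: "('a, 'b) tensor \<Rightarrow> ('a, 'b) tensor"
  is uminus by (rule ideal_cong_uminus)
lift_definition minus_tensor :: "('a, 'b) tensor \<Rightarrow> ('a, 'b) tensor \<Rightarrow> ('a, 'b) tensor"
  is "(-)" by (rule ideal_cong_diff)
lift_definition times_tensor :: "('a, 'b) tensor \<Rightarrow> ('a, 'b) tensor \<Rightarrow> ('a, 'b) tensor"
  is "(*)" by (rule ideal_cong_mult)
lift_definition scaleC_tensor :: "complex \<Rightarrow> ('a, 'b) tensor \<Rightarrow> ('a, 'b) tensor"
  is scal by (rule ideal_cong_scal)

instance
proof
  fix x y z :: "('a, 'b) tensor" and c d :: complex
  show "x + y + z = x + (y + z)" by transfer (rule ideal_cong_refl, simp add: algebra_simps)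
  show "x + y = y + x" by transfer (rule ideal_cong_refl, simp add: algebra_simps)
  show "0 + x = x" by transfer (rule ideal_cong_refl, simp)
  show "- x + x = 0" by transfer (rule ideal_cong_refl, simp)
  show "x - y = x + - y" by transfer (rule ideal_cong_refl, simp)
  show "x * y * z = x * (y * z)" by transfer (rule ideal_cong_refl, simp add: mult.assoc)
  show "(x + y) * z = x * z + y * z" by transfer (rule ideal_cong_refl, simp add: distrib_right)
  show "x * (y + z) = x * y + x * z" by transfer (rule ideal_cong_refl, simp add: distrib_left)
  show "1 * x = x" by transfer (rule ideal_cong_refl, simp)
  show "x * 1 = x" by transfer (rule ideal_cong_refl, simp)
  show "c *\<^sub>C (x + y) = c *\<^sub>C x + c *\<^sub>C y"
    by transfer (rule ideal_cong_refl, simp add: scal_add_right)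
  show "(c + d) *\<^sub>C x = c *\<^sub>C x + d *\<^sub>C x"
    by transfer (rule ideal_cong_refl, simp add: scal_add_left)
  show "c *\<^sub>C (d *\<^sub>C x) = (c * d) *\<^sub>C x"
    by transfer (rule ideal_cong_refl, simp add: scal_scal)
  show "1 *\<^sub>C x = x" by transfer (rule ideal_cong_refl, simp add: scal_one)
  show "c *\<^sub>C x * y = c *\<^sub>C (x * y)"
    by transfer (rule ideal_cong_refl, simp add: scal_mult_left)
  show "x * c *\<^sub>C y = c *\<^sub>C (x * y)"
    by transfer (rule ideal_cong_refl, simp add: scal_mult_right)
  obtain \<phi> :: "'a \<Rightarrow> complex" and \<psi> :: "'b \<Rightarrow> complex"
    where *: "clinear \<phi>" "\<phi> 1 = 1" "clinear \<psi>" "\<psi> 1 = 1"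
    using exists_functional_one by metis
  have "cbilinear (\<lambda>a b. \<phi> a * \<psi> b)"
    unfolding cbilinear_def
    by (auto intro!: clinearI simp: clinear_add[OF *(1)] clinear_add[OF *(3)] clinear_scale[OF *(1)]
        clinear_scale[OF *(3)] scaleC_complex_def algebra_simps)
  note cong = lin_ext_tensor_cong[OF this]
  have "lin_ext (case_pure (\<lambda>a b. \<phi> a * \<psi> b)) 1 = 1"
    by (simp add: * scaleC_one zero_pure_def flip: single_one)
  with cong[of 0 1] have "\<not> ideal_cong bilinear_rels (0 :: ('a, 'b) pure \<Rightarrow>\<^sub>0 complex) 1"
    by auto
  then show "(0 :: ('a, 'b) tensor) \<noteq> 1"
    by transfer
qed

end


lift_definition tensor_of :: "'a::complex_algebra_1 \<Rightarrow> 'b::complex_algebra_1 \<Rightarrow> ('a, 'b) tensor"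
    (infixr "\<otimes>\<^sub>C" 73)
  is psingle .

lemma tensor_mult: "(a \<otimes>\<^sub>C b) * (c \<otimes>\<^sub>C d) = (a * c) \<otimes>\<^sub>C (b * d)"
  by transfer (simp add: psingle_mult ideal_cong_refl)

lemma tensor_one: "1 \<otimes>\<^sub>C 1 = 1"
  by transfer (simp add: ideal_cong_refl flip: zero_pure_def)

lemma tensor_add_left: "(a + a') \<otimes>\<^sub>C b = a \<otimes>\<^sub>C b + a' \<otimes>\<^sub>C b"
  by transfer (simp only: ideal_cong_def, rule ideal_gen_incl, rule bilinear_add_left)

lemma tensor_add_right: "a \<otimes>\<^sub>C (b + b') = a \<otimes>\<^sub>C b + a \<otimes>\<^sub>C b'"
  by transfer (simp only: ideal_cong_def, rule ideal_gen_incl, rule bilinear_add_right)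

lemma tensor_scale_left: "(c *\<^sub>C a) \<otimes>\<^sub>C b = c *\<^sub>C (a \<otimes>\<^sub>C b)"
  by transfer (simp only: ideal_cong_def, rule ideal_gen_incl, rule bilinear_scale_left)

lemma tensor_scale_right: "a \<otimes>\<^sub>C (c *\<^sub>C b) = c *\<^sub>C (a \<otimes>\<^sub>C b)"
  by transfer (simp only: ideal_cong_def, rule ideal_gen_incl, rule bilinear_scale_right)

lemma tensor_zero [simp]: "0 \<otimes>\<^sub>C b = 0" "a \<otimes>\<^sub>C 0 = 0"
  using tensor_scale_left[of 0 0 b] tensor_scale_right[of a 0 0] by simp_all

lemma tensor_uminus [simp]:
  "(- a) \<otimes>\<^sub>C b = - (a \<otimes>\<^sub>C b)" "a \<otimes>\<^sub>C (- b) = - (a \<otimes>\<^sub>C b)"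
  using tensor_scale_left[of "-1" a b] tensor_scale_right[of a "-1" b] by simp_all

lemma tensor_diff_left: "(a - a') \<otimes>\<^sub>C b = a \<otimes>\<^sub>C b - a' \<otimes>\<^sub>C b"
  using tensor_add_left[of a "- a'" b] by simp

lemma tensor_diff_right: "a \<otimes>\<^sub>C (b - b') = a \<otimes>\<^sub>C b - a \<otimes>\<^sub>C b'"
  using tensor_add_right[of a b "- b'"] by simp

text \<open>The linear map induced by a bilinear map; the value for other maps is irrelevant.\<close>

lift_definition tensor_lift ::
    "('a::complex_algebra_1 \<Rightarrow> 'b::complex_algebra_1 \<Rightarrow> 'c::complex_algebra_1) \<Rightarrow>
      ('a, 'b) tensor \<Rightarrow> 'c"
  is "\<lambda>f p. if cbilinear f then lin_ext (case_pure f) p else 0"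
  using lin_ext_tensor_cong by auto

lemma clinear_tensor_lift: "clinear (tensor_lift f)"
  by (rule clinearI; transfer) (auto simp: lin_ext_add lin_ext_scal)

lemma tensor_lift_tensor_of: "cbilinear f \<Longrightarrow> tensor_lift f (a \<otimes>\<^sub>C b) = f a b"
  by transfer (simp add: scaleC_one)

definition tensor_swap ::
    "('a::complex_algebra_1, 'b::complex_algebra_1) tensor \<Rightarrow> ('b, 'a) tensor"
  where "tensor_swap = tensor_lift (\<lambda>a b. b \<otimes>\<^sub>C a)"


section \<open>The Drinfeld double of the Nichols Hopf algebra\<close>

text \<open>The linearly ordered index type \<open>'n\<close> stands for \<open>{1,\<dots>,n}\<close>, so \<open>n\<close> is \<open>CARD('n)\<close>.\<close>

datatype 'n gen = gK | gKb | gXi 'n | gXib 'n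

datatype 'g free_word = Word (letters: "'g list")

instantiation free_word :: (type) monoid_add
begin

definition zero_free_word :: "'a free_word"
  where "0 = Word []"

definition plus_free_word :: "'a free_word \<Rightarrow> 'a free_word \<Rightarrow> 'a free_word"
  where "v + w = Word (letters v @ letters w)"

instance
  by intro_classes (simp_all add: zero_free_word_def plus_free_word_def)

end

type_synonym 'g free_algebra = "'g free_word \<Rightarrow>\<^sub>0 complex"

definition fgen :: "'g \<Rightarrow> 'g free_algebra"
  where "fgen g = Poly_Mapping.single (Word [g]) 1"

definition free_hom :: "('g \<Rightarrow> 'a::complex_algebra_1) \<Rightarrow> 'g free_algebra \<Rightarrow> 'a"
  where "free_hom f = lin_ext (\<lambda>w. prod_list (map f (letters w)))"

definition free_antihom :: "('g \<Rightarrow> 'a::complex_algebra_1) \<Rightarrow> 'g free_algebra \<Rightarrow> 'a"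
  where "free_antihom f = lin_ext (\<lambda>w. prod_list (map f (rev (letters w))))"

lemma free_hom_simps:
  "free_hom f (p + q) = free_hom f p + free_hom f q"
  "free_hom f (p - q) = free_hom f p - free_hom f q"
  "free_hom f (p * q) = free_hom f p * free_hom f q"
  "free_hom f 0 = 0"
  "free_hom f 1 = 1"
  "free_hom f (fgen g) = f g"
  "free_hom f (scal c p) = c *\<^sub>C free_hom f p"
  by (simp_all add: free_hom_def lin_ext_add lin_ext_diff lin_ext_scal lin_ext_mult plus_free_word_def
      zero_free_word_def fgen_def scaleC_one flip: single_one)

lemma free_antihom_simps:
  "free_antihom f (p + q) = free_antihom f p + free_antihom f q"
  "free_antihom f (p - q) = free_antihom f p - free_antihom f q"
  "free_antihom f (p * q) = free_antihom f q * free_antihom f p"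
  "free_antihom f 0 = 0"
  "free_antihom f 1 = 1"
  "free_antihom f (fgen g) = f g"
  "free_antihom f (scal c p) = c *\<^sub>C free_antihom f p"
  by (simp_all add: free_antihom_def lin_ext_add lin_ext_diff lin_ext_scal lin_ext_mult_anti
      plus_free_word_def zero_free_word_def fgen_def scaleC_one flip: single_one)

inductive_set dk_rels :: "'n gen free_algebra set"
  where
    "fgen gK * fgen gK - 1 \<in> dk_rels"
  | "fgen gKb * fgen gKb - 1 \<in> dk_rels"
  | "(fgen gK * fgen gKb) * (fgen gK * fgen gKb) - 1 \<in> dk_rels"
  | "fgen (gXi i) * fgen (gXi i) \<in> dk_rels"
  | "fgen (gXib i) * fgen (gXib i) \<in> dk_rels"
  | "fgen gK * fgen (gXi i) + fgen (gXi i) * fgen gK \<in> dk_rels"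
  | "fgen gK * fgen (gXib i) + fgen (gXib i) * fgen gK \<in> dk_rels"
  | "fgen gKb * fgen (gXi i) + fgen (gXi i) * fgen gKb \<in> dk_rels"
  | "fgen gKb * fgen (gXib i) + fgen (gXib i) * fgen gKb \<in> dk_rels"
  | "fgen (gXi i) * fgen (gXi j) + fgen (gXi j) * fgen (gXi i) \<in> dk_rels"
  | "fgen (gXib i) * fgen (gXib j) + fgen (gXib j) * fgen (gXib i) \<in> dk_rels"
  | "i \<noteq> j \<Longrightarrow> fgen (gXi i) * fgen (gXib j) + fgen (gXib j) * fgen (gXi i) \<in> dk_rels"
  | "fgen (gXi i) * fgen (gXib i)
      - (1 - fgen gK * fgen gKb - fgen (gXib i) * fgen (gXi i)) \<in> dk_rels"

lemma free_hom_cong: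
  assumes "\<And>x. x \<in> X \<Longrightarrow> free_hom f x = 0" "ideal_cong X p q"
  shows "free_hom f p = free_hom f q"
  using lin_ext_ideal_cong[OF _ assms(2), of "\<lambda>w. prod_list (map f (letters w))"] assms(1)
  by (simp add: free_hom_simps flip: free_hom_def)

lemma free_antihom_cong:
  assumes "\<And>x. x \<in> X \<Longrightarrow> free_antihom f x = 0" "ideal_cong X p q"
  shows "free_antihom f p = free_antihom f q"
  using lin_ext_ideal_cong[OF _ assms(2), of "\<lambda>w. prod_list (map f (rev (letters w)))"] assms(1)
  by (simp add: free_antihom_simps flip: free_antihom_def)

quotient_type 'n dk = "'n gen free_algebra" / "ideal_cong dk_rels"
  by (rule equivp_ideal_cong)

fun counit_gen :: "'n gen \<Rightarrow> complex"
  where "counit_gen gK = 1"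
  | "counit_gen gKb = 1"
  | "counit_gen (gXi i) = 0"
  | "counit_gen (gXib i) = 0"

lift_definition counit :: "'n dk \<Rightarrow> complex" is "free_hom counit_gen"
proof (rule free_hom_cong)
  show "free_hom counit_gen x = 0" if "x \<in> dk_rels" for x :: "'n gen free_algebra"
    using that by cases (simp_all add: free_hom_simps)
qed

instantiation dk :: (type) complex_algebra_1
begin

lift_definition zero_dk :: "'a dk" is 0 .
lift_definition one_dk :: "'a dk" is 1 .
lift_definition plus_dk :: "'a dk \<Rightarrow> 'a dk \<Rightarrow> 'a dk" is "(+)" by (rule ideal_cong_add)
lift_definition uminus_dk :: "'a dk \<Rightarrow> 'a dk" is uminus by (rule ideal_cong_uminus)
lift_definition minus_dk :: "'a dk \<Rightarrow> 'a dk \<Rightarrow> 'a dk" is "(-)" by (rule ideal_cong_diff)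
lift_definition times_dk :: "'a dk \<Rightarrow> 'a dk \<Rightarrow> 'a dk" is "(*)" by (rule ideal_cong_mult)
lift_definition scaleC_dk :: "complex \<Rightarrow> 'a dk \<Rightarrow> 'a dk" is scal by (rule ideal_cong_scal)

instance
proof
  fix x y z :: "'a dk" and c d :: complex
  show "x + y + z = x + (y + z)" by transfer (rule ideal_cong_refl, simp add: algebra_simps)
  show "x + y = y + x" by transfer (rule ideal_cong_refl, simp add: algebra_simps)
  show "0 + x = x" by transfer (rule ideal_cong_refl, simp)
  show "- x + x = 0" by transfer (rule ideal_cong_refl, simp)
  show "x - y = x + - y" by transfer (rule ideal_cong_refl, simp)
  show "x * y * z = x * (y * z)" by transfer (rule ideal_cong_refl, simp add: mult.assoc)
  show "(x + y) * z = x * z + y * z" by transfer (rule ideal_cong_refl, simp add: distrib_right)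
  show "x * (y + z) = x * y + x * z" by transfer (rule ideal_cong_refl, simp add: distrib_left)
  show "1 * x = x" by transfer (rule ideal_cong_refl, simp)
  show "x * 1 = x" by transfer (rule ideal_cong_refl, simp)
  show "c *\<^sub>C (x + y) = c *\<^sub>C x + c *\<^sub>C y"
    by transfer (rule ideal_cong_refl, simp add: scal_add_right)
  show "(c + d) *\<^sub>C x = c *\<^sub>C x + d *\<^sub>C x"
    by transfer (rule ideal_cong_refl, simp add: scal_add_left)
  show "c *\<^sub>C (d *\<^sub>C x) = (c * d) *\<^sub>C x"
    by transfer (rule ideal_cong_refl, simp add: scal_scal)
  show "1 *\<^sub>C x = x" by transfer (rule ideal_cong_refl, simp add: scal_one)
  show "c *\<^sub>C x * y = c *\<^sub>C (x * y)"
    by transfer (rule ideal_cong_refl, simp add: scal_mult_left)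
  show "x * c *\<^sub>C y = c *\<^sub>C (x * y)"
    by transfer (rule ideal_cong_refl, simp add: scal_mult_right)
  have "counit (0 :: 'a dk) = 0" "counit (1 :: 'a dk) = 1"
    by (transfer, simp add: free_hom_simps)+
  then show "(0 :: 'a dk) \<noteq> 1" by auto
qed

end

lift_definition dk_gen :: "'n gen \<Rightarrow> 'n dk" is fgen .

abbreviation dkK :: "'n dk" where "dkK \<equiv> dk_gen gK"
abbreviation dkKb :: "'n dk" where "dkKb \<equiv> dk_gen gKb"
abbreviation xi :: "'n \<Rightarrow> 'n dk" where "xi i \<equiv> dk_gen (gXi i)"
abbreviation xib :: "'n \<Rightarrow> 'n dk" where "xib i \<equiv> dk_gen (gXib i)"

lemma dk_rels_cong:
  "x - y \<in> dk_rels \<Longrightarrow> ideal_cong dk_rels x y"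
  "x \<in> dk_rels \<Longrightarrow> ideal_cong dk_rels x 0"
  by (simp_all add: ideal_cong_def ideal_gen_incl)

lemma dk_relations:
  "dkK * dkK = 1"
  "dkKb * dkKb = 1"
  "(dkK * dkKb) * (dkK * dkKb) = 1"
  "xi i * xi i = 0"
  "xib i * xib i = 0"
  "dkK * xi i + xi i * dkK = 0"
  "dkK * xib i + xib i * dkK = 0"
  "dkKb * xi i + xi i * dkKb = 0"
  "dkKb * xib i + xib i * dkKb = 0"
  "xi i * xi j + xi j * xi i = 0"
  "xib i * xib j + xib j * xib i = 0"
  "i \<noteq> j \<Longrightarrow> xi i * xib j + xib j * xi i = 0"
  "xi i * xib i = 1 - dkK * dkKb - xib i * xi i"
  subgoal by transfer (rule dk_rels_cong(1), rule dk_rels.intros)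
  subgoal by transfer (rule dk_rels_cong(1), rule dk_rels.intros)
  subgoal by transfer (rule dk_rels_cong(1), rule dk_rels.intros)
  subgoal by transfer (rule dk_rels_cong(2), rule dk_rels.intros)
  subgoal by transfer (rule dk_rels_cong(2), rule dk_rels.intros)
  subgoal by transfer (rule dk_rels_cong(2), rule dk_rels.intros)
  subgoal by transfer (rule dk_rels_cong(2), rule dk_rels.intros)
  subgoal by transfer (rule dk_rels_cong(2), rule dk_rels.intros)
  subgoal by transfer (rule dk_rels_cong(2), rule dk_rels.intros)
  subgoal by transfer (rule dk_rels_cong(2), rule dk_rels.intros)
  subgoal by transfer (rule dk_rels_cong(2), rule dk_rels.intros)
  subgoal by transfer (rule dk_rels_cong(2), rule dk_rels.intros)
  subgoal by transfer (rule dk_rels_cong(1), rule dk_rels.intros)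
  done

lemma dk_commute:
  "dkKb * dkK = dkK * dkKb"
  "xi i * dkK = - (dkK * xi i)"
  "xib i * dkK = - (dkK * xib i)"
  "xi i * dkKb = - (dkKb * xi i)"
  "xib i * dkKb = - (dkKb * xib i)"
  "xi i * xi j = - (xi j * xi i)"
  "xib i * xib j = - (xib j * xib i)"
  "i \<noteq> j \<Longrightarrow> xib j * xi i = - (xi i * xib j)"
  "xib i * xi i = 1 - dkK * dkKb - xi i * xib i"
proof -
  have "dkK * ((dkK * dkKb) * (dkK * dkKb)) * dkKb = dkK * dkKb"
    by (simp add: dk_relations)
  then have "(dkK * dkK) * dkKb * dkK * (dkKb * dkKb) = dkK * dkKb"
    by (simp add: mult.assoc)
  then show "dkKb * dkK = dkK * dkKb"
    by (simp add: dk_relations)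
  show "i \<noteq> j \<Longrightarrow> xib j * xi i = - (xi i * xib j)"
    using dk_relations(12)[of i j] by (simp add: eq_neg_iff_add_eq_0 add.commute)
qed (simp_all add: eq_neg_iff_add_eq_0 dk_relations add.commute)

lemma dk_left_cancel:
  "dkK * (dkK * x) = x"
  "dkKb * (dkKb * x) = x"
  by (simp_all add: dk_relations flip: mult.assoc)

lemma dk_left_commute:
  "dkKb * (dkK * x) = dkK * (dkKb * x)"
  "xi i * (dkK * x) = - (dkK * (xi i * x))"
  "xib i * (dkK * x) = - (dkK * (xib i * x))"
  "xi i * (dkKb * x) = - (dkKb * (xi i * x))"
  "xib i * (dkKb * x) = - (dkKb * (xib i * x))"
  by (simp_all add: dk_commute(1-5) flip: mult.assoc)

fun coproduct_gen :: "'n gen \<Rightarrow> ('n dk, 'n dk) tensor"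
  where "coproduct_gen gK = dkK \<otimes>\<^sub>C dkK"
  | "coproduct_gen gKb = dkKb \<otimes>\<^sub>C dkKb"
  | "coproduct_gen (gXi i) = dkK \<otimes>\<^sub>C xi i + xi i \<otimes>\<^sub>C 1"
  | "coproduct_gen (gXib i) = dkKb \<otimes>\<^sub>C xib i + xib i \<otimes>\<^sub>C 1"

lift_definition coproduct :: "'n dk \<Rightarrow> ('n dk, 'n dk) tensor" is "free_hom coproduct_gen"
proof (rule free_hom_cong)
  show "free_hom coproduct_gen x = 0" if "x \<in> dk_rels" for x :: "'n gen free_algebra"
    using that
  proof cases
    case (10 i j)
    have "xi j * xi i = - (xi i * xi j)" by (rule dk_commute)
    then show ?thesis unfolding 10
      by (simp add: free_hom_simps distrib_left distrib_right tensor_mult dk_relations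
          dk_commute(1-5))
  next
    case (11 i j)
    have "xib j * xib i = - (xib i * xib j)" by (rule dk_commute)
    then show ?thesis unfolding 11
      by (simp add: free_hom_simps distrib_left distrib_right tensor_mult dk_relations
          dk_commute(1-5))
  next
    case (12 i j)
    then show ?thesis
      by (simp add: free_hom_simps distrib_left distrib_right tensor_mult dk_commute(1-5,8))
  next
    case (13 i)
    have "xib i * xi i = 1 - dkK * dkKb - xi i * xib i" by (rule dk_commute)
    then show ?thesis unfolding 13
      by (simp add: free_hom_simps distrib_left distrib_right tensor_mult tensor_one
          dk_commute(1-5) tensor_diff_left tensor_diff_right)
  qed (simp_all add: free_hom_simps distrib_left distrib_right tensor_mult tensor_one dk_relations(1-5)
        dk_commute(1-5))
qed

fun antipode_gen :: "'n gen \<Rightarrow> 'n dk"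
  where "antipode_gen gK = dkK"
  | "antipode_gen gKb = dkKb"
  | "antipode_gen (gXi i) = - (dkK * xi i)"
  | "antipode_gen (gXib i) = - (dkKb * xib i)"

lift_definition antipode :: "'n dk \<Rightarrow> 'n dk" is "free_antihom antipode_gen"
proof (rule free_antihom_cong)
  show "free_antihom antipode_gen x = 0" if "x \<in> dk_rels" for x :: "'n gen free_algebra"
    using that
  proof cases
    case (10 i j)
    have "xi j * xi i = - (xi i * xi j)" by (rule dk_commute)
    then show ?thesis unfolding 10
      by (simp add: free_antihom_simps mult.assoc dk_left_commute dk_left_cancel)
  next
    case (11 i j)
    have "xib j * xib i = - (xib i * xib j)" by (rule dk_commute)
    then show ?thesis unfolding 11
      by (simp add: free_antihom_simps mult.assoc dk_left_commute dk_left_cancel)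
  next
    case (12 i j)
    then show ?thesis
      by (simp add: free_antihom_simps mult.assoc dk_left_commute dk_left_cancel dk_commute(1-5,8))
  next
    case (13 i)
    have "xib i * xi i = 1 - dkK * dkKb - xi i * xib i" by (rule dk_commute)
    then show ?thesis unfolding 13
      by (simp add: free_antihom_simps mult.assoc dk_left_commute dk_left_cancel
          dk_commute(1-5) dk_relations(1,2) right_diff_distrib)
  qed (simp_all add: free_antihom_simps mult.assoc dk_left_commute dk_left_cancel dk_relations(1-5)
        dk_commute(1-5))
qed

text \<open>A word \<open>\<xi>\<^bsub>i\<^sub>1\<^esub> \<cdots> \<xi>\<^bsub>i\<^sub>k\<^esub>\<close> with increasing indices is represented by the set \<open>{i\<^sub>1, \<dots>, i\<^sub>k}\<close>.\<close>

definition xi_word :: "'n::{finite,linorder} set \<Rightarrow> 'n dk"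
  where "xi_word w = prod_list (map xi (sorted_list_of_set w))"

definition xib_word :: "'n::{finite,linorder} set \<Rightarrow> 'n dk"
  where "xib_word w = prod_list (map xib (sorted_list_of_set w))"

definition R_matrix :: "('n::{finite,linorder} dk, 'n dk) tensor"
  where "R_matrix =
    (\<Sum>w\<in>UNIV. (-1) ^ (card w div 2) *\<^sub>C (xi_word w \<otimes>\<^sub>C (xib_word w * dkKb ^ card w))) *
    (1/2) *\<^sub>C (1 \<otimes>\<^sub>C 1 + dkK \<otimes>\<^sub>C 1 + 1 \<otimes>\<^sub>C dkKb - dkK \<otimes>\<^sub>C dkKb)"

definition ribbon :: "'n::{finite,linorder} dk"
  where "ribbon = (1 + dkK - dkKb + dkK * dkKb) *
    (\<Sum>w\<in>UNIV. ((-1) ^ ((card w + 1) div 2) / 2) *\<^sub>C (xi_word w * xib_word w))"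

definition balancing :: "'n dk"
  where "balancing = dkK"

lemma unit_inv_balancing: "unit_inv balancing = (dkK :: 'n dk)"
proof -
  have "h = dkK" if "dkK * h = 1" for h :: "'n dk"
    using arg_cong[OF that, of "\<lambda>y. dkK * y"] by (simp add: dk_left_cancel)
  then show ?thesis
    unfolding unit_inv_def balancing_def by (intro the_equality) (simp_all add: dk_relations)
qed

definition dk_integral :: "'n::{finite,linorder} dk"
  where "dk_integral =
    (1/2) *\<^sub>C ((1 + dkK + dkKb + dkK * dkKb) * xi_word UNIV * xib_word UNIV)"

definition idem_1 :: "'n dk"
  where "idem_1 = (1/4) *\<^sub>C (1 + dkK + dkKb + dkK * dkKb)"

definition idem_K :: "'n::{finite,linorder} dk"
  where "idem_K = ((-1) ^ (CARD('n) div 2) / 2 ^ (CARD('n) + 2)) *\<^sub>C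
    ((1 + dkK - dkKb - dkK * dkKb) * xi_word UNIV * xib_word UNIV)"

definition idem_Kb :: "'n::{finite,linorder} dk"
  where "idem_Kb = ((-1) ^ (CARD('n) div 2) / 2 ^ (CARD('n) + 2)) *\<^sub>C
    ((1 - dkK + dkKb - dkK * dkKb) * xi_word UNIV * xib_word UNIV)"

definition idems :: "('n::{finite,linorder} dk)^3"
  where "idems = vector [idem_1, idem_K, idem_Kb]"

text \<open>The first leg of \<open>R\<^sub>2\<^sub>1 R\<close> is evaluated by the shifted functional \<open>x \<mapsto> \<beta> (K x)\<close>;
  \<open>\<beta>\<close> is meant to be linear.\<close>

definition drinfeld_map :: "('n::{finite,linorder} dk \<Rightarrow> complex) \<Rightarrow> 'n dk"
  where "drinfeld_map \<beta> =
    tensor_lift (\<lambda>a b. \<beta> (dkK * a) *\<^sub>C b) (tensor_swap R_matrix * R_matrix)"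

definition trace_map :: "'n::{finite,linorder} dk \<Rightarrow> 'n dk"
  where "trace_map x =
    tensor_lift (\<lambda>a b. antipode b * x * a * unit_inv balancing) (coproduct dk_integral)"

definition higman_ideal :: "'n::{finite,linorder} dk set"
  where "higman_ideal = range trace_map"

definition B_chi :: "('n::{finite,linorder} dk)^3"
  where "B_chi = (\<chi> k. drinfeld_map (module_character (left_ideal (idems $ k))))"

definition B_tau :: "('n::{finite,linorder} dk)^3"
  where "B_tau = (\<chi> k. trace_map (idems $ k))"

definition S_CW :: "'n::{finite,linorder} itself \<Rightarrow> complex^3^3"
  where "S_CW _ = coord_matrix (B_chi :: ('n dk)^3) B_tau"

definition T_LM :: "'n::{finite,linorder} dk \<Rightarrow> 'n dk"
  where "T_LM x = ribbon * x"

definition T_CW :: "'n::{finite,linorder} itself \<Rightarrow> complex^3^3"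
  where "T_CW _ = coord_matrix (B_tau :: ('n dk)^3) (\<chi> k. T_LM (B_tau $ k))"

end

theory Submission
  imports Defs
begin

text \<open>
  The element \<open>c = dkK * dkKb\<close> is a central involution, so the algebra splits into the block \<open>c = 1\<close>,
  an exterior algebra on the \<open>xi i\<close>, \<open>xib i\<close> extended by the parity \<open>dkK\<close>, and the block \<open>c = -1\<close>, where
  the exterior algebra is replaced by a Clifford algebra. The left ideal of \<open>idem_1\<close> is the regular module
  of the exterior algebra, those of \<open>idem_K\<close> and \<open>idem_Kb\<close> are the two Fock modules of the Clifford block.
  Jordan--Wigner operators on these models provide the linear independence needed to evaluate the
  characters, and with them the Drinfeld map.

  Up to multiplication by \<open>dkK\<close>, the trace map is the composite of the graded commutators with all
  \<open>xi i\<close> and \<open>xib i\<close>. These anticommute and square to zero, so the composite kills every graded commutator;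
  on the Clifford block it is therefore a Berezin integral, zero on all monomials except the top one.
  With \<open>P\<close> the product of all \<open>1 - xi i * xib i\<close> and \<open>top\<close> the longest word, the Higman ideal has the basis
  \<open>(dkK + dkKb) * top\<close>, \<open>1 - c\<close>, \<open>(dkK - dkKb) * P\<close>. The ribbon element is half of
  \<open>(1 + dkK - dkKb + c) * P\<close>; it fixes the first of these vectors and exchanges the other two.
\<close>


section \<open>Traces and matrices\<close>

text \<open>Everything ends in coordinates with respect to \<open>hig1\<close>, \<open>hig2\<close>,
  \<open>hig3\<close>. With N = 2^(n-1) and s = (-1)^(n/2) they are (0, 2N^2, 0), (sN, 0, N), (-sN,
  0, N) for \<open>B_chi\<close> and (2N^2, 0, 0), (0, sN, sN), (0, -sN, sN) for
  \<open>B_tau\<close>. The power 2^(2n) arises in two ways. In the Clifford block each graded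
  commutator contracts a generator with its partner and leaves \<open>1 - dkc\<close>, which is 2
  there. In the exterior block the graded commutators of words vanish, but behind a factor
  \<open>dkK\<close> they become multiplication by twice the generator. Evenness of n enters through
  signs: \<open>dkP\<close> acts by the n-th power of \<open>dkc\<close> on \<open>dk_top\<close>
  and by (-1)^n on the vacuum, and a word of odd length is never the longest one. The Berezin
  argument does not see elements \<open>dkK * v\<close> of the Clifford block. The central element
  \<open>hig3\<close>, whose square is twice \<open>hig2\<close>, reduces them to elements without
  \<open>dkK\<close>.\<close>

lemma clinear_zero: "clinear f \<Longrightarrow> f 0 = 0"
  using clinear_scale[of f 0 0] by simp

lemma clinear_uminus: "clinear f \<Longrightarrow> f (- x) = - f x"
  using clinear_scale[of f "-1" x] by simp

lemma clinear_diff: "clinear f \<Longrightarrow> f (x - y) = f x - f y"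
  using clinear_add[of f x "- y"] by (simp add: clinear_uminus)

lemma clinear_sum: "clinear f \<Longrightarrow> f (sum g A) = (\<Sum>a\<in>A. f (g a))"
  by (induction A rule: infinite_finite_induct) (simp_all add: clinear_add clinear_zero)

lemma clinear_eq_on_span:
  assumes "clinear f" "clinear g" "\<And>x. x \<in> S \<Longrightarrow> f x = g x" "x \<in> cvs.span S"
  shows "f x = g x"
  using assms(4)
proof (induction rule: cvs.span_induct)
  case base
  show ?case
    by (rule cvs.subspaceI)
      (simp_all add: clinear_zero clinear_add clinear_scale assms(1,2))
qed (rule assms(3))

text \<open>The functionals \<open>\<phi> i\<close> form a dual basis, so independence of
  \<open>b\<close> is built in. \<open>trace_on\<close> sums over an unspecified basis
  \<open>B\<close>; expanding the elements of \<open>B\<close> along \<open>b\<close> and exchanging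
  the two sums moves the trace to \<open>b\<close>.\<close>

lemma trace_on_dual_basis:
  fixes b :: "'i::finite \<Rightarrow> 'a::complex_algebra_1" and \<phi> :: "'i \<Rightarrow> 'a \<Rightarrow> complex"
  assumes V: "V = cvs.span (range b)"
    and \<phi>: "\<And>i. clinear (\<phi> i)" "\<And>i j. \<phi> i (b j) = (if i = j then 1 else 0)"
    and f: "clinear f" "\<And>x. x \<in> V \<Longrightarrow> f x \<in> V"
  shows "trace_on V f = (\<Sum>i\<in>UNIV. \<phi> i (f (b i)))"
proof -
  have expand: "x = (\<Sum>i\<in>UNIV. \<phi> i x *\<^sub>C b i)" if "x \<in> V" for x
  proof -
    let ?g = "\<lambda>x. \<Sum>i\<in>UNIV. \<phi> i x *\<^sub>C b i"
    have "clinear ?g"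
      by (intro clinearI) (simp_all add: clinear_add[OF \<phi>(1)] clinear_scale[OF \<phi>(1)]
          scaleC_complex_def scaleC_add_left sum.distrib cvs.scale_sum_right scaleC_scaleC)
    moreover have "clinear (\<lambda>x :: 'a. x)"
      by (rule clinearI) simp_all
    moreover have "y = ?g y" if "y \<in> range b" for y
    proof -
      from that obtain j where "y = b j" by auto
      moreover have "?g (b j) = (\<Sum>i\<in>UNIV. if i = j then b i else 0)"
        by (intro sum.cong) (auto simp: \<phi>(2))
      ultimately show ?thesis by simp
    qed
    ultimately show ?thesis
      using clinear_eq_on_span[of "\<lambda>x. x" ?g "range b" x] that[unfolded V] by blast
  qed
  define B where "B = (SOME B. cvs.independent B \<and> cvs.span B = V)"
  have "\<exists>B. cvs.independent B \<and> cvs.span B = V"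
    using cvs.basis_exists[of V] cvs.span_subspace[of _ V] cvs.subspace_span V by metis
  then have B: "cvs.independent B" "cvs.span B = V"
    unfolding B_def by (metis (mono_tags, lifting) someI_ex)+
  have BV: "b' \<in> V" if "b' \<in> B" for b'
    using B(2) that cvs.span_base by auto
  have fin: "finite B"
    using cvs.independent_span_bound[of "range b" B] B BV V by auto
  note rep_simps = cvs.representation_add[OF B(1)] cvs.representation_scale[OF B(1)]
  have bV: "b i \<in> V" for i by (simp add: V cvs.span_base)
  \<comment> \<open>\<open>cvs.representation B\<close> is additive only on the span of
    \<open>B\<close>, so every partial sum must be shown to lie there.\<close>
  have rep_sum: "cvs.representation B (\<Sum>i\<in>A. c i *\<^sub>C f (b i)) b' = (\<Sum>i\<in>A. c i * cvs.representation B (f (b i)) b')"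
    if "finite A" for A c b'
    using that
  proof induction
    case empty
    then show ?case by (simp add: cvs.representation_zero)
  next
    case (insert i A)
    have "c i *\<^sub>C f (b i) \<in> cvs.span B" "(\<Sum>i\<in>A. c i *\<^sub>C f (b i)) \<in> cvs.span B"
      "f (b i) \<in> cvs.span B"
      by (simp_all add: B(2) f bV V cvs.span_scale cvs.span_sum f(2)[unfolded V] bV[unfolded V])
    then show ?case using insert by (simp add: rep_simps)
  qed
  have *: "cvs.representation B (f b') b' = (\<Sum>i\<in>UNIV. \<phi> i b' * cvs.representation B (f (b i)) b')"
    if "b' \<in> B" for b'
  proof -
    have "f b' = (\<Sum>i\<in>UNIV. \<phi> i b' *\<^sub>C f (b i))"
      using arg_cong[OF expand[OF BV[OF that]], of f] by (simp add: clinear_sum clinear_scale f)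
    then show ?thesis by (simp add: rep_sum)
  qed
  have "trace_on V f = (\<Sum>b'\<in>B. cvs.representation B (f b') b')"
    by (simp add: trace_on_def Let_def B_def)
  also have "\<dots> = (\<Sum>b'\<in>B. \<Sum>i\<in>UNIV. \<phi> i b' * cvs.representation B (f (b i)) b')"
    by (simp add: *)
  also have "\<dots> = (\<Sum>i\<in>UNIV. \<Sum>b'\<in>B. \<phi> i b' * cvs.representation B (f (b i)) b')"
    by (rule sum.swap)
  also have "\<dots> = (\<Sum>i\<in>UNIV. \<phi> i (f (b i)))"
  proof (rule sum.cong[OF refl])
    fix i
    have "f (b i) = (\<Sum>b'\<in>B. cvs.representation B (f (b i)) b' *\<^sub>C b')"
      using cvs.sum_representation_eq[OF B(1) _ fin order.refl, of "f (b i)"] B(2) f(2) bV by simp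
    from arg_cong[OF this, of "\<phi> i"]
    show "(\<Sum>b'\<in>B. \<phi> i b' * cvs.representation B (f (b i)) b') = \<phi> i (f (b i))"
      by (simp add: clinear_sum[OF \<phi>(1)] clinear_scale[OF \<phi>(1)] scaleC_complex_def mult.commute)
  qed
  finally show ?thesis .
qed

text \<open>\<open>coord_matrix\<close> is a definite description, so uniqueness is the content:
  each column of the difference of two solutions is a linear relation among the basis
  vectors.\<close>

lemma coord_matrix_eqI:
  fixes b :: "('a::complex_algebra_1)^'m"
  assumes "ordered_basis b V" and v: "\<And>j. v $ j = (\<Sum>k\<in>UNIV. M $ k $ j *\<^sub>C b $ k)"
  shows "coord_matrix b v = M"
  unfolding coord_matrix_def
proof (rule the_equality)
  show "\<forall>j. v $ j = (\<Sum>k\<in>UNIV. M $ k $ j *\<^sub>C b $ k)" using v by simp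
  fix N assume N: "\<forall>j. v $ j = (\<Sum>k\<in>UNIV. N $ k $ j *\<^sub>C b $ k)"
  have inj: "inj (\<lambda>k. b $ k)" and ind: "cvs.independent (range (\<lambda>k. b $ k))"
    using assms(1) by (auto simp: ordered_basis_def)
  have "N $ k $ j - M $ k $ j = 0" for k j
  proof -
    \<comment> \<open>Independence speaks of coefficients indexed by vectors, so column
      \<open>j\<close> is reindexed along the inverse of the injective family.\<close>
    define g where "g x = N $ inv (\<lambda>k. b $ k) x $ j - M $ inv (\<lambda>k. b $ k) x $ j" for x
    have g: "g (b $ k) = N $ k $ j - M $ k $ j" for k
      by (simp add: g_def inv_f_f[OF inj])
    have "(\<Sum>x\<in>range (\<lambda>k. b $ k). g x *\<^sub>C x) = (\<Sum>k\<in>UNIV. g (b $ k) *\<^sub>C b $ k)"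
      by (subst sum.reindex[OF inj]) simp
    also have "\<dots> = 0"
      using N v by (simp add: g cvs.scale_left_diff_distrib sum_subtractf)
    finally have "g (b $ k) = 0"
      using cvs.independentD[OF ind, of "range (\<lambda>k. b $ k)" g "b $ k"] by auto
    then show ?thesis by (simp add: g)
  qed
  then show "N = M" by (simp add: vec_eq_iff)
qed

lemma ordered_basis_3I:
  fixes b :: "('a::complex_algebra_1)^3"
  assumes ind: "\<And>p q r. p *\<^sub>C b $ 1 + q *\<^sub>C b $ 2 + r *\<^sub>C b $ 3 = 0 \<Longrightarrow> p = 0 \<and> q = 0 \<and> r = 0"
    and V: "cvs.subspace V" "\<And>k. b $ k \<in> V"
      "\<And>x. x \<in> V \<Longrightarrow> \<exists>p q r. x = p *\<^sub>C b $ 1 + q *\<^sub>C b $ 2 + r *\<^sub>C b $ 3"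
  shows "ordered_basis b V"
proof -
  have r: "range (\<lambda>k. b $ k) = {b $ 1, b $ 2, b $ 3}"
    by (auto simp: UNIV_3)
  \<comment> \<open>If two entries were equal, their difference would be a nontrivial
    relation.\<close>
  have neq: "b $ 1 \<noteq> b $ 2" "b $ 1 \<noteq> b $ 3" "b $ 2 \<noteq> b $ 3"
    using ind[of 1 "-1" 0] ind[of 1 0 "-1"] ind[of 0 1 "-1"] by auto
  have "inj (\<lambda>k. b $ k)"
    using neq by (intro injI) (metis exhaust_3)
  moreover have "cvs.independent {b $ 1, b $ 2, b $ 3}"
  proof (rule cvs.independent_if_scalars_zero)
    fix f x assume "(\<Sum>x\<in>{b $ 1, b $ 2, b $ 3}. f x *\<^sub>C x) = 0" and x: "x \<in> {b $ 1, b $ 2, b $ 3}"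
    then have "f (b $ 1) *\<^sub>C b $ 1 + f (b $ 2) *\<^sub>C b $ 2 + f (b $ 3) *\<^sub>C b $ 3 = 0"
      using neq by (simp add: add.assoc)
    from ind[OF this] x show "f x = 0" by auto
  qed simp
  moreover have "cvs.span (range (\<lambda>k. b $ k)) = V"
  proof (rule cvs.span_subspace[OF _ _ V(1)])
    show "range (\<lambda>k. b $ k) \<subseteq> V" using V(2) by auto
    show "V \<subseteq> cvs.span (range (\<lambda>k. b $ k))"
    proof
      fix x assume "x \<in> V"
      then obtain p q r where "x = p *\<^sub>C b $ 1 + q *\<^sub>C b $ 2 + r *\<^sub>C b $ 3" using V(3) by blast
      then show "x \<in> cvs.span (range (\<lambda>k. b $ k))"
        by (simp add: cvs.span_add cvs.span_scale cvs.span_base)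
    qed
  qed
  ultimately show ?thesis by (simp add: ordered_basis_def r)
qed


section \<open>Operators on function spaces\<close>

text \<open>The linear endomorphisms get a type of their own because \<open>free_hom\<close> takes
  values in a type of class \<open>complex_algebra_1\<close>; the product will be
  composition.\<close>

typedef 'b cop = "{T :: ('b \<Rightarrow> complex) \<Rightarrow> 'b \<Rightarrow> complex.
    (\<forall>f g. T (\<lambda>s. f s + g s) = (\<lambda>s. T f s + T g s)) \<and> (\<forall>c f. T (\<lambda>s. c * f s) = (\<lambda>s. c * T f s))}"
  morphisms app Cop
  by (rule exI[of _ "\<lambda>f. f"]) simp

setup_lifting type_definition_cop

lemma app_add: "app T (\<lambda>s. f s + g s) = (\<lambda>s. app T f s + app T g s)"
  and app_scale: "app T (\<lambda>s. c * f s) = (\<lambda>s. c * app T f s)"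
  using app[of T] by auto

lemma app_zero: "app T (\<lambda>s. 0) = (\<lambda>s. 0)"
  using app_scale[of T 0 "\<lambda>s. 0"] by simp

instantiation cop :: (type) complex_algebra_1
begin

lift_definition zero_cop :: "'a cop" is "\<lambda>f s. 0" by simp
lift_definition one_cop :: "'a cop" is "\<lambda>f. f" by simp
lift_definition plus_cop :: "'a cop \<Rightarrow> 'a cop \<Rightarrow> 'a cop" is "\<lambda>S T f s. S f s + T f s"
  by (simp add: algebra_simps)
lift_definition minus_cop :: "'a cop \<Rightarrow> 'a cop \<Rightarrow> 'a cop" is "\<lambda>S T f s. S f s - T f s"
  by (simp add: algebra_simps)
lift_definition uminus_cop :: "'a cop \<Rightarrow> 'a cop" is "\<lambda>T f s. - T f s"
  by simp
lift_definition times_cop :: "'a cop \<Rightarrow> 'a cop \<Rightarrow> 'a cop" is "\<lambda>S T f. S (T f)"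
  by simp
lift_definition scaleC_cop :: "complex \<Rightarrow> 'a cop \<Rightarrow> 'a cop" is "\<lambda>c T f s. c * T f s"
  by (simp add: algebra_simps)

instance
proof
  fix x y z :: "'a cop" and c d :: complex
  show "x + y + z = x + (y + z)" by transfer (simp add: algebra_simps)
  show "x + y = y + x" by transfer (simp add: algebra_simps)
  show "0 + x = x" by transfer simp
  show "- x + x = 0" by transfer simp
  show "x - y = x + - y" by transfer simp
  show "x * y * z = x * (y * z)" by transfer simp
  show "(x + y) * z = x * z + y * z" by transfer simp
  show "x * (y + z) = x * y + x * z" by transfer simp
  show "1 * x = x" by transfer simp
  show "x * 1 = x" by transfer simp
  show "c *\<^sub>C (x + y) = c *\<^sub>C x + c *\<^sub>C y" by transfer (simp add: algebra_simps)
  show "(c + d) *\<^sub>C x = c *\<^sub>C x + d *\<^sub>C x" by transfer (simp add: algebra_simps)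
  show "c *\<^sub>C (d *\<^sub>C x) = (c * d) *\<^sub>C x" by transfer (simp add: algebra_simps)
  show "1 *\<^sub>C x = x" by transfer simp
  show "c *\<^sub>C x * y = c *\<^sub>C (x * y)" by transfer simp
  show "x * c *\<^sub>C y = c *\<^sub>C (x * y)" by transfer simp
  show "(0 :: 'a cop) \<noteq> 1" by transfer (metis one_neq_zero)
qed

end

lemmas app_simps = zero_cop.rep_eq one_cop.rep_eq plus_cop.rep_eq minus_cop.rep_eq
  uminus_cop.rep_eq times_cop.rep_eq scaleC_cop.rep_eq

lemma cop_eqI: "(\<And>f s. app S f s = app T f s) \<Longrightarrow> S = T"
  by (metis app_inject ext)

definition delta :: "'b \<Rightarrow> 'b \<Rightarrow> complex"
  where "delta s t = (if t = s then 1 else 0)"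

text \<open>Applying \<open>\<rho> x\<close> to the vector \<open>u\<close> identifies the left
  ideal with the function space; the value at \<open>s\<close> is the dual functional required by
  \<open>trace_on_dual_basis\<close>.\<close>

lemma module_character_eq_trace:
  fixes b :: "'b::finite \<Rightarrow> 'a::complex_algebra_1" and \<rho> :: "'a \<Rightarrow> 'b cop"
  assumes \<rho>: "clinear \<rho>" "\<And>x y. \<rho> (x * y) = \<rho> x * \<rho> y"
    and b: "left_ideal e = cvs.span (range b)" "\<And>s. app (\<rho> (b s)) u = delta s"
  shows "module_character (left_ideal e) x = (\<Sum>s\<in>UNIV. app (\<rho> x) (delta s) s)"
proof -
  have "trace_on (left_ideal e) ((*) x) = (\<Sum>s\<in>UNIV. app (\<rho> (x * b s)) u s)"
  proof (rule trace_on_dual_basis[OF b(1), where \<phi> = "\<lambda>s x. app (\<rho> x) u s"])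
    show "clinear (\<lambda>x. app (\<rho> x) u s)" for s
      by (intro clinearI)
        (simp_all add: clinear_add[OF \<rho>(1)] clinear_scale[OF \<rho>(1)] app_simps scaleC_complex_def)
    show "app (\<rho> (b j)) u i = (if i = j then 1 else 0)" for i j
      by (simp add: b(2) delta_def)
    show "clinear ((*) x)"
      by (intro clinearI) (simp_all add: distrib_left mult_scaleC_right)
    show "x * y \<in> left_ideal e" if "y \<in> left_ideal e" for y
      using that by (auto simp: left_ideal_def simp flip: mult.assoc)
  qed
  then show ?thesis
    by (simp add: module_character_def \<rho>(2) app_simps b(2))
qed


section \<open>Ordered words in anticommuting elements\<close>

text \<open>The generic form of \<open>xi_word\<close> and \<open>xib_word\<close>, so that one
  induction also covers operator-valued words and words in the products
  \<open>xi i * xib i\<close>.\<close>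

definition word :: "('i::linorder \<Rightarrow> 'a::monoid_mult) \<Rightarrow> 'i set \<Rightarrow> 'a"
  where "word g A = prod_list (map g (sorted_list_of_set A))"

lemma word_empty [simp]: "word g {} = 1"
  by (simp add: word_def)

lemma word_insert_min:
  assumes "finite A" "\<forall>a\<in>A. b < a"
  shows "word g (insert b A) = g b * word g A"
proof -
  have "Min (insert b A) = b"
    using assms by (intro Min_eqI) (auto intro: less_imp_le)
  moreover have "insert b A - {b} = A" using assms by auto
  ultimately show ?thesis
    using assms by (simp add: word_def sorted_list_of_set_nonempty del: sorted_list_of_set_insert_remove)
qed

lemma word_hom:
  assumes "finite A" "h 1 = 1" "\<And>x y. h (x * y) = h x * h y"
  shows "h (word g A) = word (\<lambda>i. h (g i)) A"
  using assms(1)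
  by (induction A rule: finite_linorder_min_induct) (simp_all add: assms word_insert_min)

lemma word_left_mem:
  fixes g :: "'i::linorder \<Rightarrow> 'a::ring_1"
  assumes "finite A" "\<And>i j. g i * g j = - (g j * g i)" "\<And>i. g i * g i = 0" "i \<in> A"
  shows "g i * word g A = 0"
  using assms(1,4)
proof (induction A rule: finite_linorder_min_induct)
  case (insert b A)
  show ?case
  proof (cases "i = b")
    case True
    then show ?thesis
      by (simp add: word_insert_min insert assms(3) flip: mult.assoc)
  next
    case False
    have "g i * (g b * word g A) = - (g b * (g i * word g A))"
      using assms(2)[of i b] by (simp flip: mult.assoc)
    then show ?thesis
      using False insert by (simp add: word_insert_min)
  qed
qed simp

lemma word_left_notin:
  fixes g :: "'i::linorder \<Rightarrow> 'a::complex_algebra_1"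
  assumes "finite A" "\<And>i j. g i * g j = - (g j * g i)" "i \<notin> A"
  shows "\<exists>\<epsilon>. g i * word g A = \<epsilon> *\<^sub>C word g (insert i A)"
  using assms(1,3)
proof (induction A rule: finite_linorder_min_induct)
  case empty
  have "g i * word g {} = 1 *\<^sub>C word g (insert i {})"
    using word_insert_min[of "{}" i g] by simp
  then show ?case by blast
next
  case (insert b A)
  show ?case
  proof (cases "i < b")
    case True
    then have "g i * word g (insert b A) = 1 *\<^sub>C word g (insert i (insert b A))"
      using insert by (subst word_insert_min[of "insert b A" i]) auto
    then show ?thesis by blast
  next
    case False
    with insert have i: "b < i" "i \<notin> A" by auto
    then obtain \<epsilon> where \<epsilon>: "g i * word g A = \<epsilon> *\<^sub>C word g (insert i A)" using insert by auto
    have "g i * word g (insert b A) = - (g b * (g i * word g A))"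
      using assms(2)[of i b] insert by (simp add: word_insert_min flip: mult.assoc)
    also have "\<dots> = (- \<epsilon>) *\<^sub>C word g (insert b (insert i A))"
      using insert i by (simp add: \<epsilon> word_insert_min mult_scaleC_right)
    finally show ?thesis by (metis insert_commute)
  qed
qed

lemma word_anticommute:
  fixes g :: "'i::linorder \<Rightarrow> 'a::complex_algebra_1"
  assumes "finite A" "\<And>i. i \<in> A \<Longrightarrow> x * g i = - (g i * x)"
  shows "x * word g A = (-1) ^ card A *\<^sub>C (word g A * x)"
  using assms
proof (induction A rule: finite_linorder_min_induct)
  case (insert b A)
  have "x * (g b * word g A) = - (g b * (x * word g A))"
    using insert.prems[of b] by (simp flip: mult.assoc)
  moreover have "b \<notin> A" using insert by auto
  ultimately show ?case
    using insert by (simp add: word_insert_min mult_scaleC_right mult.assoc)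
qed simp

text \<open>Each new \<open>g b\<close> moves past the \<open>card A\<close> remaining factors of
  the first word. The total 0 + 1 + ... + (k - 1) has the parity of \<open>k div 2\<close>. Only
  factors of different index pass each other, so the lemma covers \<open>xi\<close> against
  \<open>xib\<close>.\<close>

lemma word_mult_word:
  fixes f g :: "'i::linorder \<Rightarrow> 'a::complex_algebra_1"
  assumes "finite A" "\<And>i j. i \<noteq> j \<Longrightarrow> g i * f j = - (f j * g i)"
  shows "word f A * word g A = (-1) ^ (card A div 2) *\<^sub>C word (\<lambda>i. f i * g i) A"
  using assms(1)
proof (induction A rule: finite_linorder_min_induct)
  case (insert b A)
  have b: "b \<notin> A" using insert by auto
  have "g b * word f A = (-1) ^ card A *\<^sub>C (word f A * g b)"
    using insert assms(2) b by (intro word_anticommute) auto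
  then have "(-1) ^ card A *\<^sub>C (g b * word f A) = word f A * g b"
    by (simp add: scaleC_scaleC flip: power_mult_distrib)
  then have swap: "word f A * g b = (-1) ^ card A *\<^sub>C (g b * word f A)" by simp
  have "word f (insert b A) * word g (insert b A) = f b * (word f A * g b) * word g A"
    using insert by (simp add: word_insert_min mult.assoc)
  also have "\<dots> = (-1) ^ card A *\<^sub>C (f b * g b * (word f A * word g A))"
    unfolding swap by (simp add: mult_scaleC_left mult_scaleC_right mult.assoc)
  also have "\<dots> = ((-1) ^ card A * (-1) ^ (card A div 2)) *\<^sub>C word (\<lambda>i. f i * g i) (insert b A)"
    using insert by (simp add: word_insert_min mult_scaleC_right scaleC_scaleC mult.assoc)
  also have "(-1) ^ card A * (-1) ^ (card A div 2) = (-1 :: complex) ^ (Suc (card A) div 2)"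
    by (cases "even (card A)") (auto elim!: evenE oddE)
  finally show ?case using b insert by simp
qed simp

text \<open>Splitting off the smallest index keeps the chosen factors in increasing order, so the
  expansion by subsets holds for noncommuting factors.\<close>

lemma word_one_minus:
  fixes h :: "'i::linorder \<Rightarrow> 'a::complex_algebra_1"
  assumes "finite A"
  shows "word (\<lambda>i. 1 - h i) A = (\<Sum>B\<in>Pow A. (-1) ^ card B *\<^sub>C word h B)"
  using assms
proof (induction A rule: finite_linorder_min_induct)
  case (insert b A)
  have b: "b \<notin> A" using insert by auto
  have *: "(-1) ^ card (insert b B) *\<^sub>C word h (insert b B) = - (h b * ((-1) ^ card B *\<^sub>C word h B))"
    if "B \<in> Pow A" for B
  proof -
    have "finite B" "b \<notin> B" "\<forall>a\<in>B. b < a" using that insert b by (auto intro: finite_subset)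
    then show ?thesis by (simp add: word_insert_min mult_scaleC_right)
  qed
  have "(\<Sum>B\<in>Pow (insert b A). (-1) ^ card B *\<^sub>C word h B) =
      (\<Sum>B\<in>Pow A. (-1) ^ card B *\<^sub>C word h B) + (\<Sum>B\<in>insert b ` Pow A. (-1) ^ card B *\<^sub>C word h B)"
    unfolding Pow_insert using insert b by (intro sum.union_disjoint) auto
  also have "(\<Sum>B\<in>insert b ` Pow A. (-1) ^ card B *\<^sub>C word h B) =
      (\<Sum>B\<in>Pow A. (-1) ^ card (insert b B) *\<^sub>C word h (insert b B))"
    using b by (intro sum.reindex_cong[of "insert b"]) (auto simp: inj_on_def)
  also have "\<dots> = - (h b * word (\<lambda>i. 1 - h i) A)"
    using insert by (simp add: * sum_negf sum_distrib_left)
  finally show ?case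
    using insert by (simp add: word_insert_min algebra_simps)
qed simp

text \<open>Normal ordering: \<open>d\<close> moves through the word and leaves a term with
  \<open>z j\<close> at each letter. The two memberships are proved together because the step for
  \<open>d\<close> needs the shorter word itself to lie in \<open>V\<close>.\<close>

lemma word_straighten:
  fixes a :: "'i::linorder \<Rightarrow> 'a::complex_algebra_1"
  assumes "finite A" "cvs.subspace V"
    and "\<And>j x. x \<in> V \<Longrightarrow> a j * x \<in> V" "\<And>j x. x \<in> V \<Longrightarrow> z j * x \<in> V"
    and "\<And>j. d * a j = z j - a j * d" "y \<in> V" "d * y \<in> V"
  shows "word a A * y \<in> V \<and> d * (word a A * y) \<in> V"
  using assms(1)
proof (induction A rule: finite_linorder_min_induct)
  case (insert b A)
  have "d * (a b * (word a A * y)) = z b * (word a A * y) - a b * (d * (word a A * y))"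
    using arg_cong[OF assms(5)[of b], of "\<lambda>t. t * (word a A * y)"]
    by (simp add: left_diff_distrib mult.assoc)
  then show ?case
    using insert assms by (simp add: word_insert_min mult.assoc cvs.subspace_diff)
qed (use assms in simp)


section \<open>The algebra structure\<close>

lemma xi_word_eq: "xi_word = word xi" and xib_word_eq: "xib_word = word xib"
  by (simp_all add: fun_eq_iff xi_word_def xib_word_def word_def)

text \<open>Every element is a linear combination of words in the generators; this serves as the
  induction principle for the quotient.\<close>

lemma dk_left_ideal_induct:
  fixes V :: "'n dk set"
  assumes V: "cvs.subspace V" "\<And>g y. y \<in> V \<Longrightarrow> dk_gen g * y \<in> V" and y: "y \<in> V"
  shows "x * y \<in> V"
proof (induction x rule: dk.abs_induct)
  case (1 p)
  show ?case
  proof (induction p rule: monoid_algebra_induct)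
    case zero
    have "abs_dk 0 = (0 :: 'n dk)" by (simp add: zero_dk_def)
    then show ?case using V(1) by (simp add: cvs.subspace_0)
  next
    case (single k c)
    have "abs_dk (Poly_Mapping.single (Word l) c) * y \<in> V" for l
    proof (induction l)
      case Nil
      have "Poly_Mapping.single (Word []) c = (scal c 1 :: 'n gen free_algebra)"
        by (simp add: scal_single flip: single_one zero_free_word_def)
      then have "abs_dk (Poly_Mapping.single (Word []) c) = c *\<^sub>C (1 :: 'n dk)"
        by (simp add: scaleC_dk.abs_eq one_dk_def)
      then show ?case using V(1) y by (simp add: mult_scaleC_left cvs.subspace_scale)
    next
      case (Cons g l)
      have "Poly_Mapping.single (Word (g # l)) c = fgen g * Poly_Mapping.single (Word l) c"
        by (simp add: fgen_def mult_single plus_free_word_def)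
      then have "abs_dk (Poly_Mapping.single (Word (g # l)) c) =
          dk_gen g * abs_dk (Poly_Mapping.single (Word l) c)"
        by (simp add: times_dk.abs_eq dk_gen_def)
      then show ?case using V(2) Cons by (simp add: mult.assoc)
    qed
    then show ?case by (cases k) auto
  next
    case (add p q)
    have "abs_dk (p + q) = abs_dk p + abs_dk q" by (simp add: plus_dk.abs_eq)
    then show ?case using add V(1) by (simp add: distrib_right cvs.subspace_add)
  qed
qed

lemma dk_central:
  assumes "\<And>g. dk_gen g * z = z * dk_gen g"
  shows "x * z = z * x"
proof -
  have "x * 1 \<in> {x. x * z = z * x}"
  proof (rule dk_left_ideal_induct)
    show "cvs.subspace {x. x * z = z * x}"
      by (rule cvs.subspaceI) (simp_all add: algebra_simps mult_scaleC_left mult_scaleC_right)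
    show "dk_gen g * y \<in> {x. x * z = z * x}" if "y \<in> {x. x * z = z * x}" for g y
      using that assms[of g] by (simp add: mult.assoc) (simp flip: mult.assoc)
  qed simp
  then show ?thesis by simp
qed

abbreviation dkc :: "'n dk" where "dkc \<equiv> dkK * dkKb"

lemma dkc_central: "x * dkc = dkc * x"
proof (rule dk_central)
  show "dk_gen g * dkc = dkc * dk_gen g" for g
    by (cases g) (simp_all add: mult.assoc dk_left_commute dk_left_cancel dk_commute(1-5) dk_relations)
qed

lemma dkc_square: "dkc * dkc = 1"
  by (rule dk_relations)

text \<open>Since \<open>dkK\<close> is an involution this is conjugation by it: the parity
  automorphism, which negates every odd generator.\<close>

definition sg :: "'n dk \<Rightarrow> 'n dk"
  where "sg x = dkK * x * dkK"

lemma sg_add: "sg (x + y) = sg x + sg y"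
  and sg_diff: "sg (x - y) = sg x - sg y"
  and sg_scale: "sg (c *\<^sub>C x) = c *\<^sub>C sg x"
  and sg_zero: "sg 0 = 0"
  by (simp_all add: sg_def algebra_simps mult_scaleC_left mult_scaleC_right)

lemma sg_mult: "sg (x * y) = sg x * sg y"
  by (simp add: sg_def mult.assoc dk_left_cancel)

lemma sg_one: "sg 1 = 1"
  by (simp add: sg_def dk_relations)

lemma sg_sg: "sg (sg x) = x"
  by (simp add: sg_def mult.assoc dk_left_cancel dk_relations)

lemma sg_gen [simp]: "sg dkK = dkK" "sg dkKb = dkKb" "sg (xi i) = - xi i" "sg (xib i) = - xib i"
  by (simp_all add: sg_def mult.assoc dk_left_cancel dk_relations dk_commute(1-5))

lemma sg_central:
  assumes "\<And>x. x * z = z * x"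
  shows "sg z = z"
  by (simp add: sg_def assms[of dkK] mult.assoc dk_relations)

text \<open>Because \<open>dkKb = dkc * dkK\<close> and \<open>dkc\<close> is a central involution,
  both group generators conjugate alike. One parity automorphism therefore serves \<open>xi\<close>
  and \<open>xib\<close>.\<close>

lemma dkKb_conj: "dkKb * x * dkKb = sg x"
proof -
  have Kb: "dkKb = dkc * (dkK :: 'a dk)"
    by (simp add: dk_left_cancel mult.assoc dk_commute(1))
  have "dkKb * x * dkKb = dkc * dkK * x * (dkc * dkK)"
    by (rule arg_cong2[of _ _ _ _ "\<lambda>a b. a * x * b", OF Kb Kb])
  also have "\<dots> = (dkc * dkc) * (dkK * x * dkK)"
    using dkc_central[of "dkK * x"] by (metis mult.assoc)
  finally show ?thesis by (simp only: dkc_square sg_def mult_1)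
qed

text \<open>Compatibility with the relations is a property of \<open>f\<close>, so the map is
  defined on representatives instead of being lifted; under the hypothesis \<open>rels\<close> below
  it is the induced algebra homomorphism.\<close>

definition dk_eval :: "('n gen \<Rightarrow> 'a::complex_algebra_1) \<Rightarrow> 'n dk \<Rightarrow> 'a"
  where "dk_eval f x = free_hom f (rep_dk x)"

context
  fixes f :: "'n gen \<Rightarrow> 'a::complex_algebra_1"
  assumes rels: "\<And>x. x \<in> dk_rels \<Longrightarrow> free_hom f x = 0"
begin

lemma dk_eval_abs: "dk_eval f (abs_dk p) = free_hom f p"
proof -
  have "ideal_cong dk_rels (rep_dk (abs_dk p)) p"
    using Quotient_abs_rep[OF Quotient_dk] dk.abs_eq_iff by metis
  then show ?thesis
    unfolding dk_eval_def by (intro free_hom_cong[where X = dk_rels] rels)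
qed

lemma dk_eval_one: "dk_eval f 1 = 1"
  by (simp add: one_dk_def dk_eval_abs free_hom_simps)

lemma dk_eval_gen: "dk_eval f (dk_gen g) = f g"
  by (simp add: dk_gen_def dk_eval_abs free_hom_simps)

lemma dk_eval_mult: "dk_eval f (x * y) = dk_eval f x * dk_eval f y"
  by (induction x rule: dk.abs_induct; induction y rule: dk.abs_induct)
    (simp add: times_dk.abs_eq dk_eval_abs free_hom_simps)

lemma clinear_dk_eval: "clinear (dk_eval f)"
proof (rule clinearI)
  show "dk_eval f (x + y) = dk_eval f x + dk_eval f y" for x y
    by (induction x rule: dk.abs_induct; induction y rule: dk.abs_induct)
      (simp add: plus_dk.abs_eq dk_eval_abs free_hom_simps)
  show "dk_eval f (c *\<^sub>C x) = c *\<^sub>C dk_eval f x" for c x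
    by (induction x rule: dk.abs_induct) (simp add: scaleC_dk.abs_eq dk_eval_abs free_hom_simps)
qed

end


section \<open>Fock space models\<close>

text \<open>The Jordan--Wigner sign, which makes creation operators of different modes anticommute.\<close>

definition jw :: "'i::linorder \<Rightarrow> 'i set \<Rightarrow> complex"
  where "jw i S = (-1) ^ card {j \<in> S. j < i}"

lemma jw_insert:
  fixes S :: "'i::{finite,linorder} set"
  shows "jw i (insert j S) = (if j \<notin> S \<and> j < i then - jw i S else jw i S)"
proof -
  have "{k \<in> insert j S. k < i} = (if j < i then insert j {k \<in> S. k < i} else {k \<in> S. k < i})"
    by auto
  then show ?thesis by (auto simp: jw_def card_insert_if)
qed

lemma jw_remove:
  fixes S :: "'i::{finite,linorder} set"
  shows "jw i (S - {j}) = (if j \<in> S \<and> j < i then - jw i S else jw i S)"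
proof (cases "j \<in> S")
  case True
  then show ?thesis using jw_insert[of i j "S - {j}"] by (auto simp: insert_absorb split: if_splits)
qed simp

lemma jw_square [simp]: "jw i S * jw i S = 1" "jw i S * (jw i S * x) = x"
  by (simp_all add: jw_def flip: power_mult_distrib mult.assoc)

definition parity :: "'i set \<Rightarrow> complex"
  where "parity S = (-1) ^ card S"

lemma parity_insert: "parity (insert i S) = (if i \<in> S then parity S else - parity S)"
  and parity_remove: "parity (S - {i}) = (if i \<in> S then - parity S else parity S)"
  for S :: "'i::finite set"
proof -
  show *: "parity (insert i S) = (if i \<in> S then parity S else - parity S)" for S
    by (simp add: parity_def card_insert_if)
  show "parity (S - {i}) = (if i \<in> S then - parity S else parity S)"
    using *[of "S - {i}"] by (cases "i \<in> S") (auto simp: insert_absorb)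
qed

lemma parity_square [simp]: "parity S * parity S = 1" "parity S * (parity S * x) = x"
  by (simp_all add: parity_def flip: power_mult_distrib mult.assoc)

text \<open>A function holds coefficients: the value at \<open>S\<close> is read off at
  \<open>S - {i}\<close>, so on \<open>delta\<close> functions the index \<open>i\<close> is added.
  For \<open>ann\<close> it is the other way round.\<close>

lift_definition cre :: "'n::{finite,linorder} \<Rightarrow> 'n set cop"
  is "\<lambda>i f S. if i \<in> S then jw i S * f (S - {i}) else 0"
  by (auto simp: algebra_simps)

lift_definition ann :: "'n::{finite,linorder} \<Rightarrow> 'n set cop"
  is "\<lambda>i f S. if i \<in> S then 0 else jw i S * f (insert i S)"
  by (auto simp: algebra_simps)

lift_definition par :: "'n::{finite,linorder} set cop"
  is "\<lambda>f S. parity S * f S"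
  by (auto simp: algebra_simps)

lift_definition creL :: "'n::{finite,linorder} \<Rightarrow> ('n set \<times> 'n set) cop"
  is "\<lambda>i f (A, B). if i \<in> A then jw i A * f (A - {i}, B) else 0"
  by (auto simp: algebra_simps fun_eq_iff)

text \<open>The pair \<open>(A, B)\<close> stands for a \<open>xi\<close> word on \<open>A\<close>
  followed by a \<open>xib\<close> word on \<open>B\<close>; \<open>parity A\<close> is the sign of
  passing the first word.\<close>

lift_definition creR :: "'n::{finite,linorder} \<Rightarrow> ('n set \<times> 'n set) cop"
  is "\<lambda>i f (A, B). if i \<in> B then parity A * jw i B * f (A, B - {i}) else 0"
  by (auto simp: algebra_simps fun_eq_iff)

lift_definition parLR :: "('n::{finite,linorder} set \<times> 'n set) cop"
  is "\<lambda>f (A, B). parity A * parity B * f (A, B)"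
  by (auto simp: algebra_simps fun_eq_iff)

lemmas fock_app = cre.rep_eq ann.rep_eq par.rep_eq creL.rep_eq creR.rep_eq parLR.rep_eq

lemma remove_remove_commute: "S - {i} - {j} = S - {j} - {i}"
  by auto

lemma dk_rels_free_hom:
  assumes "f gK * f gK = 1" "f gKb * f gKb = 1" "f gK * f gKb * (f gK * f gKb) = 1"
    and "\<And>i. f (gXi i) * f (gXi i) = 0" "\<And>i. f (gXib i) * f (gXib i) = 0"
    and "\<And>i. f gK * f (gXi i) + f (gXi i) * f gK = 0"
    and "\<And>i. f gK * f (gXib i) + f (gXib i) * f gK = 0"
    and "\<And>i. f gKb * f (gXi i) + f (gXi i) * f gKb = 0"
    and "\<And>i. f gKb * f (gXib i) + f (gXib i) * f gKb = 0"
    and "\<And>i j. f (gXi i) * f (gXi j) + f (gXi j) * f (gXi i) = 0"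
    and "\<And>i j. f (gXib i) * f (gXib j) + f (gXib j) * f (gXib i) = 0"
    and "\<And>i j. i \<noteq> j \<Longrightarrow> f (gXi i) * f (gXib j) + f (gXib j) * f (gXi i) = 0"
    and "\<And>i. f (gXi i) * f (gXib i) = 1 - f gK * f gKb - f (gXib i) * f (gXi i)"
    and "x \<in> dk_rels"
  shows "free_hom f x = 0"
  using assms(14) by cases (simp_all add: free_hom_simps assms(1-13))

text \<open>In the block \<open>dkc = -1\<close> the generators \<open>xi i\<close> and
  \<open>xib i\<close> anticommute to 2, hence the factor 2, and \<open>dkKb\<close> is minus
  \<open>dkK\<close>. The sign \<eta> is the eigenvalue of \<open>dkK\<close> on the vacuum.\<close>

fun clifford_gen :: "complex \<Rightarrow> 'n::{finite,linorder} gen \<Rightarrow> 'n set cop"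
  where "clifford_gen \<eta> gK = \<eta> *\<^sub>C par"
  | "clifford_gen \<eta> gKb = (- \<eta>) *\<^sub>C par"
  | "clifford_gen \<eta> (gXi i) = 2 *\<^sub>C ann i"
  | "clifford_gen \<eta> (gXib i) = cre i"

lemma par_square: "par * par = 1"
  by (rule cop_eqI) (simp add: app_simps fock_app)

lemma ann_ann: "ann i * ann j = - (ann j * ann i)"
  by (rule cop_eqI) (auto simp: app_simps fock_app jw_insert insert_commute)

lemma cre_cre: "cre i * cre j = - (cre j * cre i)"
  by (rule cop_eqI) (auto simp: app_simps fock_app jw_remove remove_remove_commute)

lemma ann_square: "ann i * ann i = 0"
  by (rule cop_eqI) (auto simp: app_simps fock_app)

lemma cre_square: "cre i * cre i = 0"
  by (rule cop_eqI) (auto simp: app_simps fock_app)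

lemma par_ann: "par * ann i = - (ann i * par)"
  by (rule cop_eqI) (auto simp: app_simps fock_app parity_insert)

lemma par_cre: "par * cre i = - (cre i * par)"
  by (rule cop_eqI) (auto simp: app_simps fock_app parity_remove)

lemma ann_cre:
  assumes "i \<noteq> j"
  shows "ann i * cre j = - (cre j * ann i)"
proof (rule cop_eqI)
  fix f :: "'a set \<Rightarrow> complex" and S
  show "app (ann i * cre j) f S = app (- (cre j * ann i)) f S"
    using assms by (auto simp: app_simps fock_app jw_insert jw_remove insert_Diff_if)
qed

lemma cre_ann: "cre i * ann i = 1 - ann i * cre i"
proof (rule cop_eqI)
  fix f :: "'a set \<Rightarrow> complex" and S
  show "app (cre i * ann i) f S = app (1 - ann i * cre i) f S"
    by (cases "i \<in> S") (simp_all add: app_simps fock_app jw_insert jw_remove insert_absorb)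
qed

lemma clifford_gen_rels:
  assumes \<eta>: "\<eta> = 1 \<or> \<eta> = -1" and x: "x \<in> dk_rels"
  shows "free_hom (clifford_gen \<eta>) x = 0"
proof (rule dk_rels_free_hom[OF _ _ _ _ _ _ _ _ _ _ _ _ _ x])
  have two: "2 *\<^sub>C y = y + y" for y :: "'a set cop"
    using scaleC_add_left[of 1 1 y] by simp
  show "clifford_gen \<eta> (gXi i) * clifford_gen \<eta> (gXib i) =
      1 - clifford_gen \<eta> gK * clifford_gen \<eta> gKb - clifford_gen \<eta> (gXib i) * clifford_gen \<eta> (gXi i)"
    for i :: 'a
    using \<eta> by (auto simp: mult_scaleC_left mult_scaleC_right par_square cre_ann two algebra_simps)
  show "clifford_gen \<eta> (gXi i) * clifford_gen \<eta> (gXi j) +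
      clifford_gen \<eta> (gXi j) * clifford_gen \<eta> (gXi i) = 0" for i j :: 'a
    by (simp add: ann_ann[of i j] mult_scaleC_left mult_scaleC_right)
  show "clifford_gen \<eta> (gXib i) * clifford_gen \<eta> (gXib j) +
      clifford_gen \<eta> (gXib j) * clifford_gen \<eta> (gXib i) = 0" for i j :: 'a
    by (simp add: cre_cre[of i j])
  have \<eta>\<eta>: "\<eta> * \<eta> = 1" using \<eta> by auto
  note simps = mult_scaleC_left mult_scaleC_right scaleC_scaleC par_square par_ann par_cre \<eta>\<eta>
  show "clifford_gen \<eta> gK * clifford_gen \<eta> gK = (1 :: 'a set cop)"
    "clifford_gen \<eta> gKb * clifford_gen \<eta> gKb = (1 :: 'a set cop)"
    by (simp_all add: simps)
  show "clifford_gen \<eta> gK * clifford_gen \<eta> gKb *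
      (clifford_gen \<eta> gK * clifford_gen \<eta> gKb) = (1 :: 'a set cop)"
    by (simp add: simps)
  fix i :: 'a
  show "clifford_gen \<eta> (gXi i) * clifford_gen \<eta> (gXi i) = 0"
    "clifford_gen \<eta> (gXib i) * clifford_gen \<eta> (gXib i) = 0"
    by (simp_all add: simps ann_square cre_square)
  show "clifford_gen \<eta> gK * clifford_gen \<eta> (gXi i) + clifford_gen \<eta> (gXi i) * clifford_gen \<eta> gK = 0"
    "clifford_gen \<eta> gKb * clifford_gen \<eta> (gXi i) + clifford_gen \<eta> (gXi i) * clifford_gen \<eta> gKb = 0"
    "clifford_gen \<eta> gK * clifford_gen \<eta> (gXib i) + clifford_gen \<eta> (gXib i) * clifford_gen \<eta> gK = 0"
    "clifford_gen \<eta> gKb * clifford_gen \<eta> (gXib i) + clifford_gen \<eta> (gXib i) * clifford_gen \<eta> gKb = 0"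
    by (simp_all add: simps mult.commute)
  fix j :: 'a assume "i \<noteq> j"
  then show "clifford_gen \<eta> (gXi i) * clifford_gen \<eta> (gXib j) +
      clifford_gen \<eta> (gXib j) * clifford_gen \<eta> (gXi i) = 0"
    by (simp add: simps ann_cre)
qed

fun exterior_gen :: "'n::{finite,linorder} gen \<Rightarrow> ('n set \<times> 'n set) cop"
  where "exterior_gen gK = parLR"
  | "exterior_gen gKb = parLR"
  | "exterior_gen (gXi i) = creL i"
  | "exterior_gen (gXib i) = creR i"

lemma creL_creL: "creL i * creL j = - (creL j * creL i)"
proof (rule cop_eqI)
  fix f :: "'a set \<times> 'a set \<Rightarrow> complex" and s
  show "app (creL i * creL j) f s = app (- (creL j * creL i)) f s"
    by (cases s) (auto simp: app_simps fock_app jw_remove remove_remove_commute[of _ i j])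
qed

lemma creR_creR: "creR i * creR j = - (creR j * creR i)"
proof (rule cop_eqI)
  fix f :: "'a set \<times> 'a set \<Rightarrow> complex" and s
  show "app (creR i * creR j) f s = app (- (creR j * creR i)) f s"
    by (cases s) (auto simp: app_simps fock_app jw_remove remove_remove_commute[of _ i j])
qed

lemma parLR_square: "parLR * parLR = 1"
  by (rule cop_eqI) (auto simp: app_simps fock_app mult.left_commute)

lemma parLR_creL: "parLR * creL i = - (creL i * parLR)"
  by (rule cop_eqI) (auto simp: app_simps fock_app parity_remove)

lemma parLR_creR: "parLR * creR i = - (creR i * parLR)"
  by (rule cop_eqI) (auto simp: app_simps fock_app parity_remove)

lemma creL_creR: "creL i * creR j = - (creR j * creL i)"
  by (rule cop_eqI) (auto simp: app_simps fock_app parity_remove)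

lemma creL_square: "creL i * creL i = 0"
  by (rule cop_eqI) (auto simp: app_simps fock_app)

lemma creR_square: "creR i * creR i = 0"
  by (rule cop_eqI) (auto simp: app_simps fock_app)

lemma exterior_gen_rels:
  assumes x: "x \<in> dk_rels"
  shows "free_hom exterior_gen x = 0"
proof (rule dk_rels_free_hom[OF _ _ _ _ _ _ _ _ _ _ _ _ _ x])
  show "exterior_gen (gXi i) * exterior_gen (gXi j) +
      exterior_gen (gXi j) * exterior_gen (gXi i) = 0" for i j :: 'a
    by (simp add: creL_creL[of i j])
  show "exterior_gen (gXib i) * exterior_gen (gXib j) +
      exterior_gen (gXib j) * exterior_gen (gXib i) = 0" for i j :: 'a
    by (simp add: creR_creR[of i j])
  note simps = parLR_square parLR_creL parLR_creR creL_creR creL_square creR_square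
  show "exterior_gen gK * exterior_gen gK = (1 :: ('a set \<times> 'a set) cop)"
    "exterior_gen gKb * exterior_gen gKb = (1 :: ('a set \<times> 'a set) cop)"
    "exterior_gen gK * exterior_gen gKb * (exterior_gen gK * exterior_gen gKb) =
      (1 :: ('a set \<times> 'a set) cop)"
    by (simp_all add: simps)
  fix i j :: 'a
  show "exterior_gen (gXi i) * exterior_gen (gXi i) = 0"
    "exterior_gen (gXib i) * exterior_gen (gXib i) = 0"
    "exterior_gen gK * exterior_gen (gXi i) + exterior_gen (gXi i) * exterior_gen gK = 0"
    "exterior_gen gKb * exterior_gen (gXi i) + exterior_gen (gXi i) * exterior_gen gKb = 0"
    "exterior_gen gK * exterior_gen (gXib i) + exterior_gen (gXib i) * exterior_gen gK = 0"
    "exterior_gen gKb * exterior_gen (gXib i) + exterior_gen (gXib i) * exterior_gen gKb = 0"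
    "exterior_gen (gXi i) * exterior_gen (gXib j) + exterior_gen (gXib j) * exterior_gen (gXi i) = 0"
    "exterior_gen (gXi i) * exterior_gen (gXib i) =
      1 - exterior_gen gK * exterior_gen gKb - exterior_gen (gXib i) * exterior_gen (gXi i)"
    by (simp_all add: simps)
qed


definition clifford_rep :: "complex \<Rightarrow> 'n::{finite,linorder} dk \<Rightarrow> 'n set cop"
  where "clifford_rep \<eta> = dk_eval (clifford_gen \<eta>)"

definition exterior_rep :: "'n::{finite,linorder} dk \<Rightarrow> ('n set \<times> 'n set) cop"
  where "exterior_rep = dk_eval exterior_gen"

context
  fixes \<eta> :: complex
  assumes \<eta>: "\<eta> = 1 \<or> \<eta> = -1"
begin

lemma clifford_rep_gen:
  "clifford_rep \<eta> dkK = \<eta> *\<^sub>C par"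
  "clifford_rep \<eta> dkKb = (- \<eta>) *\<^sub>C par"
  "clifford_rep \<eta> (xi i) = 2 *\<^sub>C ann i"
  "clifford_rep \<eta> (xib i) = cre i"
  by (simp_all only: clifford_rep_def dk_eval_gen[OF clifford_gen_rels[OF \<eta>]] clifford_gen.simps)

lemma clinear_clifford_rep: "clinear (clifford_rep \<eta>)"
  unfolding clifford_rep_def by (rule clinear_dk_eval[OF clifford_gen_rels[OF \<eta>]])

lemma clifford_rep_one: "clifford_rep \<eta> 1 = 1"
  and clifford_rep_mult: "clifford_rep \<eta> (x * y) = clifford_rep \<eta> x * clifford_rep \<eta> y"
  by (simp_all only: clifford_rep_def dk_eval_one[OF clifford_gen_rels[OF \<eta>]]
      dk_eval_mult[OF clifford_gen_rels[OF \<eta>]])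

lemmas clifford_rep_linear = clinear_add[OF clinear_clifford_rep] clinear_scale[OF clinear_clifford_rep]
  clinear_diff[OF clinear_clifford_rep] clinear_uminus[OF clinear_clifford_rep]
  clinear_sum[OF clinear_clifford_rep] clinear_zero[OF clinear_clifford_rep]

lemmas clifford_rep_simps = clifford_rep_gen clifford_rep_one clifford_rep_mult clifford_rep_linear

lemma clifford_rep_word: "clifford_rep \<eta> (word g A) = word (\<lambda>i. clifford_rep \<eta> (g i)) A"
  for A :: "'i::{finite,linorder} set"
  by (rule word_hom) (simp_all add: clifford_rep_one clifford_rep_mult)

lemma clifford_rep_Kb: "clifford_rep \<eta> dkKb = - clifford_rep \<eta> dkK"
  by (simp add: clifford_rep_gen)

lemma clifford_rep_K_square: "clifford_rep \<eta> dkK * clifford_rep \<eta> dkK = 1"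
  by (simp add: dk_relations clifford_rep_one flip: clifford_rep_mult)

lemma clifford_rep_dkc: "clifford_rep \<eta> dkc = -1"
  by (simp add: clifford_rep_mult clifford_rep_Kb clifford_rep_K_square)

end

lemma exterior_rep_gen:
  "exterior_rep dkK = parLR"
  "exterior_rep dkKb = parLR"
  "exterior_rep (xi i) = creL i"
  "exterior_rep (xib i) = creR i"
  by (simp_all only: exterior_rep_def dk_eval_gen[OF exterior_gen_rels] exterior_gen.simps)

lemma clinear_exterior_rep: "clinear exterior_rep"
  unfolding exterior_rep_def by (rule clinear_dk_eval[OF exterior_gen_rels])

lemma exterior_rep_one: "exterior_rep 1 = 1"
  and exterior_rep_mult: "exterior_rep (x * y) = exterior_rep x * exterior_rep y"
  by (simp_all only: exterior_rep_def dk_eval_one[OF exterior_gen_rels] dk_eval_mult[OF exterior_gen_rels])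

lemmas exterior_rep_linear = clinear_add[OF clinear_exterior_rep] clinear_scale[OF clinear_exterior_rep]
  clinear_diff[OF clinear_exterior_rep] clinear_uminus[OF clinear_exterior_rep]
  clinear_sum[OF clinear_exterior_rep] clinear_zero[OF clinear_exterior_rep]

lemma exterior_rep_word: "exterior_rep (word g A) = word (\<lambda>i. exterior_rep (g i)) A"
  for A :: "'i::{finite,linorder} set"
  by (rule word_hom) (simp_all add: exterior_rep_one exterior_rep_mult)

section \<open>Creation and annihilation words on basis functions\<close>

lemma jw_min:
  assumes "\<And>j. j \<in> S \<Longrightarrow> \<not> j < i"
  shows "jw i S = 1"
proof -
  have "{j \<in> S. j < i} = {}" using assms by auto
  then show ?thesis by (simp only: jw_def) simp
qed

lemma cre_delta: "app (cre i) (delta S) = (\<lambda>T. (if i \<in> S then 0 else jw i S) * delta (insert i S) T)"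
proof
  fix T
  have "i \<in> T \<and> T - {i} = S \<longleftrightarrow> i \<notin> S \<and> T = insert i S" by auto
  then show "app (cre i) (delta S) T = (if i \<in> S then 0 else jw i S) * delta (insert i S) T"
    by (auto simp: fock_app delta_def jw_insert)
qed

lemma ann_delta: "app (ann i) (delta S) = (\<lambda>T. (if i \<in> S then jw i S else 0) * delta (S - {i}) T)"
proof
  fix T
  have "i \<notin> T \<and> insert i T = S \<longleftrightarrow> i \<in> S \<and> T = S - {i}" by auto
  then show "app (ann i) (delta S) T = (if i \<in> S then jw i S else 0) * delta (S - {i}) T"
    by (auto simp: fock_app delta_def jw_remove)
qed

lemma par_delta: "app par (delta S) = (\<lambda>T. parity S * delta S T)"
  by (auto simp: fock_app delta_def)

text \<open>The smallest index acts last and finds no smaller one present, so every Jordan--Wigner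
  sign is 1.\<close>

lemma word_cre_vacuum: "app (word cre A) (delta {}) = delta A"
  using finite[of A]
  by (induction A rule: finite_linorder_min_induct)
    (auto simp: word_insert_min app_simps cre_delta jw_min not_less_iff_gr_or_eq)

text \<open>For diagonal entries only the support and the vanishing condition matter, so the sign
  stays hidden in \<open>z\<close>.\<close>

lemma word_cre_delta:
  "\<exists>z. app (word cre A) (delta S) = (\<lambda>T. z * delta (A \<union> S) T) \<and> (A \<inter> S \<noteq> {} \<longrightarrow> z = 0)"
  using finite[of A]
proof (induction A rule: finite_linorder_min_induct)
  case empty
  show ?case by (rule exI[of _ 1]) (simp add: app_simps)
next
  case (insert b A)
  then obtain z where z: "app (word cre A) (delta S) = (\<lambda>T. z * delta (A \<union> S) T)"
    "A \<inter> S \<noteq> {} \<longrightarrow> z = 0" by blast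
  show ?case
    by (rule exI[of _ "z * (if b \<in> A \<union> S then 0 else jw b (A \<union> S))"])
      (use z insert in \<open>auto simp: word_insert_min app_simps app_scale cre_delta\<close>)
qed

lemma word_ann_delta:
  "\<exists>z. app (word ann A) (delta S) = (\<lambda>T. z * delta (S - A) T) \<and> (\<not> A \<subseteq> S \<longrightarrow> z = 0)"
  using finite[of A]
proof (induction A rule: finite_linorder_min_induct)
  case empty
  show ?case by (rule exI[of _ 1]) (simp add: app_simps)
next
  case (insert b A)
  then obtain z where z: "app (word ann A) (delta S) = (\<lambda>T. z * delta (S - A) T)"
    "\<not> A \<subseteq> S \<longrightarrow> z = 0" by blast
  show ?case
    by (rule exI[of _ "z * (if b \<in> S - A then jw b (S - A) else 0)"])
      (use z insert in \<open>auto simp: word_insert_min app_simps app_scale ann_delta Diff_insert[symmetric]\<close>)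
qed

definition diagonal :: "'b cop \<Rightarrow> bool"
  where "diagonal T \<longleftrightarrow> (\<forall>s. \<exists>z. app T (delta s) = (\<lambda>t. z * delta s t))"

lemma diagonalE:
  assumes "diagonal T"
  obtains z where "app T (delta s) = (\<lambda>t. z * delta s t)"
  using assms by (auto simp: diagonal_def)

lemma diagonal_one: "diagonal 1"
  unfolding diagonal_def by (intro allI exI[of _ 1]) (simp add: app_simps)

lemma diagonal_par: "diagonal par"
  unfolding diagonal_def using par_delta by blast

lemma diagonal_scale: "diagonal T \<Longrightarrow> diagonal (c *\<^sub>C T)"
  unfolding diagonal_def by (auto simp: app_simps) (metis mult.assoc)

lemma diagonal_mult:
  assumes "diagonal S" "diagonal T"
  shows "diagonal (S * T)"
  unfolding diagonal_def
proof
  fix s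
  obtain y where "app S (delta s) = (\<lambda>t. y * delta s t)" using assms(1) by (rule diagonalE)
  moreover obtain z where "app T (delta s) = (\<lambda>t. z * delta s t)" using assms(2) by (rule diagonalE)
  ultimately have "app (S * T) (delta s) = (\<lambda>t. (z * y) * delta s t)"
    by (simp add: app_simps app_scale mult.assoc)
  then show "\<exists>z. app (S * T) (delta s) = (\<lambda>t. z * delta s t)" by blast
qed

lemma diagonal_power: "diagonal T \<Longrightarrow> diagonal (T ^ k)"
  by (induction k) (simp_all add: diagonal_one diagonal_mult)

text \<open>The diagonal factors only rescale, while the words send \<open>s\<close> to
  \<open>s - w\<close> and then to \<open>v \<union> (s - w)\<close>. Returning to \<open>s\<close>
  with a nonzero coefficient forces \<open>v = w\<close>.\<close>

lemma diagonal_entry_cre_ann: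
  assumes D: "diagonal D1" "diagonal D2" "diagonal D3" and "v \<noteq> w"
  shows "app (D1 * word cre v * D2 * word ann w * D3) (delta s) s = 0"
proof -
  obtain z3 where z3: "app D3 (delta s) = (\<lambda>t. z3 * delta s t)" using D(3) by (rule diagonalE)
  obtain z where z: "app (word ann w) (delta s) = (\<lambda>t. z * delta (s - w) t)" "\<not> w \<subseteq> s \<longrightarrow> z = 0"
    using word_ann_delta by blast
  obtain z2 where z2: "app D2 (delta (s - w)) = (\<lambda>t. z2 * delta (s - w) t)"
    using D(2) by (rule diagonalE)
  obtain y where y: "app (word cre v) (delta (s - w)) = (\<lambda>t. y * delta (v \<union> (s - w)) t)"
    "v \<inter> (s - w) \<noteq> {} \<longrightarrow> y = 0"
    using word_cre_delta by blast
  obtain z1 where z1: "app D1 (delta (v \<union> (s - w))) = (\<lambda>t. z1 * delta (v \<union> (s - w)) t)"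
    using D(1) by (rule diagonalE)
  have "app (D1 * word cre v * D2 * word ann w * D3) (delta s) s =
      z3 * z * z2 * y * z1 * delta (v \<union> (s - w)) s"
    by (simp add: app_simps app_scale z3 z z2 y z1)
  also have "\<dots> = 0"
  proof (cases "w \<subseteq> s \<and> v \<inter> (s - w) = {}")
    case True
    then have "s \<noteq> v \<union> (s - w)" using \<open>v \<noteq> w\<close> by blast
    then show ?thesis by (simp add: delta_def)
  qed (use z(2) y(2) in auto)
  finally show ?thesis .
qed

lemma number_op: "app (cre i * 2 *\<^sub>C ann i) f S = 2 * (if i \<in> S then f S else 0)"
  by (simp add: app_simps fock_app jw_remove insert_absorb)

lemma word_number_op:
  "app (word (\<lambda>i. cre i * 2 *\<^sub>C ann i) A) f S = (if A \<subseteq> S then 2 ^ card A * f S else 0)"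
  using finite[of A]
proof (induction A arbitrary: f rule: finite_linorder_min_induct)
  case (insert b A)
  then have "b \<notin> A" by auto
  with insert show ?case
    by (auto simp: word_insert_min times_cop.rep_eq[of "cre b * _"] number_op)
qed (simp add: app_simps)

lemma anti_number_op: "app (2 *\<^sub>C ann i * cre i) f S = 2 * (if i \<in> S then 0 else f S)"
  by (simp add: app_simps fock_app jw_insert)

lemma word_anti_number_op:
  "app (word (\<lambda>i. 2 *\<^sub>C ann i * cre i) A) f S = (if A \<inter> S = {} then 2 ^ card A * f S else 0)"
  using finite[of A]
proof (induction A arbitrary: f rule: finite_linorder_min_induct)
  case (insert b A)
  then have "b \<notin> A" by auto
  with insert show ?case
    by (auto simp: word_insert_min times_cop.rep_eq[of "2 *\<^sub>C ann b * _"] anti_number_op)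
qed (simp add: app_simps)

text \<open>Each factor is -1 on an empty mode. The word over all indices is the image of
  \<open>dkP\<close>, so this is where the vacuum eigenvalue of \<open>dkP\<close> comes
  from.\<close>

lemma word_one_minus_anti_number_op_vacuum:
  "app (word (\<lambda>i. 1 - 2 *\<^sub>C ann i * cre i) A) (delta {}) = (\<lambda>T. (-1) ^ card A * delta {} T)"
  using finite[of A]
proof (induction A rule: finite_linorder_min_induct)
  case (insert b A)
  then have "b \<notin> A" by auto
  with insert show ?case
    by (auto simp: word_insert_min times_cop.rep_eq[of "1 - _"] minus_cop.rep_eq one_cop.rep_eq anti_number_op
        delta_def)
qed (simp add: app_simps)

text \<open>\<open>word_one_minus\<close> applied to factors \<open>1 - 1\<close>: the product is
  zero unless it is empty.\<close>

lemma sum_Pow_parity: "(\<Sum>B\<in>Pow A. (-1 :: complex) ^ card B) = (if A = {} then 1 else 0)"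
  if "finite A" for A :: "'i::linorder set"
proof -
  have one: "word (\<lambda>_. 1 :: complex) B = 1" if "finite B" for B :: "'i set"
    using that by (induction B rule: finite_linorder_min_induct) (simp_all add: word_insert_min)
  have zero: "word (\<lambda>_. 0 :: complex) A = (if A = {} then 1 else 0)"
    using that by (induction A rule: finite_linorder_min_induct) (auto simp: word_insert_min)
  have "(\<Sum>B\<in>Pow A. (-1 :: complex) ^ card B) = (\<Sum>B\<in>Pow A. (-1) ^ card B *\<^sub>C word (\<lambda>_. 1) B)"
    using that by (intro sum.cong) (auto simp: scaleC_complex_def one finite_subset)
  then show ?thesis using word_one_minus[OF that, of "\<lambda>_. 1 :: complex"] zero by simp
qed

section \<open>Traces of the model operators\<close>

definition clifford_character :: "complex \<Rightarrow> 'n::{finite,linorder} dk \<Rightarrow> complex"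
  where "clifford_character \<eta> x = (\<Sum>S\<in>UNIV. app (clifford_rep \<eta> x) (delta S) S)"

definition exterior_character :: "'n::{finite,linorder} dk \<Rightarrow> complex"
  where "exterior_character x = (\<Sum>s\<in>UNIV. app (exterior_rep x) (delta s) s)"

lemma clinear_clifford_character: "\<eta> = 1 \<or> \<eta> = -1 \<Longrightarrow> clinear (clifford_character \<eta>)"
  by (intro clinearI) (simp_all add: clifford_character_def clifford_rep_simps app_simps
      sum.distrib sum_distrib_left scaleC_complex_def)

lemma clinear_exterior_character: "clinear exterior_character"
  by (intro clinearI) (simp_all add: exterior_character_def exterior_rep_linear app_simps
      sum.distrib sum_distrib_left scaleC_complex_def)

lemma sum_supersets:
  fixes A :: "'i::finite set" and h :: "'i set \<Rightarrow> complex"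
  shows "(\<Sum>S\<in>UNIV. if A \<subseteq> S then h S else 0) = (\<Sum>B\<in>Pow (- A). h (A \<union> B))"
proof -
  have "(\<Sum>S\<in>UNIV. if A \<subseteq> S then h S else 0) = sum h {S. A \<subseteq> S}"
    by (simp add: sum.If_cases)
  also have "\<dots> = (\<Sum>B\<in>Pow (- A). h (A \<union> B))"
    by (rule sum.reindex_bij_witness[of _ "\<lambda>B. A \<union> B" "\<lambda>S. S - A"]) (auto simp: Un_absorb1)
  finally show ?thesis .
qed

text \<open>Up to the reordering sign the word is a product of number operators, equal to
  \<open>2 ^ card v\<close> on supersets of \<open>v\<close> and 0 elsewhere; there are
  \<open>2 ^ card (- v)\<close> supersets. The factor \<open>dkK\<close> turns their count into an
  alternating sum, which vanishes unless \<open>v\<close> is everything.\<close>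

lemma clifford_character_word:
  fixes v :: "'n::{finite,linorder} set"
  assumes \<eta>: "\<eta> = 1 \<or> \<eta> = -1"
  shows "clifford_character \<eta> (xib_word v * xi_word v) = (-1) ^ (card v div 2) * 2 ^ CARD('n)"
    and "clifford_character \<eta> (dkK * (xib_word v * xi_word v)) =
      (if v = UNIV then \<eta> * (-1) ^ CARD('n) * (-1) ^ (CARD('n) div 2) * 2 ^ CARD('n) else 0)"
proof -
  let ?s = "(-1) ^ (card v div 2) :: complex"
  have "xib_word v * xi_word v = ?s *\<^sub>C word (\<lambda>i. xib i * xi i) v"
    unfolding xi_word_eq xib_word_eq
    by (rule word_mult_word) (simp_all add: dk_commute(8))
  then have "clifford_rep \<eta> (xib_word v * xi_word v) = ?s *\<^sub>C word (\<lambda>i. cre i * 2 *\<^sub>C ann i) v"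
    by (simp add: clifford_rep_linear[OF \<eta>] clifford_rep_word[OF \<eta>] clifford_rep_mult[OF \<eta>]
        clifford_rep_gen[OF \<eta>])
  then have *: "app (clifford_rep \<eta> (xib_word v * xi_word v)) f S =
      ?s * (if v \<subseteq> S then 2 ^ card v * f S else 0)" for f S
    by (simp add: scaleC_cop.rep_eq word_number_op)
  have card: "card v + card (- v) = CARD('n)"
    by (metis card_Un_disjoint Compl_partition Compl_disjoint finite)
  have "clifford_character \<eta> (xib_word v * xi_word v) = (\<Sum>S\<in>UNIV. if v \<subseteq> S then ?s * 2 ^ card v else 0)"
    unfolding clifford_character_def * by (intro sum.cong) (auto simp: delta_def)
  also have "\<dots> = ?s * (2 ^ card v * 2 ^ card (- v))"
    by (subst sum_supersets) (simp add: card_Pow)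
  finally show "clifford_character \<eta> (xib_word v * xi_word v) = ?s * 2 ^ CARD('n)"
    by (simp add: card flip: power_add)
  have "clifford_character \<eta> (dkK * (xib_word v * xi_word v)) =
      (\<Sum>S\<in>UNIV. if v \<subseteq> S then \<eta> * ?s * 2 ^ card v * parity S else 0)"
    unfolding clifford_character_def clifford_rep_mult[OF \<eta>, of dkK] times_cop.rep_eq[of "clifford_rep \<eta> dkK"]
    by (intro sum.cong) (auto simp: * clifford_rep_gen[OF \<eta>] scaleC_cop.rep_eq fock_app delta_def)
  also have "\<dots> = (\<Sum>B\<in>Pow (- v). \<eta> * ?s * 2 ^ card v * parity v * (-1) ^ card B)"
    unfolding sum_supersets
  proof (intro sum.cong refl)
    fix B assume "B \<in> Pow (- v)"
    then have "card (v \<union> B) = card v + card B" by (intro card_Un_disjoint) auto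
    then show "\<eta> * ?s * 2 ^ card v * parity (v \<union> B) = \<eta> * ?s * 2 ^ card v * parity v * (-1) ^ card B"
      by (simp add: parity_def power_add)
  qed
  also have "\<dots> = \<eta> * ?s * 2 ^ card v * parity v * (if v = UNIV then 1 else 0)"
    by (auto simp: sum_Pow_parity simp flip: sum_distrib_left)
  finally show "clifford_character \<eta> (dkK * (xib_word v * xi_word v)) =
      (if v = UNIV then \<eta> * (-1) ^ CARD('n) * (-1) ^ (CARD('n) div 2) * 2 ^ CARD('n) else 0)"
    by (simp add: parity_def)
qed

lemma clifford_character_cross:
  assumes \<eta>: "\<eta> = 1 \<or> \<eta> = -1" and "v \<noteq> w"
  shows "clifford_character \<eta> (dkK ^ a * (xib_word v * dkKb ^ b) * (xi_word w * dkK ^ c)) = 0"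
proof -
  have pow: "clifford_rep \<eta> (x ^ k) = clifford_rep \<eta> x ^ k" for x :: "'a dk" and k
    by (induction k) (simp_all add: clifford_rep_one[OF \<eta>] clifford_rep_mult[OF \<eta>])
  \<comment> \<open>The factors 2 in the images of the \<open>xi i\<close> are collected in
    \<open>z\<close>, leaving a pure annihilation word.\<close>
  have "\<exists>z. word (\<lambda>i. 2 *\<^sub>C ann i) w = z *\<^sub>C word ann w"
    using finite[of w]
  proof (induction w rule: finite_linorder_min_induct)
    case empty
    show ?case by (rule exI[of _ 1]) simp
  next
    case (insert b A)
    then show ?case by (auto simp: word_insert_min mult_scaleC_left mult_scaleC_right scaleC_scaleC)
  qed
  then obtain z where z: "word (\<lambda>i. 2 *\<^sub>C ann i) w = z *\<^sub>C word ann w" ..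
  have "clifford_rep \<eta> (dkK ^ a * (xib_word v * dkKb ^ b) * (xi_word w * dkK ^ c)) =
      (z *\<^sub>C (\<eta> *\<^sub>C par) ^ a) * word cre v * ((- \<eta>) *\<^sub>C par) ^ b * word ann w * (\<eta> *\<^sub>C par) ^ c"
    by (simp only: xi_word_eq xib_word_eq clifford_rep_mult[OF \<eta>] clifford_rep_word[OF \<eta>] pow
        clifford_rep_gen[OF \<eta>] z mult_scaleC_left mult_scaleC_right mult.assoc)
  moreover have "app (\<dots>) (delta s) s = 0" for s
    by (intro diagonal_entry_cre_ann diagonal_power diagonal_scale diagonal_par \<open>v \<noteq> w\<close>)
  ultimately show ?thesis
    by (simp add: clifford_character_def)
qed


text \<open>On the exterior algebra a nonempty word raises the degree, so it has no diagonal entries.\<close>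

definition raising :: "nat \<Rightarrow> ('n::finite set \<times> 'n set) cop \<Rightarrow> bool"
  where "raising k T \<longleftrightarrow> (\<forall>j f. (\<forall>A B. card A + card B < j \<longrightarrow> f (A, B) = 0) \<longrightarrow>
    (\<forall>A B. card A + card B < j + k \<longrightarrow> app T f (A, B) = 0))"

lemma raisingD:
  fixes f :: "'n::finite set \<times> 'n set \<Rightarrow> complex"
  assumes "raising k T" "\<And>A B. card A + card B < j \<Longrightarrow> f (A, B) = 0" "card A + card B < j + k"
  shows "app T f (A, B) = 0"
  using assms unfolding raising_def by blast

lemma raising_one: "raising 0 1"
  by (simp add: raising_def app_simps)

lemma raising_mult:
  assumes "raising k S" "raising l T"
  shows "raising (k + l) (S * T)"
  unfolding raising_def
proof (intro allI impI)
  fix j and f :: "'a set \<times> 'a set \<Rightarrow> complex" and A B :: "'a set"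
  assume f: "\<forall>A B. card A + card B < j \<longrightarrow> f (A, B) = 0" and AB: "card A + card B < j + (k + l)"
  have "app T f (A, B) = 0" if "card A + card B < j + l" for A B
    using raisingD[OF assms(2), of j f] f that by blast
  then show "app (S * T) f (A, B) = 0"
    using raisingD[OF assms(1), of "j + l" "app T f"] AB by (simp add: app_simps)
qed

lemma raising_parLR: "raising 0 parLR"
  by (simp add: raising_def fock_app)

lemma card_remove_less: "i \<in> A \<Longrightarrow> card A + k < Suc j \<Longrightarrow> card (A - {i}) + k < j"
  for A :: "'n::finite set"
  using card_Suc_Diff1[of A i] by simp

lemma raising_creL: "raising 1 (creL i)"
proof -
  have "card (A - {i}) + card B < j" if "i \<in> A" "card A + card B < Suc j" for j and A B :: "'a set"
    using card_remove_less that by blast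
  then show ?thesis by (auto simp: raising_def fock_app)
qed

lemma raising_creR: "raising 1 (creR i)"
proof -
  have "card A + card (B - {i}) < j" if "i \<in> B" "card A + card B < Suc j" for j and A B :: "'a set"
    using card_remove_less[of i B "card A" j] that by (simp add: add.commute)
  then show ?thesis by (auto simp: raising_def fock_app)
qed

lemma raising_word:
  fixes g :: "'n::{finite,linorder} \<Rightarrow> ('n set \<times> 'n set) cop"
  assumes "\<And>i. raising 1 (g i)"
  shows "raising (card A) (word g A)"
  using finite[of A]
proof (induction A rule: finite_linorder_min_induct)
  case (insert b A)
  then have "b \<notin> A" by auto
  with insert show ?case
    using raising_mult[OF assms[of b]] by (fastforce simp: word_insert_min)
qed (simp add: raising_one)

lemma raising_power: "raising 0 T \<Longrightarrow> raising 0 (T ^ k)"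
  by (induction k) (use raising_one raising_mult[of 0 T 0] in auto)

text \<open>\<open>delta s\<close> starts in the degree of \<open>s\<close>, so its image starts
  strictly higher and vanishes at \<open>s\<close>.\<close>

lemma raising_diagonal_entry:
  assumes "raising k T" "k > 0"
  shows "app T (delta s) s = 0"
proof (cases s)
  case (Pair A B)
  show ?thesis
    unfolding Pair using assms(2)
    by (intro raisingD[OF assms(1), of "card A + card B"]) (auto simp: delta_def)
qed

lemma exterior_character_word:
  assumes "v \<noteq> {} \<or> w \<noteq> {}"
  shows "exterior_character (dkK ^ a * (xib_word v * dkKb ^ b) * (xi_word w * dkK ^ c)) = 0"
proof -
  have pow: "exterior_rep (x ^ k) = exterior_rep x ^ k" for x :: "'a dk" and k
    by (induction k) (simp_all add: exterior_rep_one exterior_rep_mult)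
  have "raising (0 + (card v + 0) + (card w + 0))
      (parLR ^ a * (word creR v * parLR ^ b) * (word creL w * parLR ^ c))"
    by (intro raising_mult raising_power raising_parLR raising_word raising_creL raising_creR)
  moreover have "card v > 0 \<or> card w > 0" using assms by (auto simp: card_gt_0_iff)
  moreover have "exterior_rep (dkK ^ a * (xib_word v * dkKb ^ b) * (xi_word w * dkK ^ c)) =
      parLR ^ a * (word creR v * parLR ^ b) * (word creL w * parLR ^ c)"
    by (simp only: xi_word_eq xib_word_eq exterior_rep_mult exterior_rep_word pow exterior_rep_gen)
  ultimately show ?thesis
    unfolding exterior_character_def by (intro sum.neutral ballI) (simp add: raising_diagonal_entry)
qed

text \<open>Both \<open>1\<close> and \<open>dkc\<close> act as the identity, so their trace is the
  dimension. The trace of \<open>parLR\<close> is a product of two alternating sums over subsets,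
  each zero because the index type is nonempty.\<close>

lemma exterior_character_group:
  "exterior_character (1 :: 'n::{finite,linorder} dk) = 2 ^ (2 * CARD('n))"
  "exterior_character (dkK :: 'n dk) = 0"
  "exterior_character (dkKb :: 'n dk) = 0"
  "exterior_character (dkc :: 'n dk) = 2 ^ (2 * CARD('n))"
proof -
  have one: "(\<Sum>s\<in>UNIV. app (1 :: ('n set \<times> 'n set) cop) (delta s) s) = 2 ^ (2 * CARD('n))"
  proof -
    have "CARD('n set \<times> 'n set) = 2 ^ CARD('n) * 2 ^ CARD('n)"
      by (metis card_cartesian_product card_Pow finite Pow_UNIV UNIV_Times_UNIV)
    then show ?thesis by (simp add: app_simps delta_def mult_2 power_add)
  qed
  show "exterior_character (1 :: 'n dk) = 2 ^ (2 * CARD('n))"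
    by (simp add: exterior_character_def exterior_rep_one one)
  show "exterior_character (dkc :: 'n dk) = 2 ^ (2 * CARD('n))"
    by (simp add: exterior_character_def exterior_rep_mult exterior_rep_gen parLR_square one)
  have "(\<Sum>s\<in>UNIV. app (parLR :: ('n set \<times> 'n set) cop) (delta s) s) =
      (\<Sum>s\<in>Pow (UNIV :: 'n set) \<times> Pow (UNIV :: 'n set). (case s of (A, B) \<Rightarrow> parity A * parity B))"
    unfolding Pow_UNIV UNIV_Times_UNIV by (intro sum.cong) (auto simp: fock_app delta_def)
  also have "\<dots> = (\<Sum>A\<in>Pow (UNIV :: 'n set). parity A) * (\<Sum>B\<in>Pow (UNIV :: 'n set). parity B)"
    by (simp only: sum.cartesian_product[symmetric] sum_product)
  also have "\<dots> = 0"
    by (simp add: parity_def sum_Pow_parity del: Pow_UNIV)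
  finally show "exterior_character (dkK :: 'n dk) = 0" "exterior_character (dkKb :: 'n dk) = 0"
    by (simp_all add: exterior_character_def exterior_rep_gen)
qed


section \<open>The indecomposable projective modules\<close>

lemma span_mult_closed:
  assumes "\<And>b. b \<in> B \<Longrightarrow> g * b \<in> cvs.span B" "y \<in> cvs.span B"
  shows "g * y \<in> cvs.span B"
  using assms(2)
proof (induction rule: cvs.span_induct)
  case base
  show ?case
    by (rule cvs.subspaceI)
      (simp_all add: cvs.span_zero cvs.span_add cvs.span_scale distrib_left mult_scaleC_right)
qed (rule assms(1))

text \<open>Equal and different indices are merged to give the shape
  \<open>d * a j = z j - a j * d\<close> of \<open>word_straighten\<close>, with central
  \<open>z j\<close>.\<close>

lemma xi_xib_commutator:
  "xi i * xib j = (if i = j then 1 - dkc else 0) - xib j * xi i"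
  "xib i * xi j = (if i = j then 1 - dkc else 0) - xi j * xib i"
proof -
  show "xi i * xib j = (if i = j then 1 - dkc else 0) - xib j * xi i"
    by (cases "i = j") (simp add: dk_relations(13), simp add: dk_commute(8))
  show "xib i * xi j = (if i = j then 1 - dkc else 0) - xi j * xib i"
    by (cases "i = j") (simp add: dk_commute(9), simp add: dk_commute(8))
qed

text \<open>The sign is left open; the value 0 of \<epsilon> covers
  \<open>i \<in> A\<close>.\<close>

lemma word_xi_insert: "\<exists>\<epsilon>. xi i * word xi A = \<epsilon> *\<^sub>C word xi (insert i A)"
  and word_xib_insert: "\<exists>\<epsilon>. xib i * word xib A = \<epsilon> *\<^sub>C word xib (insert i A)"
  for A :: "'n::{finite,linorder} set"
proof -
  have "xi i * word xi A = 0 *\<^sub>C word xi (insert i A)" if "i \<in> A"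
    using word_left_mem[of A xi i, OF finite dk_commute(6) dk_relations(4) that] by simp
  then show "\<exists>\<epsilon>. xi i * word xi A = \<epsilon> *\<^sub>C word xi (insert i A)"
    using word_left_notin[of A xi i, OF finite dk_commute(6)] by blast
  have "xib i * word xib A = 0 *\<^sub>C word xib (insert i A)" if "i \<in> A"
    using word_left_mem[of A xib i, OF finite dk_commute(7) dk_relations(5) that] by simp
  then show "\<exists>\<epsilon>. xib i * word xib A = \<epsilon> *\<^sub>C word xib (insert i A)"
    using word_left_notin[of A xib i, OF finite dk_commute(7)] by blast
qed

lemma group_word_commute:
  fixes A :: "'n::{finite,linorder} set"
  shows "dkK * word xi A = (-1) ^ card A *\<^sub>C (word xi A * dkK)"
    "dkK * word xib A = (-1) ^ card A *\<^sub>C (word xib A * dkK)"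
    "dkKb * word xi A = (-1) ^ card A *\<^sub>C (word xi A * dkKb)"
    "dkKb * word xib A = (-1) ^ card A *\<^sub>C (word xib A * dkKb)"
  by (rule word_anticommute; simp add: dk_commute(2-5))+

lemma subspace_left_ideal: "cvs.subspace (left_ideal e)"
proof (rule cvs.subspaceI; clarsimp simp: left_ideal_def)
  show "0 \<in> range (\<lambda>h. h * e)" by (rule range_eqI[of _ _ 0]) simp
  show "x * e + y * e \<in> range (\<lambda>h. h * e)" for x y
    by (rule range_eqI[of _ _ "x + y"]) (simp add: distrib_right)
  show "c *\<^sub>C (x * e) \<in> range (\<lambda>h. h * e)" for c x
    by (rule range_eqI[of _ _ "c *\<^sub>C x"]) (simp add: mult_scaleC_left)
qed

text \<open>The hypotheses make \<open>e\<close> a vacuum vector. The span of the creation words on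
  \<open>e\<close> is stable because \<open>xi i\<close> can be moved to the right until it meets
  \<open>e\<close>.\<close>

lemma left_ideal_clifford:
  fixes e :: "'n::{finite,linorder} dk"
  assumes K: "dkK * e = \<eta> *\<^sub>C e" "dkKb * e = (- \<eta>) *\<^sub>C e" and xi: "\<And>i. xi i * e = 0"
  shows "left_ideal e = cvs.span (range (\<lambda>S. word xib S * e))"
proof (intro equalityI subsetI)
  let ?B = "range (\<lambda>S. word xib S * e)" and ?V = "cvs.span (range (\<lambda>S. word xib S * e))"
  have B: "word xib S * e \<in> ?V" for S by (rule cvs.span_base) auto
  have e: "e \<in> ?V" using B[of "{}"] by simp
  have closed_K: "dkK * y \<in> ?V" if "y \<in> ?V" for y
    using that
  proof (rule span_mult_closed[rotated])
    fix b assume "b \<in> ?B"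
    then obtain S where "b = word xib S * e" by auto
    then have "dkK * b = (-1) ^ card S *\<^sub>C \<eta> *\<^sub>C (word xib S * e)"
      by (simp add: group_word_commute mult_scaleC_left mult_scaleC_right mult.assoc K(1) flip: mult.assoc[of dkK])
    then show "dkK * b \<in> ?V" by (simp add: cvs.span_scale B)
  qed
  have closed_Kb: "dkKb * y \<in> ?V" if "y \<in> ?V" for y
    using that
  proof (rule span_mult_closed[rotated])
    fix b assume "b \<in> ?B"
    then obtain S where "b = word xib S * e" by auto
    then have "dkKb * b = (-1) ^ card S *\<^sub>C (- \<eta>) *\<^sub>C (word xib S * e)"
      by (simp add: group_word_commute mult_scaleC_left mult_scaleC_right mult.assoc K(2) flip: mult.assoc[of dkKb])
    then show "dkKb * b \<in> ?V" by (simp only: cvs.span_scale B)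
  qed
  have closed_xib: "xib i * y \<in> ?V" if "y \<in> ?V" for y i
    using that
  proof (rule span_mult_closed[rotated])
    fix b assume "b \<in> ?B"
    then obtain S where b: "b = word xib S * e" by auto
    obtain \<epsilon> where "xib i * word xib S = \<epsilon> *\<^sub>C word xib (insert i S)"
      using word_xib_insert by blast
    then have "xib i * b = \<epsilon> *\<^sub>C (word xib (insert i S) * e)"
      by (simp add: b mult_scaleC_left flip: mult.assoc)
    then show "xib i * b \<in> ?V" by (simp only: cvs.span_scale B)
  qed
  have closed_xi: "xi i * y \<in> ?V" if "y \<in> ?V" for y i
    using that
  proof (rule span_mult_closed[rotated])
    fix b assume "b \<in> ?B"
    then obtain S where b: "b = word xib S * e" by auto
    have z: "(if i = j then 1 - dkc else 0) * x \<in> ?V" if "x \<in> ?V" for x and j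
      using closed_K[OF closed_Kb[OF that]] that
      by (auto simp: left_diff_distrib mult.assoc cvs.span_zero intro: cvs.span_diff)
    show "xi i * b \<in> ?V"
      unfolding b
      using word_straighten[of S ?V xib "\<lambda>j. if i = j then 1 - dkc else 0" "xi i" e, OF _ _ closed_xib z
          xi_xib_commutator(1)] e xi
      by (simp add: cvs.span_zero)
  qed
  fix x assume "x \<in> left_ideal e"
  then obtain h where "x = h * e" by (auto simp: left_ideal_def)
  moreover have "h * e \<in> ?V"
  proof (rule dk_left_ideal_induct[OF _ _ e])
    show "dk_gen g * y \<in> ?V" if "y \<in> ?V" for g y
      using that closed_K closed_Kb closed_xi closed_xib by (cases g) auto
  qed simp
  ultimately show "x \<in> ?V" by simp
next
  fix x assume "x \<in> cvs.span (range (\<lambda>S. word xib S * e))"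
  moreover have "cvs.span (range (\<lambda>S. word xib S * e)) \<subseteq> left_ideal e"
    by (rule cvs.span_minimal[OF _ subspace_left_ideal]) (auto simp: left_ideal_def)
  ultimately show "x \<in> left_ideal e" by (rule rev_subsetD)
qed


text \<open>Serves \<open>idem_1\<close> as well as the block elements \<open>1 + dkc\<close> and
  \<open>1 - dkc\<close>. Only the eigenvalue of \<open>dkc\<close> on \<open>e\<close> is fixed, so
  the claim is stability under the odd generators and \<open>dkc\<close>, not under
  \<open>dkK\<close>.\<close>

lemma word_span_closed:
  fixes e :: "'n::{finite,linorder} dk"
  assumes c: "dkc * e = \<epsilon> *\<^sub>C e" and y: "y \<in> cvs.span (range (\<lambda>(A, B). word xi A * (word xib B * e)))"
  shows "xi i * y \<in> cvs.span (range (\<lambda>(A, B). word xi A * (word xib B * e)))"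
    and "xib i * y \<in> cvs.span (range (\<lambda>(A, B). word xi A * (word xib B * e)))"
    and "dkc * y = \<epsilon> *\<^sub>C y"
proof -
  let ?B = "range (\<lambda>(A, B). word xi A * (word xib B * e))" and ?V = "cvs.span (range (\<lambda>(A, B). word xi A * (word xib B * e)))"
  have B: "word xi A * (word xib B * e) \<in> ?V" for A B
    by (rule cvs.span_base) (auto intro: range_eqI[of _ _ "(A, B)"])
  have closed_c: "dkc * y = \<epsilon> *\<^sub>C y" if "y \<in> ?V" for y
  proof (rule clinear_eq_on_span[OF _ _ _ that])
    show "clinear ((*) dkc)" "clinear ((*\<^sub>C) \<epsilon>)"
      by (intro clinearI; simp add: distrib_left mult_scaleC_right scaleC_add_right scaleC_scaleC mult.commute)+
    fix b assume "b \<in> ?B"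
    then obtain A C where b: "b = word xi A * word xib C * e" by (auto simp: mult.assoc)
    have "dkc * b = (dkc * (word xi A * word xib C)) * e" by (simp only: b mult.assoc)
    also have "\<dots> = word xi A * word xib C * (dkc * e)"
      unfolding dkc_central[of "word xi A * word xib C", symmetric] by (simp only: mult.assoc)
    finally show "dkc * b = \<epsilon> *\<^sub>C b" by (simp add: c b mult_scaleC_right)
  qed
  have closed_xi: "xi i * y \<in> ?V" if "y \<in> ?V" for y i
    using that
  proof (rule span_mult_closed[rotated])
    fix b assume "b \<in> ?B"
    then obtain A C where b: "b = word xi A * (word xib C * e)" by auto
    obtain \<delta> where "xi i * word xi A = \<delta> *\<^sub>C word xi (insert i A)"
      using word_xi_insert by blast
    then have "xi i * b = \<delta> *\<^sub>C (word xi (insert i A) * (word xib C * e))"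
      by (simp add: b mult_scaleC_left flip: mult.assoc)
    then show "xi i * b \<in> ?V" by (simp only: cvs.span_scale B)
  qed
  have closed_xib: "xib i * y \<in> ?V" if "y \<in> ?V" for y i
    using that
  proof (rule span_mult_closed[rotated])
    fix b assume "b \<in> ?B"
    then obtain A C where b: "b = word xi A * (word xib C * e)" by auto
    have z: "(if i = j then 1 - dkc else 0) * x \<in> ?V" if "x \<in> ?V" for x and j
      using that by (auto simp: left_diff_distrib closed_c cvs.span_zero intro: cvs.span_diff cvs.span_scale)
    obtain \<delta> where "xib i * word xib C = \<delta> *\<^sub>C word xib (insert i C)"
      using word_xib_insert by blast
    \<comment> \<open>The empty \<open>xi\<close> word is written out to match the spanning
      family.\<close>
    then have "xib i * (word xib C * e) = \<delta> *\<^sub>C (word xi {} * (word xib (insert i C) * e))"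
      by (simp add: mult_scaleC_left flip: mult.assoc)
    then have "xib i * (word xib C * e) \<in> ?V" by (simp only: cvs.span_scale B)
    moreover have "word xib C * e \<in> ?V" using B[of "{}" C] by simp
    ultimately show "xib i * b \<in> ?V"
      unfolding b
      using word_straighten[of A ?V xi "\<lambda>j. if i = j then 1 - dkc else 0" "xib i" "word xib C * e",
          OF _ _ closed_xi z xi_xib_commutator(2)]
      by simp
  qed
  show "xi i * y \<in> ?V" "xib i * y \<in> ?V" "dkc * y = \<epsilon> *\<^sub>C y"
    using y closed_xi closed_xib closed_c by blast+
qed

lemma left_ideal_exterior:
  fixes e :: "'n::{finite,linorder} dk"
  assumes K: "dkK * e = e" "dkKb * e = e"
  shows "left_ideal e = cvs.span (range (\<lambda>(A, B). word xi A * (word xib B * e)))"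
proof (intro equalityI subsetI)
  let ?b = "\<lambda>(A, B). word xi A * (word xib B * e)"
  let ?B = "range ?b" and ?V = "cvs.span (range ?b)"
  have B: "word xi A * (word xib B * e) \<in> ?V" for A B
    by (rule cvs.span_base) (auto intro: range_eqI[of _ _ "(A, B)"])
  have e: "e \<in> ?V" using B[of "{}" "{}"] by simp
  have closed_group: "g * y \<in> ?V" if "y \<in> ?V" and g: "g = dkK \<or> g = dkKb" for g y
    using that(1)
  proof (rule span_mult_closed[rotated])
    fix b assume "b \<in> ?B"
    then obtain A C where b: "b = word xi A * (word xib C * e)" by auto
    have comm: "g * word xi A = (-1) ^ card A *\<^sub>C (word xi A * g)"
      "g * word xib C = (-1) ^ card C *\<^sub>C (word xib C * g)" and ge: "g * e = e"
      using g K by (auto simp: group_word_commute)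
    have "g * b = (g * word xi A) * (word xib C * e)" by (simp add: b mult.assoc)
    also have "\<dots> = (-1) ^ card A *\<^sub>C (word xi A * ((g * word xib C) * e))"
      unfolding comm(1) by (simp add: mult_scaleC_left mult.assoc)
    also have "\<dots> = (-1) ^ card A *\<^sub>C (-1) ^ card C *\<^sub>C (word xi A * (word xib C * e))"
      unfolding comm(2) by (simp add: mult_scaleC_left mult_scaleC_right mult.assoc ge)
    finally show "g * b \<in> ?V" by (simp add: cvs.span_scale B)
  qed
  have "dkc * e = 1 *\<^sub>C e" by (simp add: mult.assoc K)
  note closed = word_span_closed[OF this]
  fix x assume "x \<in> left_ideal e"
  then obtain h where "x = h * e" by (auto simp: left_ideal_def)
  moreover have "h * e \<in> ?V"
  proof (rule dk_left_ideal_induct[OF _ _ e])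
    show "dk_gen g * y \<in> ?V" if "y \<in> ?V" for g y
      using that closed_group closed by (cases g) auto
  qed simp
  ultimately show "x \<in> ?V" by simp
next
  fix x assume "x \<in> cvs.span (range (\<lambda>(A, B). word xi A * (word xib B * e)))"
  moreover have "cvs.span (range (\<lambda>(A, B). word xi A * (word xib B * e))) \<subseteq> left_ideal e"
    by (rule cvs.span_minimal[OF _ subspace_left_ideal]) (auto simp: left_ideal_def simp flip: mult.assoc)
  ultimately show "x \<in> left_ideal e" by (rule rev_subsetD)
qed

lemma creL_delta: "(\<And>j. j \<in> S \<Longrightarrow> i < j) \<Longrightarrow> app (creL i) (delta (S, B)) = delta (insert i S, B)"
proof
  fix s :: "'a set \<times> 'a set" assume S: "\<And>j. j \<in> S \<Longrightarrow> i < j"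
  then have "i \<notin> S" by auto
  then have "i \<in> T \<and> T - {i} = S \<longleftrightarrow> T = insert i S" for T by auto
  moreover have "jw i (insert i S) = 1" using S by (intro jw_min) (auto simp: not_less_iff_gr_or_eq)
  ultimately show "app (creL i) (delta (S, B)) s = delta (insert i S, B) s"
    by (cases s) (auto simp: fock_app delta_def)
qed

text \<open>With an empty left set the factor \<open>parity\<close> is 1. In the spanning family the
  \<open>xib\<close> words act first, so no sign ever appears.\<close>

lemma creR_delta: "(\<And>j. j \<in> S \<Longrightarrow> i < j) \<Longrightarrow> app (creR i) (delta ({}, S)) = delta ({}, insert i S)"
proof
  fix s :: "'a set \<times> 'a set" assume S: "\<And>j. j \<in> S \<Longrightarrow> i < j"
  then have "i \<notin> S" by auto
  then have "i \<in> T \<and> T - {i} = S \<longleftrightarrow> T = insert i S" for T by auto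
  moreover have "jw i (insert i S) = 1" using S by (intro jw_min) (auto simp: not_less_iff_gr_or_eq)
  ultimately show "app (creR i) (delta ({}, S)) s = delta ({}, insert i S) s"
    by (cases s) (auto simp: fock_app delta_def parity_def)
qed

lemma word_creR_delta: "app (word creR B) (delta ({}, {})) = delta ({}, B)"
  using finite[of B]
  by (induction B rule: finite_linorder_min_induct)
    (simp_all add: word_insert_min app_simps creR_delta)

lemma word_creL_delta: "app (word creL A) (delta ({}, B)) = delta (A, B)"
  using finite[of A]
  by (induction A rule: finite_linorder_min_induct)
    (simp_all add: word_insert_min app_simps creL_delta)

lemma parLR_vacuum: "app parLR (delta ({}, {})) = delta ({}, {})"
  by (auto simp: fock_app delta_def parity_def)

text \<open>The group elements fix the vacuum, hence so does \<open>idem_1\<close>, and the spanning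
  words of \<open>left_ideal_exterior\<close> are sent exactly to the basis functions.\<close>

lemma module_character_idem_1:
  "module_character (left_ideal (idem_1 :: 'n::{finite,linorder} dk)) = exterior_character"
proof
  fix x :: "'n dk"
  let ?b = "\<lambda>(A, B). word xi A * (word xib B * (idem_1 :: 'n dk))"
  have K: "dkK * idem_1 = (idem_1 :: 'n dk)" "dkKb * idem_1 = (idem_1 :: 'n dk)"
    by (simp_all add: idem_1_def mult_scaleC_right distrib_left dk_left_cancel dk_left_commute
        dk_relations(1,2) dk_commute(1) add_ac)
  have e: "app (exterior_rep idem_1) (delta ({}, {})) = delta ({} :: 'n set, {} :: 'n set)"
    by (simp add: idem_1_def exterior_rep_linear exterior_rep_one exterior_rep_mult exterior_rep_gen
        app_simps parLR_vacuum)
  have "app (exterior_rep (?b s)) (delta ({}, {})) = delta s" for s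
    by (cases s) (simp add: exterior_rep_mult exterior_rep_word exterior_rep_gen app_simps e
        word_creR_delta word_creL_delta)
  then show "module_character (left_ideal idem_1) x = exterior_character x"
    unfolding exterior_character_def
    by (rule module_character_eq_trace[OF clinear_exterior_rep exterior_rep_mult left_ideal_exterior[OF K]])
qed

lemma xi_top: "xi i * xi_word UNIV = 0" and xib_top: "xib i * xib_word UNIV = 0"
  unfolding xi_word_eq xib_word_eq
  using word_left_mem[of UNIV xi i, OF finite dk_commute(6) dk_relations(4)]
    word_left_mem[of UNIV xib i, OF finite dk_commute(7) dk_relations(5)] by simp_all

text \<open>All modes are filled and then emptied: each contributes 2, and reordering contributes
  the sign. With the factor 4 of the group part this explains the normalisation of
  \<open>idem_K\<close> and \<open>idem_Kb\<close>.\<close>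

lemma clifford_rep_top_vacuum:
  assumes \<eta>: "\<eta> = 1 \<or> \<eta> = -1"
  shows "app (clifford_rep \<eta> (xi_word UNIV * xib_word UNIV)) (delta ({} :: 'n::{finite,linorder} set)) =
    (\<lambda>T. (-1) ^ (CARD('n) div 2) * 2 ^ CARD('n) * delta {} T)"
proof -
  have "xi_word UNIV * xib_word UNIV = (-1) ^ (CARD('n) div 2) *\<^sub>C word (\<lambda>i. xi i * xib i) (UNIV :: 'n set)"
    unfolding xi_word_eq xib_word_eq
    by (rule word_mult_word) (simp_all add: dk_commute(8))
  then show ?thesis
    by (auto simp: clifford_rep_linear[OF \<eta>] clifford_rep_word[OF \<eta>] clifford_rep_mult[OF \<eta>]
        clifford_rep_gen[OF \<eta>] scaleC_cop.rep_eq word_anti_number_op delta_def)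
qed

lemma par_vacuum: "app par (delta {}) = delta {}"
  by (auto simp: fock_app delta_def parity_def)

text \<open>The parameter \<eta> treats \<open>idem_K\<close> and \<open>idem_Kb\<close> together.
  The scalar makes \<open>e\<close> fix the vacuum, so that \<open>word xib S * e\<close> is sent to
  \<open>delta S\<close>.\<close>

lemma module_character_clifford:
  fixes e :: "'n::{finite,linorder} dk"
  assumes \<eta>: "\<eta> = 1 \<or> \<eta> = -1"
    and e: "e = ((-1) ^ (CARD('n) div 2) / 2 ^ (CARD('n) + 2)) *\<^sub>C
      ((1 + \<eta> *\<^sub>C dkK - \<eta> *\<^sub>C dkKb - dkc) * xi_word UNIV * xib_word UNIV)"
  shows "module_character (left_ideal e) = clifford_character \<eta>"
proof
  fix x :: "'n dk"
  let ?g = "1 + \<eta> *\<^sub>C dkK - \<eta> *\<^sub>C dkKb - (dkc :: 'n dk)"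
  have "dkK * ?g = \<eta> *\<^sub>C ?g" "dkKb * ?g = (- \<eta>) *\<^sub>C ?g"
    using \<eta> by (auto simp: algebra_simps dk_left_cancel dk_left_commute dk_relations(1,2) dk_commute(1))
  then have K: "dkK * e = \<eta> *\<^sub>C e" "dkKb * e = (- \<eta>) *\<^sub>C e"
    by (simp_all add: e mult_scaleC_left mult_scaleC_right scaleC_scaleC mult.commute flip: mult.assoc)
  have xi: "xi i * e = 0" for i
  proof -
    \<comment> \<open>Passing the group part flips the signs of \<open>dkK\<close> and
      \<open>dkKb\<close> but not of \<open>dkc\<close>; then \<open>xi i\<close> meets the longest
      \<open>xi\<close> word and gives zero.\<close>
    have "xi i * ?g = (1 - \<eta> *\<^sub>C dkK + \<eta> *\<^sub>C dkKb - dkc) * xi i"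
      by (simp add: algebra_simps mult_scaleC_left mult_scaleC_right dk_left_commute dk_commute(2-5))
    then have "xi i * (?g * xi_word UNIV * xib_word UNIV) =
        (1 - \<eta> *\<^sub>C dkK + \<eta> *\<^sub>C dkKb - dkc) * (xi i * xi_word UNIV) * xib_word UNIV"
      by (simp flip: mult.assoc)
    then show ?thesis by (simp add: e mult_scaleC_right xi_top)
  qed
  \<comment> \<open>On the vacuum \<open>dkK\<close>, \<open>dkKb\<close> and \<open>dkc\<close> are
    \<eta>, -\<eta> and -1, so the four terms add up to 4.\<close>
  have g: "app (clifford_rep \<eta> ?g) (delta {}) = (\<lambda>T. 4 * delta {} T)"
    using \<eta> by (auto simp: clifford_rep_linear[OF \<eta>] clifford_rep_one[OF \<eta>] clifford_rep_dkc[OF \<eta>]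
        clifford_rep_gen[OF \<eta>] app_simps par_vacuum)
  have "app (clifford_rep \<eta> e) (delta {}) =
      (\<lambda>T. (-1) ^ (CARD('n) div 2) / 2 ^ (CARD('n) + 2) *
        app (clifford_rep \<eta> ?g) (app (clifford_rep \<eta> (xi_word UNIV * xib_word UNIV)) (delta {})) T)"
    by (simp only: e clifford_rep_linear(2)[OF \<eta>] scaleC_cop.rep_eq mult.assoc[of ?g]
        clifford_rep_mult[OF \<eta>, of ?g] times_cop.rep_eq)
  also have "\<dots> = delta {}"
    unfolding clifford_rep_top_vacuum[OF \<eta>] app_scale g
    by (simp add: power_add field_simps flip: power_mult_distrib)
  finally have "app (clifford_rep \<eta> e) (delta {}) = delta {}" .
  then have "app (clifford_rep \<eta> (word xib S * e)) (delta {}) = delta S" for S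
    by (simp add: clifford_rep_mult[OF \<eta>] clifford_rep_word[OF \<eta>] clifford_rep_gen[OF \<eta>] app_simps
        word_cre_vacuum)
  then show "module_character (left_ideal e) x = clifford_character \<eta> x"
    unfolding clifford_character_def
    by (rule module_character_eq_trace[OF clinear_clifford_rep[OF \<eta>] clifford_rep_mult[OF \<eta>]
          left_ideal_clifford[OF K xi]])
qed

lemma module_character_idem_K: "module_character (left_ideal idem_K) = clifford_character 1"
  by (rule module_character_clifford) (simp_all add: idem_K_def)

lemma module_character_idem_Kb: "module_character (left_ideal idem_Kb) = clifford_character (-1)"
  by (rule module_character_clifford) (simp_all add: idem_Kb_def)


section \<open>The Drinfeld map\<close>

lemma cbilinear_swap: "cbilinear (\<lambda>a b. b \<otimes>\<^sub>C a)"
  unfolding cbilinear_def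
  by (auto intro!: clinearI simp: tensor_add_left tensor_add_right tensor_scale_left tensor_scale_right)

lemma clinear_tensor_swap: "clinear tensor_swap"
  unfolding tensor_swap_def by (rule clinear_tensor_lift)

lemma tensor_swap_tensor_of: "tensor_swap (a \<otimes>\<^sub>C b) = b \<otimes>\<^sub>C a"
  unfolding tensor_swap_def by (rule tensor_lift_tensor_of[OF cbilinear_swap])

lemma drinfeld_map_expand:
  fixes \<beta> :: "'n::{finite,linorder} dk \<Rightarrow> complex"
  assumes \<beta>: "clinear \<beta>"
  defines "Y \<equiv> \<lambda>w. xib_word w * dkKb ^ card w"
  shows "drinfeld_map \<beta> = (\<Sum>v\<in>UNIV. \<Sum>w\<in>UNIV. ((-1) ^ (card v div 2) * (-1) ^ (card w div 2) / 4) *\<^sub>C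
    (\<beta> (dkK * (Y v * xi_word w)) *\<^sub>C (xi_word v * (1 + dkK) * Y w * (1 + dkKb)) +
     \<beta> (dkK * (Y v * (xi_word w * dkK))) *\<^sub>C (xi_word v * (1 + dkK) * Y w * (1 - dkKb)) +
     \<beta> (dkK * (Y v * dkKb * xi_word w)) *\<^sub>C (xi_word v * (1 - dkK) * Y w * (1 + dkKb)) +
     \<beta> (dkK * (Y v * dkKb * (xi_word w * dkK))) *\<^sub>C (xi_word v * (1 - dkK) * Y w * (1 - dkKb))))"
proof -
  let ?t = "\<lambda>w :: 'n set. (-1) ^ (card w div 2) :: complex"
  \<comment> \<open>The group part of the R-matrix is regrouped as
    \<open>1 \<otimes> (1 + dkKb) + dkK \<otimes> (1 - dkKb)\<close> for \<open>P\<close>, and after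
    the swap as \<open>1 \<otimes> (1 + dkK) + dkKb \<otimes> (1 - dkK)\<close> for
    \<open>Q\<close>. In this way the leg evaluated by \<beta> is always a monomial.\<close>
  define P where "P w = xi_word w \<otimes>\<^sub>C (Y w * (1 + dkKb)) + (xi_word w * dkK) \<otimes>\<^sub>C (Y w * (1 - dkKb))" for w
  define Q where "Q v = Y v \<otimes>\<^sub>C (xi_word v * (1 + dkK)) + (Y v * dkKb) \<otimes>\<^sub>C (xi_word v * (1 - dkK))" for v
  have R: "R_matrix = (\<Sum>w\<in>UNIV. (?t w / 2) *\<^sub>C P w)"
    unfolding R_matrix_def P_def Y_def sum_distrib_right
    by (intro sum.cong refl) (simp add: mult_scaleC_left mult_scaleC_right scaleC_scaleC
        distrib_left right_diff_distrib tensor_mult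
        tensor_add_right tensor_diff_right scaleC_add_right cvs.scale_right_diff_distrib algebra_simps)
  have "tensor_swap (P v) = Q v" for v
    unfolding P_def Q_def
    by (simp add: clinear_add[OF clinear_tensor_swap] clinear_diff[OF clinear_tensor_swap] tensor_swap_tensor_of distrib_left
        right_diff_distrib tensor_add_left tensor_add_right tensor_diff_left tensor_diff_right)
  then have R21: "tensor_swap R_matrix = (\<Sum>v\<in>UNIV. (?t v / 2) *\<^sub>C Q v)"
    by (simp add: R clinear_sum[OF clinear_tensor_swap] clinear_scale[OF clinear_tensor_swap])
  define L where "L = tensor_lift (\<lambda>a b. \<beta> (dkK * a) *\<^sub>C (b :: 'n dk))"
  have bil: "cbilinear (\<lambda>a b. \<beta> (dkK * a) *\<^sub>C (b :: 'n dk))"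
    unfolding cbilinear_def
    by (auto intro!: clinearI simp: scaleC_add_right scaleC_add_left scaleC_scaleC distrib_left
        clinear_add[OF \<beta>] clinear_scale[OF \<beta>] mult_scaleC_right scaleC_complex_def mult.commute)
  have linL: "clinear L" unfolding L_def by (rule clinear_tensor_lift)
  have Lpure: "L (a \<otimes>\<^sub>C b) = \<beta> (dkK * a) *\<^sub>C b" for a b
    unfolding L_def by (rule tensor_lift_tensor_of[OF bil])
  have "drinfeld_map \<beta> = L ((\<Sum>v\<in>UNIV. (?t v / 2) *\<^sub>C Q v) * (\<Sum>w\<in>UNIV. (?t w / 2) *\<^sub>C P w))"
    by (simp only: drinfeld_map_def L_def R21) (simp only: R)
  also have "\<dots> = (\<Sum>v\<in>UNIV. \<Sum>w\<in>UNIV. (?t v * ?t w / 4) *\<^sub>C L (Q v * P w))"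
    by (simp add: sum_product clinear_sum[OF linL] clinear_scale[OF linL] mult_scaleC_left
        mult_scaleC_right scaleC_scaleC mult_ac)
  finally show ?thesis
    by (simp add: P_def Q_def distrib_left[of "_ + _" "_ \<otimes>\<^sub>C _"] distrib_right[of "_ \<otimes>\<^sub>C _"]
        tensor_mult clinear_add[OF linL] Lpure mult.assoc add_ac)
qed


text \<open>Four times the summand with \<open>v = w\<close> of the expansion; its two equal signs
  cancel.\<close>

definition drinfeld_term :: "('n::{finite,linorder} dk \<Rightarrow> complex) \<Rightarrow> 'n set \<Rightarrow> 'n dk"
  where "drinfeld_term \<beta> v = (let Y = xib_word v * dkKb ^ card v in
    \<beta> (dkK * (Y * xi_word v)) *\<^sub>C (xi_word v * (1 + dkK) * Y * (1 + dkKb)) +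
    \<beta> (dkK * (Y * (xi_word v * dkK))) *\<^sub>C (xi_word v * (1 + dkK) * Y * (1 - dkKb)) +
    \<beta> (dkK * (Y * dkKb * xi_word v)) *\<^sub>C (xi_word v * (1 - dkK) * Y * (1 + dkKb)) +
    \<beta> (dkK * (Y * dkKb * (xi_word v * dkK))) *\<^sub>C (xi_word v * (1 - dkK) * Y * (1 - dkKb)))"

text \<open>Brings the four evaluations in the expansion to one form with exponents, so that a
  single vanishing statement covers them.\<close>

lemma character_terms_zero:
  assumes "\<And>b c. \<beta> (dkK ^ 1 * (xib_word v * dkKb ^ b) * (xi_word w * dkK ^ c)) = 0"
  shows "\<beta> (dkK * (xib_word v * dkKb ^ k * xi_word w)) = 0"
    and "\<beta> (dkK * (xib_word v * dkKb ^ k * (xi_word w * dkK))) = 0"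
    and "\<beta> (dkK * (xib_word v * dkKb ^ k * dkKb * xi_word w)) = 0"
    and "\<beta> (dkK * (xib_word v * dkKb ^ k * dkKb * (xi_word w * dkK))) = 0"
  using assms[of k 0] assms[of k 1] assms[of "Suc k" 0] assms[of "Suc k" 1]
  by (simp_all add: mult.assoc power_commutes)

lemma drinfeld_map_diagonal:
  assumes \<beta>: "clinear \<beta>"
    and cross: "\<And>v w b c. v \<noteq> w \<Longrightarrow>
      \<beta> (dkK ^ 1 * (xib_word v * dkKb ^ b) * (xi_word w * dkK ^ c)) = 0"
  shows "drinfeld_map \<beta> = (1/4) *\<^sub>C (\<Sum>v\<in>UNIV. drinfeld_term \<beta> v)"
proof -
  have "drinfeld_map \<beta> = (\<Sum>v\<in>UNIV. \<Sum>w\<in>UNIV. if v = w then (1/4) *\<^sub>C drinfeld_term \<beta> v else 0)"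
    unfolding drinfeld_map_expand[OF \<beta>]
  proof (intro sum.cong refl)
    fix v w :: "'a set"
    show "((-1) ^ (card v div 2) * (-1) ^ (card w div 2) / 4) *\<^sub>C
      (\<beta> (dkK * (xib_word v * dkKb ^ card v * xi_word w)) *\<^sub>C
        (xi_word v * (1 + dkK) * (xib_word w * dkKb ^ card w) * (1 + dkKb)) +
       \<beta> (dkK * (xib_word v * dkKb ^ card v * (xi_word w * dkK))) *\<^sub>C
        (xi_word v * (1 + dkK) * (xib_word w * dkKb ^ card w) * (1 - dkKb)) +
       \<beta> (dkK * (xib_word v * dkKb ^ card v * dkKb * xi_word w)) *\<^sub>C
        (xi_word v * (1 - dkK) * (xib_word w * dkKb ^ card w) * (1 + dkKb)) +
       \<beta> (dkK * (xib_word v * dkKb ^ card v * dkKb * (xi_word w * dkK))) *\<^sub>C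
        (xi_word v * (1 - dkK) * (xib_word w * dkKb ^ card w) * (1 - dkKb))) =
      (if v = w then (1/4) *\<^sub>C drinfeld_term \<beta> v else 0)"
    proof (cases "v = w")
      case True
      have "(-1 :: complex) ^ (card w div 2) * (-1) ^ (card w div 2) = 1"
        by (simp flip: power_mult_distrib)
      then show ?thesis by (simp only: True if_True drinfeld_term_def Let_def refl)
    next
      case False
      then show ?thesis
        by (simp only: character_terms_zero[of \<beta> v w, OF cross[OF False]] if_False) simp
    qed
  qed
  then show ?thesis
    by (simp add: cvs.scale_sum_right)
qed

text \<open>Only the empty word contributes, and there only the evaluations at \<open>1\<close> and
  \<open>dkc\<close> are nonzero. In the sum of the two remaining terms the component with
  \<open>dkc = 1\<close> cancels, so the exterior character lands in the Clifford block.\<close>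

lemma drinfeld_map_exterior:
  "drinfeld_map exterior_character = (2 ^ (2 * CARD('n)) / 2) *\<^sub>C (1 - dkc :: 'n::{finite,linorder} dk)"
proof -
  have zero: "drinfeld_term exterior_character v = 0" if "v \<noteq> {}" for v :: "'n set"
  proof -
    have *: "exterior_character (dkK ^ 1 * (xib_word v * dkKb ^ b) * (xi_word v * dkK ^ c)) = 0" for b c
      using that by (intro exterior_character_word) auto
    show ?thesis
      by (simp only: drinfeld_term_def Let_def character_terms_zero[of exterior_character v v, OF *]) simp
  qed
  have "drinfeld_map exterior_character =
      (1/4) *\<^sub>C (\<Sum>v\<in>UNIV. drinfeld_term exterior_character (v :: 'n set))"
    by (rule drinfeld_map_diagonal[OF clinear_exterior_character])
      (intro exterior_character_word, blast)
  also have "(\<Sum>v\<in>UNIV. drinfeld_term exterior_character (v :: 'n set)) =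
      drinfeld_term exterior_character ({} :: 'n set)"
    by (subst sum.remove[of _ "{}"]) (simp_all add: zero)
  also have "\<dots> = (2 ^ (2 * CARD('n))) *\<^sub>C ((1 + dkK) * (1 - dkKb) + (1 - dkK) * (1 + dkKb))"
    by (simp add: drinfeld_term_def xi_word_eq xib_word_eq exterior_character_group dk_relations(1,2)
        dk_commute(1) dk_left_cancel scaleC_add_right)
  also have "(1 + dkK) * (1 - dkKb) + (1 - dkK) * (1 + dkKb) = 2 *\<^sub>C (1 - dkc :: 'n dk)"
    using scaleC_add_left[of 1 1 "1 - dkc :: 'n dk"] by (simp add: algebra_simps)
  finally show ?thesis by (simp add: scaleC_scaleC)
qed

context
  fixes \<eta> :: complex
  assumes \<eta>: "\<eta> = 1 \<or> \<eta> = -1"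
begin

lemma clifford_character_Kb: "clifford_character \<eta> (dkKb * x) = - clifford_character \<eta> (dkK * x)"
  by (simp add: clifford_character_def clifford_rep_mult[OF \<eta>] clifford_rep_Kb[OF \<eta>] app_simps sum_negf)

lemma clifford_character_dkc: "clifford_character \<eta> (dkK * (dkKb * x)) = - clifford_character \<eta> x"
  using clifford_character_Kb[of "dkK * x"] by (simp add: dk_left_commute(1) dk_left_cancel)

lemma clifford_character_uminus: "clifford_character \<eta> (- x) = - clifford_character \<eta> x"
  by (rule clinear_uminus[OF clinear_clifford_character[OF \<eta>]])

text \<open>As \<open>dkKb\<close> acts as minus \<open>dkK\<close>, all evaluations reduce to the
  two numbers of \<open>clifford_character_word\<close>. The sign \<open>(-1) ^ card v\<close> comes
  from moving group elements past the words and puts both parities into one formula.\<close>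

lemma drinfeld_term_clifford:
  assumes n: "even CARD('n)"
  shows "drinfeld_term (clifford_character \<eta>) (v :: 'n::{finite,linorder} set) =
    (2 * (-1) ^ card v * clifford_character \<eta> (xib_word v * xi_word v)) *\<^sub>C
      ((dkK - dkKb) * (xi_word v * xib_word v)) +
    (2 * clifford_character \<eta> (dkK * (xib_word v * xi_word v))) *\<^sub>C
      ((dkK + dkKb) * (xi_word v * xib_word v))"
proof -
  have double: "q *\<^sub>C ((x + x) * y) = (2 * q) *\<^sub>C (x * y)" for q and x y :: "'n dk"
    using scaleC_add_left[of q q "x * y"] by (simp add: distrib_right scaleC_add_right)
  show ?thesis
  proof (cases "even (card v)")
    case True
    then have pow: "dkKb ^ card v = (1 :: 'n dk)"
      by (elim evenE) (simp add: power_mult power2_eq_square dk_relations)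
    have comm: "xi_word v * dkK = dkK * xi_word v" "xib_word v * dkK = dkK * xib_word v"
      "xi_word v * dkKb = dkKb * xi_word v" "xib_word v * dkKb = dkKb * xib_word v"
      using group_word_commute[of v] True by (simp_all add: xi_word_eq xib_word_eq)
    have comm': "xi_word v * (dkK * x) = dkK * (xi_word v * x)"
      "xib_word v * (dkK * x) = dkK * (xib_word v * x)"
      "xi_word v * (dkKb * x) = dkKb * (xi_word v * x)"
      "xib_word v * (dkKb * x) = dkKb * (xib_word v * x)" for x
      by (simp_all add: comm flip: mult.assoc)
    let ?W = "xib_word v * xi_word v" and ?V = "xi_word v * xib_word v"
    have chi: "clifford_character \<eta> (dkK * (xib_word v * (xi_word v * dkK))) = clifford_character \<eta> ?W"
      "clifford_character \<eta> (dkK * (xib_word v * dkKb * xi_word v)) = - clifford_character \<eta> ?W"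
      "clifford_character \<eta> (dkK * (xib_word v * dkKb * (xi_word v * dkK))) =
        - clifford_character \<eta> (dkK * ?W)"
      by (simp_all only: comm comm' mult.assoc dk_left_cancel dk_left_commute(1) clifford_character_Kb
          clifford_character_dkc)
    have legs: "xi_word v * g * xib_word v * h = g * h * ?V"
      if "g = 1 + dkK \<or> g = 1 - dkK" "h = 1 + dkKb \<or> h = 1 - dkKb" for g h
    proof -
      have "xi_word v * g = g * xi_word v" "xi_word v * h = h * xi_word v" "xib_word v * h = h * xib_word v"
        using that by (auto simp: comm distrib_left distrib_right left_diff_distrib right_diff_distrib)
      then show ?thesis by (metis mult.assoc)
    qed
    have sums: "(1 + dkK) * (1 + dkKb) - (1 - dkK) * (1 - dkKb) = (dkK + dkKb) + (dkK + dkKb)"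
      "(1 + dkK) * (1 - dkKb) - (1 - dkK) * (1 + dkKb) = (dkK - dkKb) + (dkK - dkKb)"
      by (simp_all add: algebra_simps)
    have "drinfeld_term (clifford_character \<eta>) v =
        clifford_character \<eta> (dkK * ?W) *\<^sub>C (((1 + dkK) * (1 + dkKb) - (1 - dkK) * (1 - dkKb)) * ?V) +
        clifford_character \<eta> ?W *\<^sub>C (((1 + dkK) * (1 - dkKb) - (1 - dkK) * (1 + dkKb)) * ?V)"
      unfolding drinfeld_term_def Let_def pow mult_1_right chi
      by (simp add: legs left_diff_distrib[of "_ * _" "_ * _"] cvs.scale_right_diff_distrib)
    then show ?thesis
      using True unfolding sums by (simp add: double add.commute)
  next
    case False
    then have pow: "dkKb ^ card v = (dkKb :: 'n dk)"
      by (elim oddE) (simp add: power_mult power2_eq_square dk_relations)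
    \<comment> \<open>A set of odd size is not the whole index set, whose size is even.\<close>
    have r: "clifford_character \<eta> (dkK * (xib_word v * xi_word v)) = 0"
      using False n by (auto simp: clifford_character_word[OF \<eta>])
    have comm: "xi_word v * dkK = - (dkK * xi_word v)" "xib_word v * dkK = - (dkK * xib_word v)"
      "xi_word v * dkKb = - (dkKb * xi_word v)" "xib_word v * dkKb = - (dkKb * xib_word v)"
      using group_word_commute[of v] False by (simp_all add: xi_word_eq xib_word_eq)
    have comm': "xi_word v * (dkK * x) = - (dkK * (xi_word v * x))"
      "xib_word v * (dkK * x) = - (dkK * (xib_word v * x))"
      "xi_word v * (dkKb * x) = - (dkKb * (xi_word v * x))"
      "xib_word v * (dkKb * x) = - (dkKb * (xib_word v * x))" for x
      by (simp_all add: comm flip: mult.assoc)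
    let ?W = "xib_word v * xi_word v" and ?V = "xi_word v * xib_word v"
    have chi: "clifford_character \<eta> (dkK * (xib_word v * dkKb * xi_word v)) = clifford_character \<eta> ?W"
      "clifford_character \<eta> (dkK * (xib_word v * dkKb * (xi_word v * dkK))) = 0"
      "clifford_character \<eta> (dkK * (xib_word v * dkKb * dkKb * xi_word v)) = 0"
      "clifford_character \<eta> (dkK * (xib_word v * dkKb * dkKb * (xi_word v * dkK))) = clifford_character \<eta> ?W"
      by (simp_all only: comm comm' mult.assoc mult_minus_left mult_minus_right minus_minus dk_relations(2)
          mult_1_right dk_left_cancel dk_left_commute(1)
          clifford_character_uminus clifford_character_Kb clifford_character_dkc r minus_zero)
    have legs: "xi_word v * (1 + dkK) * (xib_word v * dkKb) * (1 + dkKb) = (1 - dkK) * (1 + dkKb) * ?V"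
      "xi_word v * (1 - dkK) * (xib_word v * dkKb) * (1 - dkKb) = - ((1 + dkK) * (1 - dkKb) * ?V)"
      by (simp_all add: comm comm' mult.assoc distrib_left distrib_right left_diff_distrib right_diff_distrib
          dk_left_cancel dk_left_commute(1))
    have sums: "(1 - dkK) * (1 + dkKb) - (1 + dkK) * (1 - dkKb) = - ((dkK - dkKb) + (dkK - dkKb))"
      by (simp add: algebra_simps)
    have "drinfeld_term (clifford_character \<eta>) v =
        clifford_character \<eta> ?W *\<^sub>C (((1 - dkK) * (1 + dkKb) - (1 + dkK) * (1 - dkKb)) * ?V)"
      unfolding drinfeld_term_def Let_def pow chi legs
      by (simp add: left_diff_distrib[of "_ * _" "_ * _"] cvs.scale_right_diff_distrib)
    then show ?thesis
      using False unfolding sums r mult_minus_left cvs.scale_minus_right double by simp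
  qed
qed

end

text \<open>In the Fock models a factor becomes 1 on a filled mode and -1 on an empty one, so
  \<open>dkP\<close> is the fermion parity up to the sign (-1)^n.\<close>

definition dkP :: "'n::{finite,linorder} dk"
  where "dkP = word (\<lambda>i. 1 - xi i * xib i) UNIV"

abbreviation dk_top :: "'n::{finite,linorder} dk"
  where "dk_top \<equiv> xi_word UNIV * xib_word UNIV"

lemma xi_word_xib_word:
  "xi_word A * xib_word A = (-1) ^ (card A div 2) *\<^sub>C word (\<lambda>i. xi i * xib i) A"
  unfolding xi_word_eq xib_word_eq
  by (rule word_mult_word) (simp_all add: dk_commute(8))

lemma dkP_eq_sum:
  "dkP = (\<Sum>A\<in>UNIV. ((-1) ^ card A * (-1) ^ (card A div 2)) *\<^sub>C (xi_word A * xib_word A))"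
proof -
  have "(-1 :: complex) ^ card A * (-1) ^ (card A div 2) * (-1) ^ (card A div 2) = (-1) ^ card A"
    for A :: "'a set"
    by (simp add: mult.assoc flip: power_mult_distrib)
  then show ?thesis
    by (simp only: dkP_def word_one_minus[OF finite] Pow_UNIV xi_word_xib_word scaleC_scaleC)
qed

text \<open>The first part of \<open>drinfeld_term_clifford\<close> carries exactly the coefficient
  of its word in \<open>dkP\<close>, so these parts sum to \<open>dkP\<close>; the second part
  survives only for the longest word.\<close>

lemma drinfeld_map_clifford:
  assumes \<eta>: "\<eta> = 1 \<or> \<eta> = -1" and n: "even CARD('n)"
  shows "drinfeld_map (clifford_character \<eta>) =
    (2 ^ CARD('n) / 2) *\<^sub>C ((dkK - dkKb) * dkP) +
    (\<eta> * (-1) ^ (CARD('n) div 2) * 2 ^ CARD('n) / 2) *\<^sub>C ((dkK + dkKb) * (dk_top :: 'n::{finite,linorder} dk))"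
proof -
  let ?t = "\<lambda>v :: 'n set. (-1 :: complex) ^ card v * (-1) ^ (card v div 2)"
  have "drinfeld_map (clifford_character \<eta>) =
      (1/4) *\<^sub>C (\<Sum>v\<in>UNIV. drinfeld_term (clifford_character \<eta>) (v :: 'n set))"
    by (rule drinfeld_map_diagonal[OF clinear_clifford_character[OF \<eta>]])
      (intro clifford_character_cross \<eta>)
  also have "(\<Sum>v\<in>UNIV. drinfeld_term (clifford_character \<eta>) (v :: 'n set)) =
      (\<Sum>v\<in>UNIV. (2 * 2 ^ CARD('n)) *\<^sub>C ((dkK - dkKb) * (?t v *\<^sub>C (xi_word v * xib_word v))) +
        (if v = UNIV then (2 * (\<eta> * (-1) ^ (CARD('n) div 2) * 2 ^ CARD('n))) *\<^sub>C
          ((dkK + dkKb) * dk_top) else 0))"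
    using n by (intro sum.cong refl) (simp add: drinfeld_term_clifford[OF \<eta> n]
        clifford_character_word[OF \<eta>] mult_scaleC_right scaleC_scaleC mult_ac)
  also have "\<dots> = (2 * 2 ^ CARD('n)) *\<^sub>C ((dkK - dkKb) * dkP) +
      (2 * (\<eta> * (-1) ^ (CARD('n) div 2) * 2 ^ CARD('n))) *\<^sub>C ((dkK + dkKb) * (dk_top :: 'n dk))"
    unfolding sum.distrib dkP_eq_sum by (simp add: cvs.scale_sum_right sum_distrib_left)
  finally show ?thesis
    by (simp add: scaleC_add_right scaleC_scaleC)
qed


section \<open>The trace map\<close>

lemma antipode_simps:
  "antipode (x + y) = antipode x + antipode y"
  "antipode (c *\<^sub>C x) = c *\<^sub>C antipode x"
  "antipode (x * y) = antipode y * antipode x"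
  "antipode 1 = 1"
  "antipode (dk_gen g) = antipode_gen g"
  by (transfer; simp add: free_antihom_simps)+

lemma coproduct_simps:
  "coproduct (x + y) = coproduct x + coproduct y"
  "coproduct (c *\<^sub>C x) = c *\<^sub>C coproduct x"
  "coproduct (x * y) = coproduct x * coproduct y"
  "coproduct 1 = 1"
  "coproduct (dk_gen g) = coproduct_gen g"
  by (transfer; simp add: free_hom_simps)+

lemma tensor_linear_eqI:
  assumes "clinear f" "clinear g" "\<And>a b. f (a \<otimes>\<^sub>C b) = g (a \<otimes>\<^sub>C b)"
  shows "f t = g t"
proof (induction t rule: tensor.abs_induct)
  case (1 p)
  show ?case
  proof (induction p rule: monoid_algebra_induct)
    case zero
    have "abs_tensor 0 = (0 :: ('a, 'b) tensor)" by (simp add: zero_tensor_def)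
    then show ?case by (simp add: clinear_zero assms)
  next
    case (single k c)
    obtain a b where k: "k = Pure a b" by (cases k)
    have "abs_tensor (Poly_Mapping.single k c) = c *\<^sub>C (a \<otimes>\<^sub>C b)"
      by (simp add: k tensor_of_def scaleC_tensor.abs_eq scal_single)
    then show ?case by (simp add: clinear_scale assms)
  next
    case (add p q)
    have "abs_tensor (p + q) = abs_tensor p + abs_tensor q" by (simp add: plus_tensor.abs_eq)
    then show ?case using add by (simp add: clinear_add assms)
  qed
qed

text \<open>The trace map without its last factor. It is kept separate because it is a right action
  of the tensor square, which \<open>trace_map\<close> itself is not.\<close>

definition adj_action :: "('n dk, 'n dk) tensor \<Rightarrow> 'n dk \<Rightarrow> 'n dk"
  where "adj_action t x = tensor_lift (\<lambda>a b. antipode b * x * a) t"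

lemma cbilinear_adj_action: "cbilinear (\<lambda>a b. antipode b * x * a * y)"
  unfolding cbilinear_def
  by (auto intro!: clinearI simp: antipode_simps distrib_left distrib_right mult_scaleC_left mult_scaleC_right)

lemma adj_action_tensor_of: "adj_action (a \<otimes>\<^sub>C b) x = antipode b * x * a"
  unfolding adj_action_def using tensor_lift_tensor_of[OF cbilinear_adj_action[of x 1]] by simp

lemma clinear_adj_action: "clinear (\<lambda>t. adj_action t x)"
  unfolding adj_action_def by (rule clinear_tensor_lift)

lemmas adj_action_linear = clinear_add[OF clinear_adj_action] clinear_scale[OF clinear_adj_action]

lemma clinear_adj_action_right: "clinear (adj_action t)"
proof (rule clinearI)
  show "adj_action t (x + y) = adj_action t x + adj_action t y" for x y
    by (rule tensor_linear_eqI)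
      (auto intro!: clinearI simp: adj_action_linear scaleC_add_right adj_action_tensor_of distrib_left distrib_right)
  show "adj_action t (c *\<^sub>C x) = c *\<^sub>C adj_action t x" for c x
    by (rule tensor_linear_eqI)
      (auto intro!: clinearI simp: adj_action_linear scaleC_add_right adj_action_tensor_of scaleC_scaleC
        mult_scaleC_left mult_scaleC_right mult.commute)
qed

lemmas adj_action_linear_right = clinear_add[OF clinear_adj_action_right] clinear_scale[OF clinear_adj_action_right]

text \<open>The antipode reverses products, so the left factor acts first; hence the integral can be
  applied one generator at a time.\<close>

lemma adj_action_mult: "adj_action (s * t) x = adj_action t (adj_action s x)"
proof (rule tensor_linear_eqI[where t = t])
  show "clinear (\<lambda>t. adj_action (s * t) x)" "clinear (\<lambda>t. adj_action t (adj_action s x))"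
    by (auto intro!: clinearI simp: adj_action_linear distrib_left mult_scaleC_right)
  show "adj_action (s * (a \<otimes>\<^sub>C b)) x = adj_action (a \<otimes>\<^sub>C b) (adj_action s x)" for a b
  proof (rule tensor_linear_eqI[where t = s])
    show "clinear (\<lambda>s. adj_action (s * (a \<otimes>\<^sub>C b)) x)" "clinear (\<lambda>s. adj_action (a \<otimes>\<^sub>C b) (adj_action s x))"
      by (auto intro!: clinearI simp: adj_action_linear adj_action_linear_right distrib_right mult_scaleC_left)
    show "adj_action ((a' \<otimes>\<^sub>C b') * (a \<otimes>\<^sub>C b)) x = adj_action (a \<otimes>\<^sub>C b) (adj_action (a' \<otimes>\<^sub>C b') x)" for a' b'
      by (simp add: tensor_mult adj_action_tensor_of antipode_simps mult.assoc)
  qed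
qed

lemma adj_action_prod_list:
  "adj_action (coproduct (prod_list us)) x = fold (\<lambda>u. adj_action (coproduct u)) us x"
proof (induction us arbitrary: x)
  case Nil
  show ?case by (simp add: coproduct_simps antipode_simps adj_action_tensor_of flip: tensor_one)
qed (simp add: coproduct_simps adj_action_mult)

lemma trace_map_eq_adj_action: "trace_map x = adj_action (coproduct dk_integral) x * dkK"
  unfolding trace_map_def unit_inv_balancing
proof (rule tensor_linear_eqI)
  show "clinear (tensor_lift (\<lambda>a b. antipode b * x * a * dkK))" by (rule clinear_tensor_lift)
  show "clinear (\<lambda>t. adj_action t x * dkK)"
    by (auto intro!: clinearI simp: adj_action_linear distrib_right mult_scaleC_left)
qed (simp add: tensor_lift_tensor_of[OF cbilinear_adj_action] adj_action_tensor_of)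

section \<open>Graded commutators with the odd generators\<close>

definition odd_gens :: "'n dk set"
  where "odd_gens = range xi \<union> range xib"

text \<open>The graded commutator with an odd element \<open>u\<close>.\<close>

definition scomm :: "'n dk \<Rightarrow> 'n dk \<Rightarrow> 'n dk"
  where "scomm u y = y * u - u * sg y"

lemma scomm_add: "scomm u (x + y) = scomm u x + scomm u y"
  and scomm_scale: "scomm u (c *\<^sub>C x) = c *\<^sub>C scomm u x"
  by (simp_all add: scomm_def sg_add sg_scale algebra_simps mult_scaleC_left mult_scaleC_right
      cvs.scale_right_diff_distrib)

lemma clinear_scomm: "clinear (scomm u)"
  by (rule clinearI) (simp_all add: scomm_add scomm_scale)

lemma clinear_fold_scomm: "clinear (fold scomm us)"
proof (induction us)
  case Nil
  show ?case by (rule clinearI) simp_all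
next
  case (Cons u us)
  then show ?case
    by (intro clinearI) (simp_all add: clinear_add[OF clinear_scomm] clinear_scale[OF clinear_scomm]
        clinear_add[OF Cons] clinear_scale[OF Cons])
qed

lemma scomm_derivation: "scomm u (x * y) = x * scomm u y + scomm u x * sg y"
  by (simp add: scomm_def sg_mult algebra_simps)

text \<open>The trailing \<open>dkK\<close> turns the two terms of the coproduct into those of a
  graded commutator, and the result again ends in \<open>dkK\<close>, so the step iterates. For
  \<open>xib\<close> the conjugation is by \<open>dkKb\<close>, which is \<open>sg\<close> as
  well.\<close>

lemma adj_action_odd_gen:
  assumes "u \<in> odd_gens"
  shows "adj_action (coproduct u) (y * dkK) = - scomm u y * dkK"
  using assms unfolding odd_gens_def
proof (elim UnE rangeE)
  fix i assume u: "u = xi i"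
  have "adj_action (coproduct u) (y * dkK) = - (dkK * xi i * y * (dkK * dkK)) + y * dkK * xi i"
    by (simp add: u coproduct_simps adj_action_linear adj_action_tensor_of antipode_simps mult.assoc)
  also have "\<dots> = - scomm u y * dkK"
    by (simp add: u scomm_def sg_def dk_relations left_diff_distrib mult.assoc dk_commute(2) dk_left_commute(2))
  finally show ?thesis .
next
  fix i assume u: "u = xib i"
  have "adj_action (coproduct u) (y * dkK) = - (dkKb * (xib i * y * dkK) * dkKb) + y * dkK * xib i"
    by (simp add: u coproduct_simps adj_action_linear adj_action_tensor_of antipode_simps mult.assoc)
  also have "\<dots> = - scomm u y * dkK"
    by (simp only: dkKb_conj)
      (simp add: u scomm_def sg_def dk_relations left_diff_distrib mult.assoc dk_commute(3) dk_left_commute(3))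
  finally show ?thesis .
qed

lemma fold_adj_action_odd_gens:
  "set us \<subseteq> odd_gens \<Longrightarrow>
    fold (\<lambda>u. adj_action (coproduct u)) us (y * dkK) = (-1) ^ length us *\<^sub>C fold scomm us y * dkK"
proof (induction us arbitrary: y)
  case (Cons u us)
  have "fold (\<lambda>u. adj_action (coproduct u)) (u # us) (y * dkK) =
      (-1) ^ length us *\<^sub>C fold scomm us (- scomm u y) * dkK"
    using Cons.IH[of "- scomm u y"] adj_action_odd_gen[of u y] Cons.prems by (simp del: mult_minus_left)
  then show ?case
    by (simp add: clinear_uminus[OF clinear_fold_scomm])
qed simp

definition odd_list :: "'n::{finite,linorder} dk list"
  where "odd_list = map xi (sorted_list_of_set UNIV) @ map xib (sorted_list_of_set UNIV)"

lemma set_odd_list: "set odd_list = odd_gens"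
  by (simp add: odd_list_def odd_gens_def)

text \<open>The group part of the integral acts first and symmetrises \<open>x\<close> under
  \<open>sg\<close>. The signs of the odd generators cancel because their number is even, and the
  trailing \<open>dkK\<close> cancels the inverse of the balancing element.\<close>

lemma trace_map_eq: "trace_map x = fold scomm odd_list (x * dkK + dkK * x)"
proof -
  have int: "dk_integral = (1/2) *\<^sub>C ((1 + dkK + dkKb + dkc) * prod_list (odd_list :: 'a dk list))"
    by (simp add: dk_integral_def odd_list_def xi_word_def xib_word_def mult.assoc)
  have grp: "adj_action (coproduct (1 + dkK + dkKb + dkc)) x = 2 *\<^sub>C (x + sg x)" for x :: "'a dk"
  proof -
    have "adj_action (coproduct (1 + dkK + dkKb + dkc)) x =
        x + dkK * x * dkK + dkKb * x * dkKb + dkKb * (dkK * x * dkK) * dkKb"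
      by (simp add: coproduct_simps adj_action_linear adj_action_mult adj_action_tensor_of antipode_simps
          flip: tensor_one)
    also have "\<dots> = x + sg x + sg x + sg (sg x)"
      by (simp only: dkKb_conj) (simp only: sg_def)
    finally show ?thesis
      using scaleC_add_left[of 1 1 "x + sg x"] by (simp add: sg_sg algebra_simps)
  qed
  have "trace_map x = fold (\<lambda>u. adj_action (coproduct u)) odd_list ((1/2) *\<^sub>C 2 *\<^sub>C (x + sg x)) * dkK"
    unfolding trace_map_eq_adj_action int coproduct_simps(2) coproduct_simps(3) adj_action_linear adj_action_mult
      adj_action_prod_list[symmetric] grp by (simp add: adj_action_linear_right)
  also have "(1/2) *\<^sub>C 2 *\<^sub>C (x + sg x) = (x * dkK + dkK * x) * dkK"
    by (simp add: scaleC_scaleC sg_def distrib_right mult.assoc dk_relations)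
  also have "fold (\<lambda>u. adj_action (coproduct u)) odd_list \<dots> =
      (-1) ^ length (odd_list :: 'a dk list) *\<^sub>C fold scomm odd_list (x * dkK + dkK * x) * dkK"
    by (rule fold_adj_action_odd_gens) (simp add: set_odd_list)
  also have "(-1 :: complex) ^ length (odd_list :: 'a dk list) = 1"
    by (simp add: odd_list_def flip: mult_2)
  finally show ?thesis by (simp add: mult.assoc dk_relations)
qed

lemma odd_gens_sg: "u \<in> odd_gens \<Longrightarrow> sg u = - u"
  by (auto simp: odd_gens_def)

lemma odd_gens_square: "u \<in> odd_gens \<Longrightarrow> u * u = 0"
  by (auto simp: odd_gens_def dk_relations)

lemma odd_gens_anticommutator:
  assumes "u \<in> odd_gens" "v \<in> odd_gens"
  shows "u * v + v * u = 0 \<or> u * v + v * u = 1 - dkc"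
proof -
  have "xib i * xi j + xi j * xib i = 0 \<or> xib i * xi j + xi j * xib i = 1 - dkc" for i j :: 'a
    by (simp add: xi_xib_commutator(2))
  moreover from this have "xi j * xib i + xib i * xi j = 0 \<or> xi j * xib i + xib i * xi j = 1 - dkc" for i j :: 'a
    by (simp add: add.commute)
  ultimately show ?thesis
    using assms by (auto simp: odd_gens_def dk_relations(10,11))
qed

text \<open>The two iterated commutators add up to the ordinary commutator of \<open>y\<close> with
  \<open>u * v + v * u\<close>, which is central.\<close>

lemma scomm_scomm:
  assumes "u \<in> odd_gens" "v \<in> odd_gens"
  shows "scomm u (scomm v y) = - scomm v (scomm u y)"
proof -
  have "scomm u (scomm v y) + scomm v (scomm u y) = y * (u * v + v * u) - (u * v + v * u) * y"
    by (simp add: scomm_def sg_diff sg_mult odd_gens_sg[OF assms(1)] odd_gens_sg[OF assms(2)] sg_sg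
        algebra_simps)
  also have "\<dots> = 0"
    using odd_gens_anticommutator[OF assms] dkc_central[of y] by (auto simp: left_diff_distrib right_diff_distrib)
  finally show ?thesis by (simp add: eq_neg_iff_add_eq_0)
qed

lemma scomm_self: "u \<in> odd_gens \<Longrightarrow> scomm u (scomm u y) = 0"
  by (simp add: scomm_def sg_diff sg_mult odd_gens_sg sg_sg algebra_simps odd_gens_square)
    (simp add: odd_gens_square flip: mult.assoc)

text \<open>Anticommutation moves \<open>scomm u\<close> along the list to its own occurrence, where
  \<open>scomm_self\<close> applies: the integral of a derivative is zero.\<close>

lemma fold_scomm_scomm:
  assumes "u \<in> set us" "set us \<subseteq> odd_gens"
  shows "fold scomm us (scomm u y) = 0"
  using assms
proof (induction us arbitrary: y)
  case (Cons v us)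
  show ?case
  proof (cases "u = v")
    case True
    then show ?thesis using Cons.prems
      by (simp add: scomm_self clinear_zero[OF clinear_fold_scomm])
  next
    case False
    then have "u \<in> odd_gens" "v \<in> odd_gens" using Cons.prems by auto
    then have "scomm v (scomm u y) = - scomm u (scomm v y)" by (rule scomm_scomm[rotated])
    then show ?thesis using Cons False by (simp add: clinear_uminus[OF clinear_fold_scomm])
  qed
qed simp

lemma fold_scomm_central:
  assumes "\<And>x. x * z = z * x"
  shows "fold scomm us (z * y) = z * fold scomm us y"
proof (induction us arbitrary: y)
  case (Cons u us)
  have "scomm u (z * y) = z * scomm u y"
    using assms[of u] by (simp add: scomm_def sg_mult sg_central[OF assms] right_diff_distrib)
      (metis mult.assoc)
  then show ?case using Cons by simp
qed simp


section \<open>The Higman ideal\<close>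

lemma word_closed:
  assumes "finite A" "\<And>j y. y \<in> Z \<Longrightarrow> a j * y \<in> Z" "y \<in> Z"
  shows "word a A * y \<in> Z"
  using assms(1)
  by (induction A rule: finite_linorder_min_induct) (simp_all add: word_insert_min assms(2,3) mult.assoc)

lemma word_annihilate:
  fixes a :: "'i::linorder \<Rightarrow> 'a::ring_1"
  assumes "finite A" "A \<noteq> {}" "\<And>j. a j * y = 0"
  shows "word a A * y = 0"
  using assms(1,2)
proof (induction A rule: finite_linorder_min_induct)
  case (insert b A)
  then show ?case by (cases "A = {}") (simp_all add: word_insert_min assms(3) mult.assoc)
qed simp

lemma sg_xi_word: "sg (xi_word A) = (-1) ^ card A *\<^sub>C xi_word A"
  and sg_xib_word: "sg (xib_word A) = (-1) ^ card A *\<^sub>C xib_word A"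
  by (simp_all add: sg_def xi_word_eq xib_word_eq group_word_commute mult_scaleC_left mult.assoc dk_relations(1))

lemma sg_top: "sg dk_top = dk_top"
  by (simp add: sg_mult sg_xi_word sg_xib_word mult_scaleC_left mult_scaleC_right scaleC_scaleC
      flip: power_mult_distrib)

lemma top_dkK: "dk_top * dkK = dkK * dk_top"
  using arg_cong[OF sg_top, of "\<lambda>x. dkK * x"] by (simp add: sg_def dk_left_cancel mult.assoc)

lemma one_minus_dkc_central: "x * (1 - dkc) = (1 - dkc) * x"
  and one_plus_dkc_central: "x * (1 + dkc) = (1 + dkc) * x"
  using dkc_central[of x] by (simp_all add: algebra_simps)

lemma dkc_one_minus: "dkc * (1 - dkc) = (-1) *\<^sub>C (1 - dkc)"
  and dkc_one_plus: "dkc * (1 + dkc) = 1 *\<^sub>C (1 + dkc)"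
  by (simp_all add: right_diff_distrib distrib_left dkc_square)

lemma one_minus_dkc_square: "(1 - dkc) * (1 - dkc) = 2 *\<^sub>C (1 - dkc)"
  using scaleC_add_left[of 1 1 "1 - dkc :: 'a dk"]
  by (simp add: left_diff_distrib dkc_one_minus)

lemma one_minus_dkc_power: "(1 - dkc) ^ k * (1 - dkc) = 2 ^ k *\<^sub>C (1 - dkc)"
  by (induction k) (simp_all add: mult.assoc mult_scaleC_right one_minus_dkc_square scaleC_scaleC mult.commute)

lemma scomm_gens:
  "scomm (xi i) (xi j) = 0" "scomm (xib i) (xib j) = 0"
  "scomm (xi i) (xib j) = (if i = j then 1 - dkc else 0)"
  "scomm (xib i) (xi j) = (if i = j then 1 - dkc else 0)"
proof -
  show "scomm (xi i) (xib j) = (if i = j then 1 - dkc else 0)"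
    using xi_xib_commutator(1)[of i j] by (simp add: scomm_def)
  show "scomm (xib i) (xi j) = (if i = j then 1 - dkc else 0)"
    using xi_xib_commutator(2)[of i j] by (simp add: scomm_def)
qed (simp_all add: scomm_def dk_relations(10,11))

lemma scomm_odd_gens:
  assumes "u \<in> odd_gens" "v \<in> odd_gens"
  shows "scomm u v = 0 \<or> scomm u v = 1 - dkc"
  using assms by (auto simp: odd_gens_def scomm_gens)

lemma scomm_word_zero:
  assumes "finite A" "\<And>j. j \<in> A \<Longrightarrow> scomm u (a j) = 0"
  shows "scomm u (word a A) = 0"
  using assms
  by (induction A rule: finite_linorder_min_induct)
    (simp_all add: word_insert_min scomm_derivation, simp add: scomm_def sg_one)

lemma prod_list_odd_list: "prod_list odd_list = dk_top"
  by (simp add: odd_list_def xi_word_def xib_word_def)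


subsection \<open>The exterior block\<close>

text \<open>The graded commutator of two odd generators is 0 or \<open>1 - dkc\<close>, and
  \<open>1 - dkc\<close> annihilates \<open>y\<close>; so graded commutation with \<open>g\<close>
  is inherited by products.\<close>

lemma exterior_block_mult:
  assumes "(1 - dkc) * y = 0" "scomm g y = 0" "g \<in> odd_gens" "u \<in> odd_gens"
  shows "(1 - dkc) * (u * y) = 0" "scomm g (u * y) = 0" "(1 - dkc) * (y * u) = 0" "scomm g (y * u) = 0"
proof -
  have "(1 - dkc) * (u * y) = u * ((1 - dkc) * y)"
    using one_minus_dkc_central[of u] by (simp flip: mult.assoc)
  then show "(1 - dkc) * (u * y) = 0" using assms by simp
  show "(1 - dkc) * (y * u) = 0" using assms by (simp flip: mult.assoc)
  have "(1 - dkc) * sg y = 0"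
    using arg_cong[OF assms(1), of sg] by (simp add: sg_mult sg_diff sg_one sg_zero)
  then show "scomm g (u * y) = 0"
    using scomm_odd_gens[OF assms(3,4)] assms(2) by (auto simp: scomm_derivation)
  show "scomm g (y * u) = 0"
    using scomm_odd_gens[OF assms(3,4)] assms(1,2) one_minus_dkc_central[of y] by (auto simp: scomm_derivation)
qed

lemma exterior_block_words:
  fixes v :: "'n::{finite,linorder} dk"
  assumes v: "v \<in> cvs.span (range (\<lambda>(A, B). word xi A * (word xib B * (1 + dkc))))"
    and g: "g \<in> odd_gens"
  shows "(1 - dkc) * v = 0 \<and> scomm g v = 0"
  using v
proof (induction rule: cvs.span_induct)
  case base
  show ?case
    by (rule cvs.subspaceI)
      (simp_all add: scomm_add scomm_scale clinear_zero[OF clinear_scomm] distrib_left mult_scaleC_right)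
next
  case (step x)
  let ?Z = "{y. (1 - dkc) * y = 0 \<and> scomm g y = 0}"
  have "(1 - dkc) * (1 + dkc) = 0" "scomm g (1 + dkc) = 0"
    using one_plus_dkc_central[of g]
    by (simp_all add: scomm_def sg_central[OF one_plus_dkc_central] left_diff_distrib dkc_one_plus)
  then have "1 + dkc \<in> ?Z" by simp
  moreover have "xi j * y \<in> ?Z" "xib j * y \<in> ?Z" if "y \<in> ?Z" for j y
    using that g exterior_block_mult[of y g] by (auto simp: odd_gens_def)
  ultimately have "word xi A * (word xib B * (1 + dkc)) \<in> ?Z" for A B :: "'n set"
    by (intro word_closed) auto
  then show ?case using step by auto
qed

lemma fold_scomm_exterior_zero:
  fixes v :: "'n::{finite,linorder} dk"
  assumes "v \<in> cvs.span (range (\<lambda>(A, B). word xi A * (word xib B * (1 + dkc))))"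
    and "us \<noteq> []" "set us \<subseteq> odd_gens"
  shows "fold scomm us v = 0"
proof (cases us)
  case (Cons u us')
  then show ?thesis
    using exterior_block_words[OF assms(1), of u] assms(3) by (simp add: clinear_zero[OF clinear_fold_scomm])
qed (use assms(2) in simp)

text \<open>The sign of passing \<open>dkK\<close> makes the two terms of
  \<open>scomm u (dkK * v)\<close> add instead of cancel: both equal
  \<open>dkK * (v * u)\<close>.\<close>

lemma fold_scomm_exterior:
  assumes "(1 - dkc) * v = 0" "\<And>g. g \<in> odd_gens \<Longrightarrow> scomm g v = 0" "set us \<subseteq> odd_gens"
  shows "fold scomm us (dkK * v) = 2 ^ length us *\<^sub>C (dkK * v * prod_list us)"
  using assms
proof (induction us arbitrary: v)
  case (Cons u us)
  have u: "u \<in> odd_gens" using Cons.prems by simp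
  have "v * u = u * sg v" using Cons.prems(2)[OF u] by (simp add: scomm_def)
  moreover have "u * dkK = - (dkK * u)"
    using u by (auto simp: odd_gens_def dk_commute(2,3))
  then have "u * (dkK * sg v) = - (dkK * (u * sg v))" by (simp flip: mult.assoc)
  ultimately have "scomm u (dkK * v) = dkK * (v * u) + dkK * (v * u)"
    by (simp add: scomm_def sg_mult mult.assoc)
  then have "fold scomm (u # us) (dkK * v) = fold scomm us (dkK * (v * u)) + fold scomm us (dkK * (v * u))"
    by (simp add: clinear_add[OF clinear_fold_scomm])
  also have "\<dots> = 2 *\<^sub>C fold scomm us (dkK * (v * u))"
    using scaleC_add_left[of 1 1 "fold scomm us (dkK * (v * u))"] by simp
  also have "fold scomm us (dkK * (v * u)) = 2 ^ length us *\<^sub>C (dkK * (v * u) * prod_list us)"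
    using Cons.prems exterior_block_mult[OF Cons.prems(1) Cons.prems(2) _ u]
    by (intro Cons.IH) auto
  finally show ?case by (simp add: scaleC_scaleC mult.assoc)
qed simp

text \<open>In this block the longest word is a top form. For \<open>xib\<close> the form is even
  and commutes with \<open>xib i\<close>, which can thus be moved to its right end, where it meets
  the \<open>xib\<close> word.\<close>

lemma one_plus_top_annihilate:
  "xi i * ((1 + dkc) * dk_top) = 0" "xib i * ((1 + dkc) * dk_top) = 0"
proof -
  have "xi i * ((1 + dkc) * dk_top) = (1 + dkc) * (xi i * xi_word UNIV * xib_word UNIV)"
    using one_plus_dkc_central[of "xi i"] by (simp flip: mult.assoc)
  then show "xi i * ((1 + dkc) * dk_top) = 0" by (simp add: xi_top)
  let ?v = "dk_top * (1 + dkc) :: 'a dk"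
  have v: "?v = word xi UNIV * (word xib UNIV * (1 + dkc))"
    by (simp add: xi_word_eq xib_word_eq mult.assoc)
  have "?v \<in> cvs.span (range (\<lambda>(A, B). word xi A * (word xib B * (1 + dkc))))"
    unfolding v by (rule cvs.span_base) (auto intro: range_eqI[of _ _ "(UNIV, UNIV)"])
  then have "scomm (xib i) ?v = 0"
    by (rule exterior_block_words[THEN conjunct2]) (simp add: odd_gens_def)
  moreover have "sg ?v = ?v"
    unfolding sg_mult[of dk_top "1 + dkc"] sg_top sg_central[OF one_plus_dkc_central] ..
  ultimately have "xib i * ?v = ?v * xib i"
    by (simp add: scomm_def)
  also have "\<dots> = xi_word UNIV * (xib_word UNIV * xib i) * (1 + dkc)"
    using one_plus_dkc_central[of "xib i"] by (simp add: mult.assoc)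
  also have "xib_word UNIV * xib i = 0"
  proof -
    have "xib i * xib_word UNIV = (-1) ^ CARD('a) *\<^sub>C (xib_word UNIV * xib i)"
      unfolding xib_word_eq by (rule word_anticommute[OF finite dk_commute(7)])
    then show ?thesis by (simp add: xib_top)
  qed
  finally show "xib i * ((1 + dkc) * dk_top) = 0"
    by (simp add: one_plus_dkc_central)
qed

definition hig1 :: "'n::{finite,linorder} dk"
  where "hig1 = (dkK + dkKb) * dk_top"

definition hig2 :: "'n::{finite,linorder} dk"
  where "hig2 = 1 - dkc"

definition hig3 :: "'n::{finite,linorder} dk"
  where "hig3 = (dkK - dkKb) * dkP"

lemma hig1_eq: "hig1 = dkK * (1 + dkc) * dk_top"
  by (simp add: hig1_def distrib_left dk_left_cancel)

text \<open>The iterated commutator becomes multiplication by the top form, which kills every word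
  but the empty one; that one gives \<open>hig1\<close>.\<close>

lemma fold_scomm_exterior_dkK:
  assumes v: "v \<in> cvs.span (range (\<lambda>(A, B). word xi A * (word xib B * (1 + dkc))))"
  shows "\<exists>r. fold scomm odd_list (dkK * v) = r *\<^sub>C (hig1 :: 'n::{finite,linorder} dk)"
proof -
  have "\<exists>r. dkK * v * dk_top = r *\<^sub>C (hig1 :: 'n dk)"
    using v
  proof (induction rule: cvs.span_induct)
    case base
    show ?case
    proof (rule cvs.subspaceI; simp only: mem_Collect_eq)
      show "\<exists>r. dkK * 0 * dk_top = r *\<^sub>C (hig1 :: 'n dk)" by (rule exI[of _ 0]) simp
      show "\<exists>r. dkK * (x + y) * dk_top = r *\<^sub>C (hig1 :: 'n dk)"
        if "\<exists>r. dkK * x * dk_top = r *\<^sub>C (hig1 :: 'n dk)" "\<exists>r. dkK * y * dk_top = r *\<^sub>C (hig1 :: 'n dk)" for x y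
        using that by (metis distrib_left distrib_right scaleC_add_left)
      show "\<exists>r. dkK * (c *\<^sub>C x) * dk_top = r *\<^sub>C (hig1 :: 'n dk)"
        if "\<exists>r. dkK * x * dk_top = r *\<^sub>C (hig1 :: 'n dk)" for c x
        using that by (metis mult_scaleC_left mult_scaleC_right scaleC_scaleC)
    qed
  next
    case (step x)
    then obtain A B where x: "x = word xi A * (word xib B * (1 + dkc))" by auto
    have e: "dkK * x * dk_top = dkK * (word xi A * (word xib B * ((1 + dkc) * dk_top)))"
      by (simp add: x mult.assoc)
    consider "B \<noteq> {}" | "B = {}" "A \<noteq> {}" | "A = {}" "B = {}" by blast
    then show ?case
    proof cases
      case 1
      then have "dkK * x * dk_top = 0 *\<^sub>C hig1"
        unfolding e by (subst word_annihilate[of B]) (simp_all add: one_plus_top_annihilate)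
      then show ?thesis by blast
    next
      case 2
      then have "dkK * x * dk_top = 0 *\<^sub>C hig1"
        unfolding e using word_annihilate[of A xi "(1 + dkc) * dk_top"] by (simp add: one_plus_top_annihilate)
      then show ?thesis by blast
    next
      case 3
      then have "dkK * x * dk_top = 1 *\<^sub>C hig1"
        unfolding e by (simp add: hig1_eq mult.assoc)
      then show ?thesis by blast
    qed
  qed
  then obtain r where r: "dkK * v * dk_top = r *\<^sub>C hig1" ..
  have "fold scomm odd_list (dkK * v) = 2 ^ length (odd_list :: 'n dk list) *\<^sub>C (dkK * v * dk_top)"
    using exterior_block_words[OF v] fold_scomm_exterior[of v odd_list]
    by (auto simp: set_odd_list prod_list_odd_list odd_gens_def)
  then show ?thesis by (auto simp: r scaleC_scaleC)
qed


subsection \<open>The Clifford block\<close>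

text \<open>Contraction of the \<open>b\<close> word by the \<open>a\<close> letters, for which
  \<open>x\<close> is a constant. Each step yields the central \<open>1 - dkc\<close>, and the sign
  counts the letters still standing to the right.\<close>

lemma fold_scomm_word:
  assumes "distinct l" "\<And>i. i \<in> set l \<Longrightarrow> a i \<in> odd_gens" "\<And>i. i \<in> set l \<Longrightarrow> b i \<in> odd_gens"
    and ab: "\<And>i j. scomm (a i) (b j) = (if i = j then 1 - dkc else 0)"
    and x: "\<And>i. i \<in> set l \<Longrightarrow> scomm (a i) x = 0"
  shows "fold scomm (map a l) (x * prod_list (map b l)) =
    (-1) ^ (\<Sum>k<length l. k) *\<^sub>C ((1 - dkc) ^ length l * x)"
  using assms(1-3,5)
proof (induction l)
  case (Cons i l)
  have "sg (prod_list (map b l')) = (-1) ^ length l' *\<^sub>C prod_list (map b l')" if "set l' \<subseteq> set l" for l'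
    using that Cons.prems(3)
    by (induction l') (simp_all add: sg_one sg_mult odd_gens_sg mult_scaleC_right)
  then have sgl: "sg (prod_list (map b l)) = (-1) ^ length l *\<^sub>C prod_list (map b l)" by blast
  have "scomm (a i) (prod_list (map b l')) = 0" if "i \<notin> set l'" for l'
    using that by (induction l') (auto simp: scomm_derivation ab, simp add: scomm_def sg_one)
  then have zero: "scomm (a i) (prod_list (map b l)) = 0" using Cons.prems(1) by simp
  have "scomm (a i) (x * prod_list (map b (i # l))) = (-1) ^ length l *\<^sub>C (x * ((1 - dkc) * prod_list (map b l)))"
    using Cons.prems(4)[of i] zero sgl by (simp add: scomm_derivation ab mult_scaleC_right)
  also have "\<dots> = (-1) ^ length l *\<^sub>C ((1 - dkc) * (x * prod_list (map b l)))"
    using one_minus_dkc_central[of x] by (simp flip: mult.assoc)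
  finally have "fold scomm (map a (i # l)) (x * prod_list (map b (i # l))) =
      (-1) ^ length l *\<^sub>C ((1 - dkc) * fold scomm (map a l) (x * prod_list (map b l)))"
    by (simp add: clinear_scale[OF clinear_fold_scomm] fold_scomm_central[OF one_minus_dkc_central])
  also have "fold scomm (map a l) (x * prod_list (map b l)) =
      (-1) ^ (\<Sum>k<length l. k) *\<^sub>C ((1 - dkc) ^ length l * x)"
    using Cons.prems by (intro Cons.IH) auto
  finally show ?case
    by (simp add: mult_scaleC_right scaleC_scaleC power_add mult.assoc mult.commute)
qed simp

text \<open>The \<open>xi\<close> commutators contract the \<open>xib\<close> word, then the
  \<open>xib\<close> commutators contract the \<open>xi\<close> word; the two equal signs
  cancel.\<close>

lemma fold_scomm_top: "fold scomm odd_list dk_top = (1 - dkc :: 'n::{finite,linorder} dk) ^ (2 * CARD('n))"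
proof -
  let ?l = "sorted_list_of_set (UNIV :: 'n set)" and ?q = "1 - dkc :: 'n dk"
  let ?s = "(-1) ^ (\<Sum>k<length ?l. k) :: complex"
  have len: "length ?l = CARD('n)" by simp
  have q: "x * ?q ^ k = ?q ^ k * x" for x k
    by (induction k) (simp_all add: mult.assoc, metis mult.assoc one_minus_dkc_central)
  have "fold scomm odd_list dk_top =
      fold scomm (map xib ?l) (fold scomm (map xi ?l) (xi_word UNIV * prod_list (map xib ?l)))"
    by (simp add: odd_list_def xib_word_def)
  also have "fold scomm (map xi ?l) (xi_word UNIV * prod_list (map xib ?l)) =
      ?s *\<^sub>C (?q ^ length ?l * xi_word UNIV)"
    by (rule fold_scomm_word)
      (auto simp: odd_gens_def scomm_gens xi_word_eq intro!: scomm_word_zero)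
  also have "fold scomm (map xib ?l) (?s *\<^sub>C (?q ^ length ?l * xi_word UNIV)) =
      ?s *\<^sub>C (?q ^ length ?l * fold scomm (map xib ?l) (1 * prod_list (map xi ?l)))"
    by (simp add: clinear_scale[OF clinear_fold_scomm] fold_scomm_central[OF q] xi_word_def)
  also have "fold scomm (map xib ?l) (1 * prod_list (map xi ?l)) = ?s *\<^sub>C (?q ^ length ?l * 1)"
    by (rule fold_scomm_word) (auto simp: odd_gens_def scomm_gens, simp add: scomm_def sg_one)
  finally show ?thesis
    by (simp add: mult_scaleC_right scaleC_scaleC len mult_2 power_add flip: power_mult_distrib)
qed

lemma fold_scomm_top_block:
  "fold scomm odd_list ((1 - dkc) * dk_top) = 2 ^ (2 * CARD('n)) *\<^sub>C (hig2 :: 'n::{finite,linorder} dk)"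
proof -
  have "fold scomm odd_list ((1 - dkc) * dk_top) = (1 - dkc) ^ (2 * CARD('n)) * (1 - dkc :: 'n dk)"
    by (simp add: fold_scomm_central[OF one_minus_dkc_central] fold_scomm_top power_commutes)
  then show ?thesis by (simp only: one_minus_dkc_power hig2_def)
qed

text \<open>The argument is itself a graded commutator, namely
  \<open>scomm u (m * v)\<close>.\<close>

lemma fold_scomm_times_one_minus:
  assumes "scomm u m = 0" "scomm u v = 1 - dkc" "u \<in> odd_gens"
  shows "fold scomm odd_list (m * (1 - dkc)) = 0"
proof -
  have "scomm u (m * v) = m * (1 - dkc)" using assms by (simp add: scomm_derivation)
  then show ?thesis using fold_scomm_scomm[of u odd_list "m * v"] assms(3) by (simp add: set_odd_list)
qed

text \<open>A word other than the longest misses some letter. The partner \<open>u\<close> of that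
  letter annihilates the word under \<open>scomm\<close>, so multiplying the word by the missing
  letter exhibits its product with \<open>1 - dkc\<close> as a graded commutator.\<close>

lemma fold_scomm_clifford:
  assumes "v \<in> cvs.span (range (\<lambda>(A, B). word xi A * (word xib B * (1 - dkc))))"
  shows "\<exists>r. fold scomm odd_list v = r *\<^sub>C (hig2 :: 'n::{finite,linorder} dk)"
  using assms
proof (induction rule: cvs.span_induct)
  case base
  show ?case
  proof (rule cvs.subspaceI; simp only: mem_Collect_eq clinear_add[OF clinear_fold_scomm]
      clinear_scale[OF clinear_fold_scomm] clinear_zero[OF clinear_fold_scomm])
    show "\<exists>r. 0 = r *\<^sub>C (hig2 :: 'n dk)" by (rule exI[of _ 0]) simp
  qed (metis scaleC_add_left, metis scaleC_scaleC)
next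
  case (step x)
  then obtain A B where x: "x = (word xi A * word xib B) * (1 - dkc)" by (auto simp: mult.assoc)
  consider i where "i \<notin> B" | i where "i \<notin> A" | "A = UNIV" "B = UNIV" by blast
  then show ?case
  proof cases
    case 1
    then have "scomm (xi i) (word xib B) = 0" "scomm (xi i) (word xi A) = 0"
      by (auto intro!: scomm_word_zero simp: scomm_gens)
    then have "fold scomm odd_list x = 0"
      unfolding x by (intro fold_scomm_times_one_minus[of "xi i" _ "xib i"])
        (simp_all add: scomm_derivation scomm_gens odd_gens_def)
    then show ?thesis by (intro exI[of _ 0]) simp
  next
    case 2
    then have "scomm (xib i) (word xib B) = 0" "scomm (xib i) (word xi A) = 0"
      by (auto intro!: scomm_word_zero simp: scomm_gens)
    then have "fold scomm odd_list x = 0"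
      unfolding x by (intro fold_scomm_times_one_minus[of "xib i" _ "xi i"])
        (simp_all add: scomm_derivation scomm_gens odd_gens_def)
    then show ?thesis by (intro exI[of _ 0]) simp
  next
    case 3
    then have "x = (1 - dkc) * dk_top"
      using one_minus_dkc_central[of dk_top] by (simp add: x xi_word_eq xib_word_eq)
    then show ?thesis using fold_scomm_top_block by blast
  qed
qed

section \<open>The product \<open>dkP\<close> and the central element \<open>hig3\<close>\<close>

lemma word_pass:
  fixes h :: "'i::linorder \<Rightarrow> 'a::ring_1"
  assumes "finite A" "\<And>i. i \<noteq> j \<Longrightarrow> h i * x = x * h i" "h j * x = c * (x * h j)"
    and c: "\<And>y. y * c = c * y"
  shows "word h A * x = (if j \<in> A then c * (x * word h A) else x * word h A)"
  using assms(1)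
proof (induction A rule: finite_linorder_min_induct)
  case (insert b A)
  then have b: "b \<notin> A" by auto
  have 1: "word h (insert b A) * x = h b * (word h A * x)"
    using insert by (simp add: word_insert_min mult.assoc)
  have hc: "h b * (c * y) = c * (h b * y)" for y
    using c[of "h b"] by (simp flip: mult.assoc)
  have hx: "h b * (x * y) = (if b = j then c * (x * (h b * y)) else x * (h b * y))" for y
    using assms(2)[of b] assms(3) by (simp flip: mult.assoc)
  \<comment> \<open>The factor \<open>c\<close> is picked up once, at the single occurrence of
    \<open>j\<close>.\<close>
  show ?case
    unfolding 1 insert(3) using b insert(1,2)
    by (auto simp: word_insert_min hc hx)
qed simp

text \<open>At equal index nilpotency decides: \<open>(1 - xi j * xib j) * xi j\<close> is
  \<open>dkc * xi j\<close>, while \<open>xi j * (1 - xi j * xib j)\<close> is \<open>xi j\<close>.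
  For \<open>xib j\<close> the factor \<open>dkc\<close> arises on the other side and
  \<open>dkc * dkc = 1\<close> moves it across.\<close>

lemma one_minus_xi_xib_pass:
  "i \<noteq> j \<Longrightarrow> (1 - xi i * xib i) * xi j = xi j * (1 - xi i * xib i)"
  "i \<noteq> j \<Longrightarrow> (1 - xi i * xib i) * xib j = xib j * (1 - xi i * xib i)"
  "(1 - xi j * xib j) * xi j = dkc * (xi j * (1 - xi j * xib j))"
  "(1 - xi j * xib j) * xib j = dkc * (xib j * (1 - xi j * xib j))"
proof -
  have "xi i * xib i * xi j = xi j * (xi i * xib i)" if "i \<noteq> j"
  proof -
    have "xi i * xib i * xi j = - (xi i * xi j * xib i)"
      using xi_xib_commutator(2)[of i j] that by (simp add: mult.assoc)
    also have "\<dots> = xi j * xi i * xib i" using dk_commute(6)[of i j] by simp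
    finally show ?thesis by (simp add: mult.assoc)
  qed
  then show "i \<noteq> j \<Longrightarrow> (1 - xi i * xib i) * xi j = xi j * (1 - xi i * xib i)"
    by (simp add: left_diff_distrib right_diff_distrib)
  have "xi i * xib i * xib j = xib j * (xi i * xib i)" if "i \<noteq> j"
  proof -
    have "xi i * xib i * xib j = - (xi i * xib j * xib i)"
      using dk_commute(7)[of i j] by (simp add: mult.assoc)
    also have "\<dots> = xib j * xi i * xib i" using xi_xib_commutator(1)[of i j] that by simp
    finally show ?thesis by (simp add: mult.assoc)
  qed
  then show "i \<noteq> j \<Longrightarrow> (1 - xi i * xib i) * xib j = xib j * (1 - xi i * xib i)"
    by (simp add: left_diff_distrib right_diff_distrib)
  have "xi j * xib j * xi j = xi j * (xib j * xi j)" by (simp add: mult.assoc)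
  also have "\<dots> = xi j * (1 - dkc) - xi j * xi j * xib j"
    by (simp add: dk_commute(9) right_diff_distrib mult.assoc)
  finally have 1: "xi j * xib j * xi j = xi j - dkc * xi j"
    using dkc_central[of "xi j"] by (simp add: dk_relations(4) right_diff_distrib)
  moreover have "xi j * (xi j * xib j) = 0" by (simp add: dk_relations(4) flip: mult.assoc)
  ultimately show "(1 - xi j * xib j) * xi j = dkc * (xi j * (1 - xi j * xib j))"
    by (simp add: left_diff_distrib right_diff_distrib)
  have "xib j * (xi j * xib j) = xib j * xi j * xib j" by (simp add: mult.assoc)
  also have "\<dots> = (1 - dkc) * xib j - xi j * (xib j * xib j)"
    by (simp only: dk_commute(9) left_diff_distrib mult.assoc)
  finally have "xib j * (xi j * xib j) = xib j - dkc * xib j"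
    by (simp add: dk_relations(5) left_diff_distrib)
  moreover have "dkc * (dkc * xib j) = xib j"
    using arg_cong[OF dkc_square, of "\<lambda>y. y * xib j"] by (simp only: mult.assoc mult_1_left)
  ultimately show "(1 - xi j * xib j) * xib j = dkc * (xib j * (1 - xi j * xib j))"
    by (simp add: left_diff_distrib right_diff_distrib mult.assoc dk_relations(5))
qed

lemma dkP_commute:
  fixes j :: "'n::{finite,linorder}"
  shows "dkP * xi j = dkc * (xi j * dkP)" "dkP * xib j = dkc * (xib j * dkP)"
    "dkP * dkK = dkK * (dkP :: 'n dk)" "dkP * dkKb = dkKb * (dkP :: 'n dk)"
proof -
  show "dkP * xi j = dkc * (xi j * dkP)" "dkP * xib j = dkc * (xib j * dkP)"
    unfolding dkP_def
    using word_pass[where A = "UNIV :: 'n set" and j = j, OF finite one_minus_xi_xib_pass(1,3) dkc_central]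
      word_pass[where A = "UNIV :: 'n set" and j = j, OF finite one_minus_xi_xib_pass(2,4) dkc_central]
    by simp_all
  have "x * dkP = dkP * x" if x: "x = dkK \<or> x = dkKb" for x :: "'n dk"
  proof -
    have "x * (xi i * xib i) = xi i * xib i * x" for i
      using x by (auto simp: mult.assoc dk_commute(2-5) dk_left_commute)
    then have "(1 - xi i * xib i) * x = 1 * (x * (1 - xi i * xib i))" for i
      by (simp add: left_diff_distrib right_diff_distrib)
    then show ?thesis
      unfolding dkP_def
      using word_pass[where A = "UNIV :: 'n set" and h = "\<lambda>i. 1 - xi i * xib i" and x = x and c = 1] by simp
  qed
  then show "dkP * dkK = dkK * (dkP :: 'n dk)" "dkP * dkKb = dkKb * (dkP :: 'n dk)" by auto
qed

text \<open>For \<open>h = xi i * xib i\<close> one has \<open>h * h = (1 - dkc) * h\<close>, which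
  is twice \<open>h\<close> on this block, so \<open>1 - h\<close> squares to 1 there. The factors
  commute, so their product squares to 1 as well.\<close>

lemma dkP_square: "dkP * (dkP * (1 - dkc)) = 1 - dkc"
proof -
  let ?h = "\<lambda>i :: 'a. 1 - xi i * xib i"
  have hh: "?h i * (?h i * (1 - dkc)) = 1 - dkc" for i
  proof -
    have "?h i * (?h i * (1 - dkc)) = (1 - dkc) - 2 *\<^sub>C (xi i * xib i * (1 - dkc))
        + xi i * (xib i * xi i) * (xib i * (1 - dkc))"
      using scaleC_add_left[of 1 1 "xi i * xib i * (1 - dkc)"] by (simp add: algebra_simps)
    also have "xi i * (xib i * xi i) * (xib i * (1 - dkc)) = xi i * ((1 - dkc) * (xib i * (1 - dkc)))"
      by (simp add: dk_commute(9) left_diff_distrib right_diff_distrib mult.assoc)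
        (simp add: dk_relations(4) flip: mult.assoc)
    also have "(1 - dkc) * (xib i * (1 - dkc)) = xib i * ((1 - dkc) * (1 - dkc))"
      by (simp only: mult.assoc[symmetric]) (simp only: one_minus_dkc_central[of "xib i"])
    also have "xi i * \<dots> = 2 *\<^sub>C (xi i * xib i * (1 - dkc))"
      by (simp add: one_minus_dkc_square mult_scaleC_right mult.assoc)
    finally show ?thesis by simp
  qed
  have comm: "?h i * ?h j = ?h j * ?h i" for i j
  proof (cases "i = j")
    case False
    then have "?h i * (xi j * xib j) = xi j * xib j * ?h i"
      using one_minus_xi_xib_pass(1,2)[of i j] by (metis mult.assoc)
    then show ?thesis
      by (simp only: right_diff_distrib[of "?h i" 1 "xi j * xib j"]
          left_diff_distrib[of 1 "xi j * xib j" "?h i"] mult_1_left mult_1_right)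
  qed simp
  have "word ?h A * (word ?h A * (1 - dkc)) = 1 - dkc" if "finite A" for A
    using that
  proof (induction A rule: finite_linorder_min_induct)
    case (insert b A)
    \<comment> \<open>No index is exceptional here, so \<open>word_pass\<close> is used with the
      central factor 1 and an arbitrary index.\<close>
    have pass: "word ?h A * ?h b = ?h b * word ?h A"
      using word_pass[OF insert(1), of undefined ?h "?h b" 1] comm by simp
    have "word ?h (insert b A) * (word ?h (insert b A) * (1 - dkc)) =
        ?h b * (word ?h A * ?h b) * (word ?h A * (1 - dkc))"
      using insert by (simp only: word_insert_min mult.assoc)
    also have "\<dots> = ?h b * (?h b * (word ?h A * (word ?h A * (1 - dkc))))"
      by (simp only: pass mult.assoc)
    finally have "word ?h (insert b A) * (word ?h (insert b A) * (1 - dkc)) = \<dots>" .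
    then show ?case by (simp only: insert(3) hh)
  qed simp
  then show ?thesis by (simp add: dkP_def)
qed

text \<open>An odd generator gets a sign from passing \<open>dkK - dkKb\<close> and a factor
  \<open>dkc\<close> from passing \<open>dkP\<close>; next to \<open>dkK - dkKb\<close> the latter
  is -1, and the two cancel.\<close>

lemma hig3_central: "x * hig3 = hig3 * x"
proof (rule dk_central)
  have e: "(dkK - dkKb) * dkc = - (dkK - dkKb)"
    by (simp add: left_diff_distrib dk_left_cancel dk_left_commute(1) dk_relations)
  have odd: "u * hig3 = hig3 * u"
    if "dkP * u = dkc * (u * dkP)" "u * (dkK - dkKb) = - ((dkK - dkKb) * u)" for u :: "'a dk"
  proof -
    have "hig3 * u = ((dkK - dkKb) * dkc) * u * dkP"
      using that(1) by (simp add: hig3_def mult.assoc)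
    also have "\<dots> = u * (dkK - dkKb) * dkP"
      by (simp only: e that(2) mult_minus_left)
    finally show ?thesis by (simp add: hig3_def mult.assoc)
  qed
  fix g :: "'a gen"
  show "dk_gen g * hig3 = hig3 * dk_gen g"
  proof (cases g)
    case (gXi i)
    then show ?thesis
      using odd[OF dkP_commute(1)] by (simp add: right_diff_distrib left_diff_distrib dk_commute(2,4))
  next
    case (gXib i)
    then show ?thesis
      using odd[OF dkP_commute(2)] by (simp add: right_diff_distrib left_diff_distrib dk_commute(3,5))
  next
    case gK
    then show ?thesis
      by (simp add: hig3_def mult.assoc dkP_commute) (simp add: left_diff_distrib right_diff_distrib dk_commute(1) flip: mult.assoc)
  next
    case gKb
    then show ?thesis
      by (simp add: hig3_def mult.assoc dkP_commute) (simp add: left_diff_distrib right_diff_distrib dk_commute(1) flip: mult.assoc)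
  qed
qed

lemma dkK_minus_dkKb: "dkc * v = (-1) *\<^sub>C v \<Longrightarrow> (dkK - dkKb) * v = 2 *\<^sub>C (dkK * v)"
proof -
  assume "dkc * v = (-1) *\<^sub>C v"
  from arg_cong[OF this, of "\<lambda>y. dkK * y"] have "dkKb * v = - (dkK * v)"
    by (simp add: mult.assoc dk_left_cancel)
  then show ?thesis
    using scaleC_add_left[of 1 1 "dkK * v"] by (simp add: left_diff_distrib)
qed

lemma hig2_scale: "dkc * v = (-1) *\<^sub>C v \<Longrightarrow> (1 - dkc) * v = 2 *\<^sub>C v"
  using scaleC_add_left[of 1 1 v] by (simp add: left_diff_distrib)

lemma scaleC_two: "2 *\<^sub>C x = x + x"
  using scaleC_add_left[of 1 1 x] by simp

lemma hig_products:
  "hig3 * hig2 = 2 *\<^sub>C hig3" "hig3 * hig3 = 2 *\<^sub>C hig2"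
proof -
  have e: "(1 - dkc) * (dkK - dkKb) = (dkK - dkKb) + (dkK - dkKb)"
    by (simp add: algebra_simps dk_left_cancel dk_left_commute(1) dk_commute(1) dk_relations(1,2))
  have "hig3 * hig2 = (1 - dkc) * (dkK - dkKb) * dkP"
    unfolding hig2_def one_minus_dkc_central by (simp add: hig3_def mult.assoc)
  also have "\<dots> = hig3 + hig3" by (simp only: e hig3_def distrib_right)
  finally show "hig3 * hig2 = 2 *\<^sub>C hig3" by (simp only: scaleC_two)
  have "dkP * (dkK - dkKb) = (dkK - dkKb) * dkP"
    by (simp add: left_diff_distrib right_diff_distrib dkP_commute)
  then have "hig3 * hig3 = ((dkK - dkKb) * (dkK - dkKb)) * (dkP * dkP)"
    unfolding hig3_def by (metis mult.assoc)
  also have "(dkK - dkKb) * (dkK - dkKb) = (1 - dkc) + (1 - dkc)"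
    by (simp add: algebra_simps dk_commute(1) dk_relations(1,2))
  also have "((1 - dkc) + (1 - dkc)) * (dkP * dkP) = dkP * (dkP * (1 - dkc)) + dkP * (dkP * (1 - dkc))"
    unfolding distrib_right one_minus_dkc_central[of "dkP * dkP", symmetric] by (simp only: mult.assoc)
  finally show "hig3 * hig3 = 2 *\<^sub>C hig2"
    by (simp only: dkP_square hig2_def scaleC_two)
qed

text \<open>In this block \<open>2 *\<^sub>C (dkK * v)\<close> equals
  \<open>hig3 * (dkP * v)\<close>. The central \<open>hig3\<close> leaves the iterated commutator,
  which reduces the claim to \<open>fold_scomm_clifford\<close> for \<open>dkP * v\<close>.\<close>

lemma fold_scomm_clifford_dkK:
  assumes v: "v \<in> cvs.span (range (\<lambda>(A, B). word xi A * (word xib B * (1 - dkc))))" (is "_ \<in> ?V")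
  shows "\<exists>r. fold scomm odd_list (dkK * v) = r *\<^sub>C (hig3 :: 'n::{finite,linorder} dk)"
proof -
  note closed = word_span_closed[OF dkc_one_minus]
  have Pv: "dkP * v \<in> ?V"
    unfolding dkP_def
  proof (rule word_closed[OF finite _ v])
    show "(1 - xi j * xib j) * y \<in> ?V" if "y \<in> ?V" for j y
      using closed[OF that] closed(1)[OF closed(2)[OF that]] that
      by (simp add: left_diff_distrib mult.assoc cvs.span_diff)
  qed
  have PPv: "dkP * (dkP * v) = v"
  proof -
    \<comment> \<open>On \<open>v\<close> the element \<open>1 - dkc\<close> is 2, which supplies
      the factor needed for \<open>dkP_square\<close>.\<close>
    have "(2 :: complex) *\<^sub>C (dkP * (dkP * v)) = dkP * (dkP * ((1 - dkc) * v))"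
      by (simp add: hig2_scale[OF closed(3)[OF v]] mult_scaleC_right)
    also have "\<dots> = (dkP * (dkP * (1 - dkc))) * v" by (simp only: mult.assoc)
    also have "\<dots> = 2 *\<^sub>C v" by (simp only: dkP_square hig2_scale[OF closed(3)[OF v]])
    finally show ?thesis by simp
  qed
  have "2 *\<^sub>C (dkK * v) = hig3 * (dkP * v)"
    by (simp add: hig3_def mult.assoc PPv dkK_minus_dkKb[OF closed(3)[OF v]])
  then have "2 *\<^sub>C fold scomm odd_list (dkK * v) = hig3 * fold scomm odd_list (dkP * v)"
    by (simp flip: clinear_scale[OF clinear_fold_scomm] fold_scomm_central[OF hig3_central])
  moreover obtain r where "fold scomm odd_list (dkP * v) = r *\<^sub>C (hig2 :: 'n dk)"
    using fold_scomm_clifford[OF Pv] ..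
  ultimately have "2 *\<^sub>C fold scomm odd_list (dkK * v) = 2 *\<^sub>C r *\<^sub>C (hig3 :: 'n dk)"
    by (simp add: mult_scaleC_right hig_products scaleC_scaleC mult.commute)
  then have "fold scomm odd_list (dkK * v) = r *\<^sub>C (hig3 :: 'n dk)"
    by (simp only: cvs.scale_cancel_left) simp
  then show ?thesis by blast
qed


subsection \<open>Bases of the Higman ideal\<close>

text \<open>\<open>dkK\<close> exchanges the two parts, \<open>dkKb = dkK * dkc\<close> does so up
  to \<epsilon>, and odd generators preserve each part because passing \<open>dkK\<close> costs only
  a sign.\<close>

lemma block_decomposition:
  fixes e :: "'n::{finite,linorder} dk"
  assumes c: "dkc * e = \<epsilon> *\<^sub>C e"
  defines "V \<equiv> cvs.span (range (\<lambda>(A, B). word xi A * (word xib B * e)))"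
  shows "\<exists>u\<in>V. \<exists>v\<in>V. x * e = u + dkK * v"
proof -
  note closed = word_span_closed[OF c, folded V_def]
  have sub: "cvs.subspace V" by (simp add: V_def)
  let ?W = "{y. \<exists>u\<in>V. \<exists>v\<in>V. y = u + dkK * v}"
  have "x * e \<in> ?W"
  proof (rule dk_left_ideal_induct)
    show "cvs.subspace ?W"
    proof (rule cvs.subspaceI)
      show "0 \<in> ?W" using cvs.subspace_0[OF sub] by force
    next
      fix x y assume "x \<in> ?W" "y \<in> ?W"
      then obtain u v u' v' where *: "u \<in> V" "v \<in> V" "u' \<in> V" "v' \<in> V" "x = u + dkK * v" "y = u' + dkK * v'"
        by auto
      then have "x + y = (u + u') + dkK * (v + v')" by (simp add: distrib_left add_ac)
      then show "x + y \<in> ?W" using * cvs.subspace_add[OF sub] by blast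
    next
      fix a x assume "x \<in> ?W"
      then obtain u v where *: "u \<in> V" "v \<in> V" "x = u + dkK * v" by auto
      then have "a *\<^sub>C x = a *\<^sub>C u + dkK * (a *\<^sub>C v)" by (simp add: scaleC_add_right mult_scaleC_right)
      then show "a *\<^sub>C x \<in> ?W" using * cvs.subspace_scale[OF sub] by blast
    qed
    have "e \<in> V" unfolding V_def by (rule cvs.span_base) (auto intro: range_eqI[of _ _ "({}, {})"])
    then show "e \<in> ?W" using cvs.subspace_0[OF sub] by force
    fix g y assume "y \<in> ?W"
    then obtain u v where uv: "u \<in> V" "v \<in> V" "y = u + dkK * v" by auto
    show "dk_gen g * y \<in> ?W"
    proof (cases g)
      case gK
      then have "dk_gen g * y = v + dkK * u" by (simp add: uv(3) distrib_left dk_left_cancel)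
      then show ?thesis using uv by blast
    next
      case gKb
      have "dkKb * u = dkK * (dkc * u)" by (simp add: mult.assoc dk_left_cancel)
      moreover have "dkKb * (dkK * v) = dkc * v" by (simp add: mult.assoc dk_left_commute(1))
      ultimately have "dk_gen g * y = \<epsilon> *\<^sub>C v + dkK * (\<epsilon> *\<^sub>C u)"
        using gKb closed(3)[OF uv(1)] closed(3)[OF uv(2)] by (simp add: uv(3) distrib_left)
      then show ?thesis using uv cvs.subspace_scale[OF sub] by blast
    next
      case (gXi i)
      then have "dk_gen g * y = xi i * u + dkK * (- (xi i * v))"
        by (simp add: uv(3) distrib_left dk_left_commute)
      then show ?thesis using closed(1) uv cvs.subspace_neg[OF sub] by blast
    next
      case (gXib i)
      then have "dk_gen g * y = xib i * u + dkK * (- (xib i * v))"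
        by (simp add: uv(3) distrib_left dk_left_commute)
      then show ?thesis using closed(2) uv cvs.subspace_neg[OF sub] by blast
    qed
  qed
  then show ?thesis by simp
qed

lemma odd_list_nonempty: "odd_list \<noteq> []"
  by (simp add: odd_list_def)

text \<open>Both blocks split into a part without and a part with \<open>dkK\<close>. The four
  pieces contribute zero and multiples of \<open>hig1\<close>, \<open>hig2\<close> and
  \<open>hig3\<close>.\<close>

lemma fold_scomm_range:
  "\<exists>a b c. fold scomm odd_list y = a *\<^sub>C hig1 + b *\<^sub>C hig2 + c *\<^sub>C (hig3 :: 'n::{finite,linorder} dk)"
proof -
  obtain u v where uv: "u \<in> cvs.span (range (\<lambda>(A, B). word xi A * (word xib B * (1 + dkc))))"
    "v \<in> cvs.span (range (\<lambda>(A, B). word xi A * (word xib B * (1 + dkc))))"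
    "y * (1 + dkc) = u + dkK * v"
    using block_decomposition[OF dkc_one_plus, of y] by blast
  obtain u' v' where uv': "u' \<in> cvs.span (range (\<lambda>(A, B). word xi A * (word xib B * (1 - dkc))))"
    "v' \<in> cvs.span (range (\<lambda>(A, B). word xi A * (word xib B * (1 - dkc))))"
    "y * (1 - dkc) = u' + dkK * v'"
    using block_decomposition[OF dkc_one_minus, of y] by blast
  have "y * (1 + dkc) + y * (1 - dkc) = 2 *\<^sub>C y"
    by (simp add: distrib_left right_diff_distrib scaleC_two)
  then have "y = (1/2) *\<^sub>C ((u + dkK * v) + (u' + dkK * v'))"
    using arg_cong[of _ _ "\<lambda>x. (1/2) *\<^sub>C x"] by (fastforce simp: uv uv' scaleC_scaleC)
  then have "fold scomm odd_list y = (1/2) *\<^sub>C ((fold scomm odd_list u + fold scomm odd_list (dkK * v)) +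
      (fold scomm odd_list u' + fold scomm odd_list (dkK * v')))"
    by (simp only: clinear_add[OF clinear_fold_scomm] clinear_scale[OF clinear_fold_scomm])
  moreover have "fold scomm odd_list u = 0"
    by (rule fold_scomm_exterior_zero[OF uv(1) odd_list_nonempty]) (simp add: set_odd_list)
  moreover obtain a where "fold scomm odd_list (dkK * v) = a *\<^sub>C hig1"
    using fold_scomm_exterior_dkK[OF uv(2)] ..
  moreover obtain b where "fold scomm odd_list u' = b *\<^sub>C hig2"
    using fold_scomm_clifford[OF uv'(1)] ..
  moreover obtain c where "fold scomm odd_list (dkK * v') = c *\<^sub>C hig3"
    using fold_scomm_clifford_dkK[OF uv'(2)] ..
  ultimately have "fold scomm odd_list y = (a/2) *\<^sub>C hig1 + (b/2) *\<^sub>C hig2 + (c/2) *\<^sub>C (hig3 :: 'n dk)"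
    by (simp add: scaleC_add_right scaleC_scaleC add.assoc)
  then show ?thesis by blast
qed

definition hig_comb :: "complex \<Rightarrow> complex \<Rightarrow> complex \<Rightarrow> 'n::{finite,linorder} dk"
  where "hig_comb a b c = a *\<^sub>C hig1 + b *\<^sub>C hig2 + c *\<^sub>C hig3"

lemma hig_comb_add: "hig_comb a b c + hig_comb a' b' c' = hig_comb (a + a') (b + b') (c + c')"
  and hig_comb_scale: "r *\<^sub>C hig_comb a b c = hig_comb (r * a) (r * b) (r * c)"
  by (simp_all add: hig_comb_def scaleC_add_left scaleC_add_right scaleC_scaleC add_ac)

text \<open>In the Fock models \<open>hig1\<close> vanishes, and the vacuum entry is twice
  \<open>b + \<eta> * c\<close>; the two signs separate \<open>b\<close> from \<open>c\<close>. The
  top coefficient in the exterior model then isolates \<open>a\<close>.\<close>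

lemma hig_comb_eq_0:
  assumes "even CARD('n)" and 0: "hig_comb a b c = (0 :: 'n::{finite,linorder} dk)"
  shows "a = 0 \<and> b = 0 \<and> c = 0"
proof -
  have "2 * b + 2 * \<eta> * c = 0" if \<eta>: "\<eta> = 1 \<or> \<eta> = -1" for \<eta>
  proof -
    have P: "app (clifford_rep \<eta> dkP) (delta ({} :: 'n set)) = delta {}"
      using assms(1) by (simp add: dkP_def clifford_rep_word[OF \<eta>] clifford_rep_linear[OF \<eta>]
          clifford_rep_one[OF \<eta>] clifford_rep_mult[OF \<eta>] clifford_rep_gen[OF \<eta>]
          word_one_minus_anti_number_op_vacuum)
    have 1: "clifford_rep \<eta> (hig1 :: 'n dk) = 0"
      by (simp add: hig1_def clifford_rep_mult[OF \<eta>] clifford_rep_linear[OF \<eta>] clifford_rep_Kb[OF \<eta>])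
    have 2: "clifford_rep \<eta> (hig2 :: 'n dk) = 2 *\<^sub>C 1"
      by (simp add: hig2_def clifford_rep_linear[OF \<eta>] clifford_rep_dkc[OF \<eta>] clifford_rep_one[OF \<eta>] scaleC_two)
    have 3: "clifford_rep \<eta> (hig3 :: 'n dk) =
        \<eta> *\<^sub>C (par * clifford_rep \<eta> dkP) + \<eta> *\<^sub>C (par * clifford_rep \<eta> dkP)"
      by (simp add: hig3_def clifford_rep_mult[OF \<eta>] clifford_rep_linear[OF \<eta>] clifford_rep_Kb[OF \<eta>]
          clifford_rep_gen(1)[OF \<eta>] mult_scaleC_left distrib_right)
    have "app (clifford_rep \<eta> (hig_comb a b c)) (delta {}) ({} :: 'n set) = 0"
      by (simp add: 0 clifford_rep_linear[OF \<eta>] app_simps)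
    then show ?thesis
      by (simp add: hig_comb_def clifford_rep_linear[OF \<eta>] 1 2 3 app_simps P par_vacuum)
        (simp add: delta_def algebra_simps)
  qed
  from this[of 1] this[of "-1"] have bc: "b = 0" "c = 0" by auto
  have "app (exterior_rep (hig1 :: 'n dk)) (delta ({}, {})) (UNIV, UNIV) = 2"
    by (simp add: hig1_def exterior_rep_mult exterior_rep_linear exterior_rep_gen xi_word_eq xib_word_eq
        exterior_rep_word app_simps word_creR_delta word_creL_delta)
      (simp add: fock_app delta_def)
  moreover have "app (exterior_rep (hig_comb a b c)) (delta ({}, {})) (UNIV :: 'n set, UNIV :: 'n set) = 0"
    by (simp add: 0 exterior_rep_linear app_simps)
  ultimately have "a = 0"
    by (simp add: hig_comb_def bc exterior_rep_linear app_simps)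
  then show ?thesis using bc by simp
qed

text \<open>Since \<open>xi i\<close> kills the longest word, \<open>xi i * xib i\<close> acts on it
  as \<open>1 - dkc\<close>, so each factor of \<open>dkP\<close> acts as \<open>dkc\<close>. An
  even number of these cancels.\<close>

lemma dkP_top:
  assumes "even CARD('n)"
  shows "dkP * dk_top = (dk_top :: 'n::{finite,linorder} dk)"
proof -
  have h: "(1 - xi i * xib i) * dk_top = dkc * dk_top" for i :: 'n
  proof -
    have "xi i * xib i * dk_top = (1 - dkc) * dk_top - xib i * (xi i * xi_word UNIV) * xib_word UNIV"
      using arg_cong[OF xi_xib_commutator(1)[of i i], of "\<lambda>y. y * dk_top"]
      by (simp add: left_diff_distrib mult.assoc)
    then show ?thesis by (simp add: left_diff_distrib xi_top)
  qed
  have "word (\<lambda>i. 1 - xi i * xib i) A * dk_top = dkc ^ card A * (dk_top :: 'n dk)" for A :: "'n set"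
    using finite[of A]
  proof (induction A rule: finite_linorder_min_induct)
    case (insert b A)
    then have "b \<notin> A" by auto
    have pow: "x * dkc ^ k = dkc ^ k * x" for x :: "'n dk" and k
      by (induction k) (simp_all add: mult.assoc, metis dkc_central mult.assoc)
    have "word (\<lambda>i. 1 - xi i * xib i) (insert b A) * (dk_top :: 'n dk) =
        ((1 - xi b * xib b) * dkc ^ card A) * dk_top"
      using insert by (simp only: word_insert_min mult.assoc)
    also have "\<dots> = dkc ^ card A * ((1 - xi b * xib b) * dk_top)"
      by (simp only: pow mult.assoc)
    finally show ?case
      by (simp only: card_insert_disjoint[OF insert(1) \<open>b \<notin> A\<close>] h power_Suc2 mult.assoc)
  qed simp
  moreover have "dkc ^ CARD('n) = (1 :: 'n dk)"
    using assms by (elim evenE) (simp add: power_mult power2_eq_square dkc_square)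
  ultimately show ?thesis by (simp add: dkP_def)
qed

text \<open>\<open>idem_1\<close> has the parts \<open>1 + dkc\<close> and
  \<open>dkK * (1 + dkc)\<close>. The first is killed; on the second every commutator doubles, and
  the result is a multiple of \<open>hig1\<close>.\<close>

lemma trace_map_idem_1:
  "trace_map (idem_1 :: 'n::{finite,linorder} dk) = hig_comb (2 ^ (2 * CARD('n)) / 2) 0 0"
proof -
  let ?p = "1 + dkc :: 'n dk" and ?V = "cvs.span (range (\<lambda>(A, B). word xi A * (word xib B * (1 + dkc :: 'n dk))))"
  have p: "?p \<in> ?V" by (rule cvs.span_base) (auto intro: range_eqI[of _ _ "({}, {})"])
  have e: "idem_1 = (1/4) *\<^sub>C (?p + dkK * ?p)"
    by (simp add: idem_1_def distrib_left dk_left_cancel add_ac)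
  have "dkK * idem_1 = (idem_1 :: 'n dk)" "idem_1 * dkK = (idem_1 :: 'n dk)"
    by (simp_all add: idem_1_def mult_scaleC_left mult_scaleC_right distrib_left distrib_right
        dk_left_cancel dk_relations(1,2) dk_commute(1) mult.assoc add_ac)
  then have "idem_1 * dkK + dkK * idem_1 = (1/2) *\<^sub>C (?p + dkK * ?p)"
    by (simp add: e scaleC_scaleC flip: scaleC_add_left)
  then have "trace_map idem_1 = (1/2) *\<^sub>C (fold scomm odd_list ?p + fold scomm odd_list (dkK * ?p))"
    unfolding trace_map_eq by (simp only: clinear_add[OF clinear_fold_scomm] clinear_scale[OF clinear_fold_scomm])
  moreover have "fold scomm odd_list ?p = 0"
    by (rule fold_scomm_exterior_zero[OF p odd_list_nonempty]) (simp add: set_odd_list)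
  \<comment> \<open>Any odd generator can be inserted, since the first conjunct does not mention
    it.\<close>
  moreover have "(1 - dkc) * ?p = 0"
    using exterior_block_words[OF p, of "xi undefined"] by (simp add: odd_gens_def)
  then have "fold scomm odd_list (dkK * ?p) = 2 ^ length (odd_list :: 'n dk list) *\<^sub>C (dkK * ?p * dk_top)"
    using exterior_block_words[OF p] fold_scomm_exterior[of ?p odd_list]
    by (auto simp: set_odd_list prod_list_odd_list)
  ultimately show ?thesis
    by (simp add: hig1_eq hig_comb_def scaleC_scaleC odd_list_def mult_2)
qed

lemma trace_map_clifford:
  fixes e :: "'n::{finite,linorder} dk"
  assumes \<eta>: "\<eta> = 1 \<or> \<eta> = -1" and n: "even CARD('n)"
    and e: "e = k *\<^sub>C ((1 + \<eta> *\<^sub>C dkK - \<eta> *\<^sub>C dkKb - dkc) * dk_top)"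
  shows "trace_map e = hig_comb 0 (2 * k * 2 ^ (2 * CARD('n)) * \<eta>) (2 * k * 2 ^ (2 * CARD('n)))"
proof -
  let ?g = "1 + \<eta> *\<^sub>C dkK - \<eta> *\<^sub>C dkKb - (dkc :: 'n dk)"
  have "dkK * ?g = \<eta> *\<^sub>C (1 - dkc) + (dkK - dkKb)"
    using \<eta> by (auto simp: algebra_simps dk_left_cancel dk_relations(1))
  moreover have "?g * dkK = \<eta> *\<^sub>C (1 - dkc) + (dkK - dkKb)"
    using \<eta> by (auto simp: algebra_simps dk_left_cancel dk_relations(1) dk_commute(1))
  moreover have "?g * dk_top * dkK = (?g * dkK) * dk_top"
    by (simp only: mult.assoc[of ?g] top_dkK)
  ultimately have "e * dkK + dkK * e =
      (2 * k) *\<^sub>C (\<eta> *\<^sub>C ((1 - dkc) * dk_top) + (dkK - dkKb) * dk_top)"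
    using scaleC_two[of "k *\<^sub>C (\<eta> *\<^sub>C ((1 - dkc) * dk_top) + (dkK - dkKb) * (dk_top :: 'n dk))"]
    by (simp add: e mult_scaleC_left mult_scaleC_right distrib_right scaleC_scaleC flip: mult.assoc)
  \<comment> \<open>As \<open>dkP\<close> fixes the longest word it can be inserted, which produces
    the central \<open>hig3\<close>.\<close>
  also have "(dkK - dkKb) * dk_top = hig3 * (dk_top :: 'n dk)"
    by (simp only: hig3_def mult.assoc dkP_top[OF n])
  finally have "trace_map e = (2 * k) *\<^sub>C (\<eta> *\<^sub>C fold scomm odd_list ((1 - dkc) * dk_top) +
      fold scomm odd_list (hig3 * dk_top))"
    unfolding trace_map_eq by (simp only: clinear_add[OF clinear_fold_scomm] clinear_scale[OF clinear_fold_scomm])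
  moreover have "hig3 * (1 - dkc) ^ m = 2 ^ m *\<^sub>C (hig3 :: 'n dk)" for m
  proof (induction m)
    case (Suc m)
    have "hig3 * (1 - dkc) ^ Suc m = (hig3 * (1 - dkc) ^ m) * (1 - dkc :: 'n dk)"
      by (simp only: power_Suc2 mult.assoc)
    also have "\<dots> = 2 ^ m *\<^sub>C (hig3 * hig2)" by (simp only: Suc mult_scaleC_left hig2_def)
    finally show ?case by (simp add: hig_products scaleC_scaleC mult.commute)
  qed simp
  then have "fold scomm odd_list (hig3 * dk_top) = 2 ^ (2 * CARD('n)) *\<^sub>C (hig3 :: 'n dk)"
    by (simp add: fold_scomm_central[OF hig3_central] fold_scomm_top)
  ultimately show ?thesis
    by (simp add: fold_scomm_top_block hig_comb_def scaleC_add_right scaleC_scaleC mult_ac)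
qed

lemma trace_map_idem_K:
  assumes n: "even CARD('n)"
  shows "trace_map (idem_K :: 'n::{finite,linorder} dk) =
      hig_comb 0 ((-1) ^ (CARD('n) div 2) * 2 ^ CARD('n) / 2) ((-1) ^ (CARD('n) div 2) * 2 ^ CARD('n) / 2)"
    and "trace_map (idem_Kb :: 'n dk) =
      hig_comb 0 (- ((-1) ^ (CARD('n) div 2) * 2 ^ CARD('n) / 2)) ((-1) ^ (CARD('n) div 2) * 2 ^ CARD('n) / 2)"
proof -
  have pow: "2 * ((-1) ^ (CARD('n) div 2) / 2 ^ (CARD('n) + 2)) * 2 ^ (2 * CARD('n)) =
      ((-1) ^ (CARD('n) div 2) * 2 ^ CARD('n) / 2 :: complex)"
    using power_add[of "2 :: complex" "CARD('n)" "CARD('n)"] by (simp add: power_add flip: mult_2)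
  show "trace_map (idem_K :: 'n dk) =
      hig_comb 0 ((-1) ^ (CARD('n) div 2) * 2 ^ CARD('n) / 2) ((-1) ^ (CARD('n) div 2) * 2 ^ CARD('n) / 2)"
    by (subst trace_map_clifford[of 1, OF _ n, where k = "(-1) ^ (CARD('n) div 2) / 2 ^ (CARD('n) + 2)"])
      (simp_all only: pow, simp_all add: idem_K_def mult.assoc)
  show "trace_map (idem_Kb :: 'n dk) =
      hig_comb 0 (- ((-1) ^ (CARD('n) div 2) * 2 ^ CARD('n) / 2)) ((-1) ^ (CARD('n) div 2) * 2 ^ CARD('n) / 2)"
    by (subst trace_map_clifford[of "-1", OF _ n, where k = "(-1) ^ (CARD('n) div 2) / 2 ^ (CARD('n) + 2)"])
      (simp_all only: pow, simp_all add: idem_Kb_def mult.assoc)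
qed

text \<open>\<open>(k + 1) div 2\<close> and \<open>k + k div 2\<close> have the same parity, so the
  signs in the ribbon element are those of the expansion of \<open>dkP\<close>.\<close>

lemma ribbon_eq: "ribbon = (1/2) *\<^sub>C ((1 + dkK - dkKb + dkc) * dkP)"
proof -
  have "(-1 :: complex) ^ ((k + 1) div 2) = (-1) ^ k * (-1) ^ (k div 2)" for k :: nat
    by (cases "even k") (auto elim!: evenE oddE)
  then show ?thesis
    by (simp add: ribbon_def dkP_eq_sum sum_distrib_left mult_scaleC_right cvs.scale_sum_right scaleC_scaleC)
qed

lemma ribbon_hig:
  assumes "even CARD('n)"
  shows "ribbon * hig1 = (hig1 :: 'n::{finite,linorder} dk)"
    and "ribbon * hig2 = (hig3 :: 'n dk)" and "ribbon * hig3 = (hig2 :: 'n dk)"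
proof -
  let ?g = "1 + dkK - dkKb + (dkc :: 'n dk)"
  have g1: "?g * (dkK + dkKb) = 2 *\<^sub>C (dkK + dkKb)" and g2: "?g * (1 - dkc) = 2 *\<^sub>C (dkK - dkKb)"
    unfolding scaleC_two
    by (simp_all add: algebra_simps dk_left_cancel dk_left_commute(1) dk_commute(1) dk_relations(1,2))
  have "dkP * (dkK + dkKb) = (dkK + dkKb) * (dkP :: 'n dk)"
    by (simp add: distrib_left distrib_right dkP_commute)
  then have "ribbon * hig1 = (1/2) *\<^sub>C ((?g * (dkK + dkKb)) * (dkP * dk_top))"
    unfolding ribbon_eq hig1_def mult_scaleC_left by (metis mult.assoc)
  then show "ribbon * hig1 = (hig1 :: 'n dk)"
    by (simp only: g1 dkP_top[OF assms]) (simp add: mult_scaleC_left scaleC_scaleC hig1_def)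
  have "ribbon * hig2 = (1/2) *\<^sub>C ((?g * (1 - dkc)) * dkP)"
    unfolding ribbon_eq hig2_def mult_scaleC_left mult.assoc one_minus_dkc_central[of dkP] ..
  then show r2: "ribbon * hig2 = (hig3 :: 'n dk)"
    by (simp only: g2) (simp add: mult_scaleC_left scaleC_scaleC hig3_def)
  \<comment> \<open>Writing twice \<open>hig3\<close> as \<open>hig2 * hig3\<close> reduces this to
    the product already known and the square of \<open>hig3\<close>.\<close>
  have "2 *\<^sub>C (ribbon * hig3) = ribbon * (hig2 * (hig3 :: 'n dk))"
    by (simp add: hig3_central hig_products mult_scaleC_right)
  also have "\<dots> = 2 *\<^sub>C hig2" by (simp only: r2 hig_products(2) flip: mult.assoc)
  finally show "ribbon * hig3 = (hig2 :: 'n dk)" by (simp only: cvs.scale_cancel_left) simp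
qed

lemma ribbon_hig_comb:
  "even CARD('n) \<Longrightarrow> ribbon * hig_comb a b c = (hig_comb a c b :: 'n::{finite,linorder} dk)"
  by (simp add: hig_comb_def distrib_left mult_scaleC_right ribbon_hig add_ac)

lemma higman_ideal_eq:
  assumes n: "even CARD('n)"
  shows "(higman_ideal :: 'n::{finite,linorder} dk set) = {y. \<exists>a b c. y = hig_comb a b c}"
proof (intro equalityI subsetI)
  fix y :: "'n dk" assume "y \<in> higman_ideal"
  then show "y \<in> {y. \<exists>a b c. y = hig_comb a b c}"
    using fold_scomm_range by (auto simp: higman_ideal_def trace_map_eq hig_comb_def)
next
  fix y :: "'n dk" assume "y \<in> {y. \<exists>a b c. y = hig_comb a b c}"
  then obtain a b c where y: "y = hig_comb a b c" by blast
  define t :: complex where "t = (-1) ^ (CARD('n) div 2) * 2 ^ CARD('n) / 2"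
  have t: "t \<noteq> 0" by (simp add: t_def)
  have lin: "clinear (trace_map :: 'n dk \<Rightarrow> 'n dk)"
    by (rule clinearI) (simp_all add: trace_map_eq distrib_left distrib_right mult_scaleC_left
        mult_scaleC_right add_ac flip: clinear_add[OF clinear_fold_scomm] clinear_scale[OF clinear_fold_scomm]
        scaleC_add_right)
  \<comment> \<open>The traces of \<open>idem_K\<close> and \<open>idem_Kb\<close> are t times
    \<open>hig3 + hig2\<close> and \<open>hig3 - hig2\<close>; solving for the coordinates
    \<open>b\<close> and \<open>c\<close> gives these coefficients.\<close>
  have "trace_map ((2 * a / 2 ^ (2 * CARD('n))) *\<^sub>C idem_1 + ((b + c) / (2 * t)) *\<^sub>C idem_K +
      ((c - b) / (2 * t)) *\<^sub>C idem_Kb) = y"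
    using t unfolding clinear_add[OF lin] clinear_scale[OF lin] trace_map_idem_1
      trace_map_idem_K[OF n, folded t_def] hig_comb_scale hig_comb_add y
    by (simp add: field_simps)
  then show "y \<in> higman_ideal" unfolding higman_ideal_def by blast
qed

lemma subspace_higman_ideal:
  assumes "even CARD('n)"
  shows "cvs.subspace (higman_ideal :: 'n::{finite,linorder} dk set)"
proof (rule cvs.subspaceI)
  have "(0 :: 'n dk) = hig_comb 0 0 0" by (simp add: hig_comb_def)
  then show "(0 :: 'n dk) \<in> higman_ideal" unfolding higman_ideal_eq[OF assms] by blast
next
  fix x y :: "'n dk" assume "x \<in> higman_ideal" "y \<in> higman_ideal"
  then show "x + y \<in> higman_ideal" unfolding higman_ideal_eq[OF assms] using hig_comb_add by blast
next
  fix r and x :: "'n dk" assume "x \<in> higman_ideal"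
  then show "r *\<^sub>C x \<in> higman_ideal" unfolding higman_ideal_eq[OF assms] using hig_comb_scale by blast
qed


section \<open>The Cohen--Westreich matrices\<close>

text \<open>\<open>N\<close> is 2^(n-1) and \<open>2 * N * N\<close> is half of 2^(2n), so that all
  coordinates are monomials in \<open>N\<close> and the sign \<open>s\<close>.\<close>

lemma B_chi_nth:
  assumes "even CARD('n)"
  defines "N \<equiv> 2 ^ CARD('n) / 2 :: complex" and "s \<equiv> (-1) ^ (CARD('n) div 2) :: complex"
  shows "(B_chi :: ('n::{finite,linorder} dk)^3) $ 1 = hig_comb 0 (2 * N * N) 0"
    and "(B_chi :: ('n dk)^3) $ 2 = hig_comb (s * N) 0 N"
    and "(B_chi :: ('n dk)^3) $ 3 = hig_comb (- (s * N)) 0 N"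
proof -
  have "(2 :: complex) ^ (2 * CARD('n)) / 2 = 2 * N * N"
    using power_add[of "2 :: complex" "CARD('n)" "CARD('n)"] by (simp add: N_def flip: mult_2)
  then show "(B_chi :: ('n dk)^3) $ 1 = hig_comb 0 (2 * N * N) 0"
    by (simp add: B_chi_def idems_def module_character_idem_1 drinfeld_map_exterior hig_comb_def hig2_def)
  show "(B_chi :: ('n dk)^3) $ 2 = hig_comb (s * N) 0 N"
    and "(B_chi :: ('n dk)^3) $ 3 = hig_comb (- (s * N)) 0 N"
    by (simp_all add: B_chi_def idems_def module_character_idem_K module_character_idem_Kb
        drinfeld_map_clifford assms(1) hig_comb_def hig1_def hig3_def N_def s_def add.commute)
qed

lemma B_tau_nth:
  assumes "even CARD('n)"
  defines "N \<equiv> 2 ^ CARD('n) / 2 :: complex" and "s \<equiv> (-1) ^ (CARD('n) div 2) :: complex"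
  shows "(B_tau :: ('n::{finite,linorder} dk)^3) $ 1 = hig_comb (2 * N * N) 0 0"
    and "(B_tau :: ('n dk)^3) $ 2 = hig_comb 0 (s * N) (s * N)"
    and "(B_tau :: ('n dk)^3) $ 3 = hig_comb 0 (- (s * N)) (s * N)"
proof -
  have "(2 :: complex) ^ (2 * CARD('n)) / 2 = 2 * N * N"
    using power_add[of "2 :: complex" "CARD('n)" "CARD('n)"] by (simp add: N_def flip: mult_2)
  then show "(B_tau :: ('n dk)^3) $ 1 = hig_comb (2 * N * N) 0 0"
    by (simp add: B_tau_def idems_def trace_map_idem_1 mult.assoc)
  show "(B_tau :: ('n dk)^3) $ 2 = hig_comb 0 (s * N) (s * N)"
    and "(B_tau :: ('n dk)^3) $ 3 = hig_comb 0 (- (s * N)) (s * N)"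
    by (simp_all add: B_tau_def idems_def trace_map_idem_K assms(1) N_def s_def)
qed

lemma ordered_basis_B_chi:
  assumes n: "even CARD('n)"
  shows "ordered_basis (B_chi :: ('n::{finite,linorder} dk)^3) higman_ideal"
proof (rule ordered_basis_3I)
  define N s :: complex where Ns: "N = 2 ^ CARD('n) / 2" "s = (-1) ^ (CARD('n) div 2)"
  note b = B_chi_nth[OF n, folded Ns]
  have [simp]: "N \<noteq> 0" "s \<noteq> 0" by (simp_all add: Ns)
  have comb: "p *\<^sub>C B_chi $ 1 + q *\<^sub>C B_chi $ 2 + r *\<^sub>C B_chi $ 3 =
      (hig_comb (s * N * (q - r)) (2 * N * N * p) (N * (q + r)) :: 'n dk)" for p q r
    by (simp add: b hig_comb_scale hig_comb_add algebra_simps)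
  show "p = 0 \<and> q = 0 \<and> r = 0"
    if "p *\<^sub>C B_chi $ 1 + q *\<^sub>C B_chi $ 2 + r *\<^sub>C (B_chi $ 3 :: 'n dk) = 0" for p q r
    using hig_comb_eq_0[OF n that[unfolded comb]] by auto
  show "cvs.subspace (higman_ideal :: 'n dk set)" by (rule subspace_higman_ideal[OF n])
  show "(B_chi :: ('n dk)^3) $ k \<in> higman_ideal" for k
    using exhaust_3[of k] b unfolding higman_ideal_eq[OF n] by blast
  fix x :: "'n dk" assume "x \<in> higman_ideal"
  then obtain a b c where "x = hig_comb a b c" unfolding higman_ideal_eq[OF n] by blast
  \<comment> \<open>The second and third vectors differ only in the sign of \<open>hig1\<close>;
    half sum and half difference of the normalised coordinates invert the system.\<close>
  then have "x = (b / (2 * N * N)) *\<^sub>C B_chi $ 1 + ((c / N + a / (s * N)) / 2) *\<^sub>C B_chi $ 2 +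
      ((c / N - a / (s * N)) / 2) *\<^sub>C B_chi $ 3"
    unfolding comb by (simp add: field_simps)
  then show "\<exists>p q r. x = p *\<^sub>C B_chi $ 1 + q *\<^sub>C B_chi $ 2 + r *\<^sub>C B_chi $ 3" by blast
qed

lemma ordered_basis_B_tau:
  assumes n: "even CARD('n)"
  shows "ordered_basis (B_tau :: ('n::{finite,linorder} dk)^3) higman_ideal"
proof (rule ordered_basis_3I)
  define N s :: complex where Ns: "N = 2 ^ CARD('n) / 2" "s = (-1) ^ (CARD('n) div 2)"
  note b = B_tau_nth[OF n, folded Ns]
  have [simp]: "N \<noteq> 0" "s \<noteq> 0" by (simp_all add: Ns)
  have comb: "p *\<^sub>C B_tau $ 1 + q *\<^sub>C B_tau $ 2 + r *\<^sub>C B_tau $ 3 =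
      (hig_comb (2 * N * N * p) (s * N * (q - r)) (s * N * (q + r)) :: 'n dk)" for p q r
    by (simp add: b hig_comb_scale hig_comb_add algebra_simps)
  show "p = 0 \<and> q = 0 \<and> r = 0"
    if "p *\<^sub>C B_tau $ 1 + q *\<^sub>C B_tau $ 2 + r *\<^sub>C (B_tau $ 3 :: 'n dk) = 0" for p q r
    using hig_comb_eq_0[OF n that[unfolded comb]] by auto
  show "cvs.subspace (higman_ideal :: 'n dk set)" by (rule subspace_higman_ideal[OF n])
  show "(B_tau :: ('n dk)^3) $ k \<in> higman_ideal" for k
    using exhaust_3[of k] b unfolding higman_ideal_eq[OF n] by blast
  fix x :: "'n dk" assume "x \<in> higman_ideal"
  then obtain a b c where "x = hig_comb a b c" unfolding higman_ideal_eq[OF n] by blast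
  then have "x = (a / (2 * N * N)) *\<^sub>C B_tau $ 1 + ((c + b) / (2 * s * N)) *\<^sub>C B_tau $ 2 +
      ((c - b) / (2 * s * N)) *\<^sub>C B_tau $ 3"
    unfolding comb by (simp add: field_simps)
  then show "\<exists>p q r. x = p *\<^sub>C B_tau $ 1 + q *\<^sub>C B_tau $ 2 + r *\<^sub>C B_tau $ 3" by blast
qed

theorem corollary7p3p9:
  fixes n :: nat
  assumes "n = CARD('n::{finite,linorder})"
    and "n \<ge> 2"
    and "even n"
  shows "ordered_basis (B_chi :: ('n dk)^3) higman_ideal \<and>
    ordered_basis (B_tau :: ('n dk)^3) higman_ideal \<and>
    S_CW TYPE('n) = (-1) ^ (n div 2) *\<^sub>R
      vector [vector [0, 1 / 2 ^ n, - (1 / 2 ^ n)],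
              vector [2 ^ (n - 1), 1/2, 1/2],
              vector [- (2 ^ (n - 1)), 1/2, 1/2]] \<and>
    T_CW TYPE('n) =
      vector [vector [1, 0, 0],
              vector [0, 1, 0],
              vector [0, 0, -1]]"
proof (intro conjI)
  have n: "even CARD('n)" using assms by simp
  define N s :: complex where Ns: "N = 2 ^ CARD('n) / 2" "s = (-1) ^ (CARD('n) div 2)"
  have N: "N \<noteq> 0" by (simp add: Ns)
  have s: "s * s = 1" "s * (s * x) = x" for x by (simp_all add: Ns flip: power_mult_distrib mult.assoc)
  have pow: "2 ^ n = 2 * N" "2 ^ (n - Suc 0) = N"
    using assms(1,2) by (simp_all add: Ns power_diff)
  have sgn: "(-1) ^ (n div 2) *\<^sub>R x = s * x" for x
    using assms(1) by (simp add: Ns scaleR_conv_of_real)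
  note nth = B_chi_nth[OF n, folded Ns] B_tau_nth[OF n, folded Ns]
  show chi: "ordered_basis (B_chi :: ('n dk)^3) higman_ideal" by (rule ordered_basis_B_chi[OF n])
  show tau: "ordered_basis (B_tau :: ('n dk)^3) higman_ideal" by (rule ordered_basis_B_tau[OF n])
  show "S_CW TYPE('n) = (-1) ^ (n div 2) *\<^sub>R
      vector [vector [0, 1 / 2 ^ n, - (1 / 2 ^ n)],
              vector [2 ^ (n - 1), 1/2, 1/2],
              vector [- (2 ^ (n - 1)), 1/2, 1/2]]"
    unfolding S_CW_def
  proof (rule coord_matrix_eqI[OF chi])
    \<comment> \<open>The columns are tau_1 = s N (chi_2 - chi_3) and tau_2, tau_3 = s (chi_2 +
      chi_3) / 2 plus or minus s chi_1 / (2 N).\<close>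
    fix j :: 3
    show "(B_tau :: ('n dk)^3) $ j = (\<Sum>k\<in>UNIV. ((-1) ^ (n div 2) *\<^sub>R
        vector [vector [0, 1 / 2 ^ n, - (1 / 2 ^ n)],
              vector [2 ^ (n - 1), 1/2, 1/2],
              vector [- (2 ^ (n - 1)), 1/2, 1/2]]) $ k $ j *\<^sub>C B_chi $ k)"
      using exhaust_3[of j] N
      by (auto simp: sum_3 vector_scaleR_component sgn pow nth hig_comb_scale hig_comb_add s mult.assoc field_simps)
  qed
  show "T_CW TYPE('n) = vector [vector [1, 0, 0], vector [0, 1, 0], vector [0, 0, -1]]"
    unfolding T_CW_def
  proof (rule coord_matrix_eqI[OF tau])
    \<comment> \<open>Multiplication by \<open>ribbon\<close> exchanges the coordinates of
      \<open>hig2\<close> and \<open>hig3\<close>: the second vector of \<open>B_tau\<close> is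
      symmetric in them and the third antisymmetric.\<close>
    fix j :: 3
    show "(\<chi> k. T_LM (B_tau $ k :: 'n dk)) $ j =
        (\<Sum>k\<in>UNIV. vector [vector [1, 0, 0], vector [0, 1, 0], vector [0, 0, -1]] $ k $ j *\<^sub>C B_tau $ k)"
      using exhaust_3[of j]
      by (auto simp: sum_3 T_LM_def nth ribbon_hig_comb[OF n] hig_comb_scale hig_comb_add)
  qed
qed

end
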